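(* The general distance minimisation problem is undecidable.
   Context: An MDP is $\mathcal D=(S,Act,L,\varphi,\ell)$ with finite $S,Act,L$, a partial function $\varphi:S\times Act\rightharpoonup\mathrm{Distr}(S)$ (rational probabilities) and labelling $\ell:S\to L$. A path is $s_0{\sf m}_1s_1\cdots{\sf m}_ns_n$ with $\varphi(s_i,{\sf m}_{i+1})$ defined and $\varphi(s_i,{\sf m}_{i+1})(s_{i+1})>0$. A general strategy $\alpha$ maps each path to a distribution over actions available at its last state; it induces the (possibly infinite) LMC $\mathcal D(\alpha)$ whose states are paths, with transition $\tau(\rho)(\rho{\sf m}t)=\alpha(\rho)({\sf m})\varphi({\sf last}(\rho),{\sf m})(t)$ and label of $\rho$ the label of its last state; a state $s\in S$ is identified with the one-state path $s$. For an LMC $(S,L,\tau,\ell)$ the probabilistic bisimilarity distance $d$ is the least fixed point of $\Delta(e)(s,t)=1$ if $\ell(s)\ne\ell(t)$, and otherwise $\Delta(e)(s,t)=\min_{\omega\in\Omega(\tau(s),\tau(t))}\sum_{u,v}\omega(u,v)e(u,v)$, where $\Omega(\mu,\nu)$ is the set of couplings of $\mu,\nu$ (distributions on $S\times S$ with marginals $\mu,\nu$). The general distance minimisation problem asks, given an MDP, two states $s_1,s_2$ and a rational $\theta$, whether there is a general strategy $\alpha$ with $d(s_1,s_2)<\theta$ in $\mathcal D(\alpha)$. *)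

theory Defs
  imports "HOL-Probability.Probability" "HOL-Library.Nat_Bijection"
begin

datatype recf = Zero | Succ | Proj nat | Comp recf "recf list" | Prim recf recf | Mu recf

inductive recf_eval :: "recf \<Rightarrow> nat list \<Rightarrow> nat \<Rightarrow> bool" where
  zero: "recf_eval Zero xs 0"
| succ: "recf_eval Succ (x # xs) (Suc x)"
| proj: "i < length xs \<Longrightarrow> recf_eval (Proj i) xs (xs ! i)"
| comp: "list_all2 (\<lambda>g y. recf_eval g xs y) gs ys \<Longrightarrow> recf_eval f ys z \<Longrightarrow> recf_eval (Comp f gs) xs z"
| prim0: "recf_eval f xs z \<Longrightarrow> recf_eval (Prim f g) (0 # xs) z"
| primS: "recf_eval (Prim f g) (n # xs) r \<Longrightarrow> recf_eval g (r # n # xs) z \<Longrightarrow>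
          recf_eval (Prim f g) (Suc n # xs) z"
| mu: "recf_eval f (n # xs) 0 \<Longrightarrow> (\<forall>k<n. \<exists>y. y \<noteq> 0 \<and> recf_eval f (k # xs) y) \<Longrightarrow>
       recf_eval (Mu f) xs n"

text \<open>States are 0..<n_states, actions 0..<n_acts, labels are naturals (lab ! s is the label of s).
  trans lists the defined entries of the partial function phi: an entry (s, m, ps) means
  phi(s,m)(t) = ps ! t.\<close>
record dm_instance =
  n_states :: nat
  n_acts :: nat
  lab :: "nat list"
  trans :: "(nat \<times> nat \<times> rat list) list"
  src1 :: nat
  src2 :: nat
  thr :: rat

definition phi :: "dm_instance \<Rightarrow> nat \<Rightarrow> nat \<Rightarrow> rat list option" where
  "phi I s m = map_of (map (\<lambda>(s, m, ps). ((s, m), ps)) (trans I)) (s, m)"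

definition enabled :: "dm_instance \<Rightarrow> nat \<Rightarrow> nat set" where
  "enabled I s = {m. phi I s m \<noteq> None}"

definition valid_instance :: "dm_instance \<Rightarrow> bool" where
  "valid_instance I \<longleftrightarrow>
     length (lab I) = n_states I \<and>
     distinct (map (\<lambda>(s, m, ps). (s, m)) (trans I)) \<and>
     (\<forall>(s, m, ps) \<in> set (trans I). s < n_states I \<and> m < n_acts I \<and>
        length ps = n_states I \<and> (\<forall>p \<in> set ps. 0 \<le> p) \<and> sum_list ps = 1) \<and>
     src1 I < n_states I \<and> src2 I < n_states I"

definition dist_pmf :: "rat list \<Rightarrow> nat pmf" where
  "dist_pmf ps = embed_pmf (\<lambda>t. if t < length ps then real_of_rat (ps ! t) else 0)"

text \<open>A path s0 m1 s1 ... mn sn is represented as (s0, [(m1,s1), ..., (mn,sn)]).\<close>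
type_synonym path = "nat \<times> (nat \<times> nat) list"

fun steps_ok :: "dm_instance \<Rightarrow> nat \<Rightarrow> (nat \<times> nat) list \<Rightarrow> bool" where
  "steps_ok I s [] = True"
| "steps_ok I s ((m, t) # r) =
     (case phi I s m of None \<Rightarrow> False
      | Some ps \<Rightarrow> t < length ps \<and> 0 < ps ! t \<and> steps_ok I t r)"

definition is_path :: "dm_instance \<Rightarrow> path \<Rightarrow> bool" where
  "is_path I \<rho> \<longleftrightarrow> fst \<rho> < n_states I \<and> steps_ok I (fst \<rho>) (snd \<rho>)"

definition last_st :: "path \<Rightarrow> nat" where
  "last_st \<rho> = (if snd \<rho> = [] then fst \<rho> else snd (last (snd \<rho>)))"

definition extend :: "path \<Rightarrow> nat \<Rightarrow> nat \<Rightarrow> path" where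
  "extend \<rho> m t = (fst \<rho>, snd \<rho> @ [(m, t)])"

definition is_strategy :: "dm_instance \<Rightarrow> (path \<Rightarrow> nat pmf) \<Rightarrow> bool" where
  "is_strategy I \<alpha> \<longleftrightarrow> (\<forall>\<rho>. is_path I \<rho> \<longrightarrow> set_pmf (\<alpha> \<rho>) \<subseteq> enabled I (last_st \<rho>))"

text \<open>Transition function of the LMC D(alpha) (states = paths; non-paths are made absorbing
  and are unreachable from paths).\<close>
definition lmc_tau :: "dm_instance \<Rightarrow> (path \<Rightarrow> nat pmf) \<Rightarrow> path \<Rightarrow> path pmf" where
  "lmc_tau I \<alpha> \<rho> =
     (if is_path I \<rho> then
        bind_pmf (\<alpha> \<rho>) (\<lambda>m. map_pmf (extend \<rho> m) (dist_pmf (the (phi I (last_st \<rho>) m))))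
      else return_pmf \<rho>)"

definition lmc_lab :: "dm_instance \<Rightarrow> path \<Rightarrow> nat" where
  "lmc_lab I \<rho> = lab I ! last_st \<rho>"

definition couplings :: "'s pmf \<Rightarrow> 's pmf \<Rightarrow> ('s \<times> 's) pmf set" where
  "couplings \<mu> \<nu> = {\<omega>. map_pmf fst \<omega> = \<mu> \<and> map_pmf snd \<omega> = \<nu>}"

definition Delta :: "('s \<Rightarrow> 's pmf) \<Rightarrow> ('s \<Rightarrow> 'l) \<Rightarrow> ('s \<Rightarrow> 's \<Rightarrow> real) \<Rightarrow> 's \<Rightarrow> 's \<Rightarrow> real" where
  "Delta \<tau> lb e s t =
     (if lb s \<noteq> lb t then 1
      else (INF \<omega> \<in> couplings (\<tau> s) (\<tau> t). measure_pmf.expectation \<omega> (\<lambda>(u, v). e u v)))"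

definition Delta_fixpoints :: "('s \<Rightarrow> 's pmf) \<Rightarrow> ('s \<Rightarrow> 'l) \<Rightarrow> ('s \<Rightarrow> 's \<Rightarrow> real) set" where
  "Delta_fixpoints \<tau> lb = {e. (\<forall>s t. 0 \<le> e s t \<and> e s t \<le> 1) \<and> Delta \<tau> lb e = e}"

definition bisim_dist :: "('s \<Rightarrow> 's pmf) \<Rightarrow> ('s \<Rightarrow> 'l) \<Rightarrow> 's \<Rightarrow> 's \<Rightarrow> real" where
  "bisim_dist \<tau> lb = (THE d. d \<in> Delta_fixpoints \<tau> lb \<and>
                         (\<forall>e \<in> Delta_fixpoints \<tau> lb. \<forall>s t. d s t \<le> e s t))"

definition gen_dist_min_yes :: "dm_instance \<Rightarrow> bool" where
  "gen_dist_min_yes I \<longleftrightarrow>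
     (\<exists>\<alpha>. is_strategy I \<alpha> \<and>
        bisim_dist (lmc_tau I \<alpha>) (lmc_lab I) (src1 I, []) (src2 I, []) < real_of_rat (thr I))"

definition rat_code :: "rat \<Rightarrow> nat" where
  "rat_code r = prod_encode (int_encode (fst (quotient_of r)), int_encode (snd (quotient_of r)))"

definition trans_code :: "(nat \<times> nat \<times> rat list) list \<Rightarrow> nat" where
  "trans_code tr = list_encode (map (\<lambda>(s, m, ps).
      prod_encode (s, prod_encode (m, list_encode (map rat_code ps)))) tr)"

definition instance_code :: "dm_instance \<Rightarrow> nat" where
  "instance_code I = list_encode
     [n_states I, n_acts I, list_encode (lab I), trans_code (trans I),
      src1 I, src2 I, rat_code (thr I)]"

definition gen_dist_min_decidable :: bool where
  "gen_dist_min_decidable \<longleftrightarrow>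
     (\<exists>f. \<forall>I. valid_instance I \<longrightarrow>
        recf_eval f [instance_code I] (if gen_dist_min_yes I then 1 else 0))"

end

theory Submission
  imports Defs
begin

text \<open>
  Halting of partial recursive functions is reduced to distance minimisation, and a decision
  procedure is then diagonalised against itself.

  A recursive function is compiled into a nondeterministic program whose only instructions are
  clear, copy, increment and equality test; loops are left nondeterministically and checked
  afterwards. A configuration is an integer vector \<open>x\<close> (constant 1, program counter, registers),
  every instruction acts linearly on \<open>x\<close>, and a wrong instruction is detected by a sum of squares
  of linear forms, which is a nonnegative integer. Hence the tensor \<open>x \<otimes> x\<close> evolves linearly and
  the error is a linear functional of it.

  In the MDP, the run from the second source announces a sequence of instructions by its labels.
  The run from the first source carries the tensor, scaled by \<open>C ^ (- k)\<close> after \<open>k\<close> instructions, as a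
  distribution over states, and has to announce the same labels, or else it pays distance 1; thus
  it cannot exploit its knowledge of the current state. The mass lost at each step is rejected
  (reaches a uniquely labelled state) with probability \<open>1/2\<close>, increased by \<open>\<delta>\<close> times the error.
  The last letter kills all mass and lowers the rejection by \<open>\<delta>\<close> in the same scale, so one error
  earlier on outweighs it, and the distance drops below \<open>1/2\<close> iff an error-free halting run exists.

  Only the initial distribution depends on the input \<open>n\<close>. Therefore the instance with input \<open>n\<close> is
  computable from \<open>n\<close> and the code of the remaining data, and feeding a machine its own code suffices:
  neither a universal function nor the computability of the compilation is needed.
\<close>

section \<open>Computable functions\<close>

text \<open>A linear map cannot branch on a test, which forces the guess-and-check format: every
  instruction is carried out unconditionally, and control flow becomes a claim that may be false.
  Errors must not cancel, hence squares instead of signed linear forms, and integrality makes each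
  error at least 1, enough to offset the later saving of the final letter, which is scaled down by
  then. The baseline 1/2 makes the cost independent of the letters: half of all lost mass is
  rejected whatever is announced, and the other half joins the state of the second run, where it
  costs nothing under a strategy that looks only at the length of the path. Some strategies never
  play the last letter; therefore at least half of the mass is lost with every letter, and the
  bounds for finite horizons tend to 1/2. Strategies may randomise and remember, and couplings are
  arbitrary. But the second run has a single path for each sequence of letters, common to all states
  of the first run, so a strategy can do no more than average over letters.\<close>

inductive_cases recf_Zero: "recf_eval Zero xs y"
inductive_cases recf_Succ: "recf_eval Succ xs y"
inductive_cases recf_Proj: "recf_eval (Proj i) xs y"
inductive_cases recf_Comp: "recf_eval (Comp f gs) xs y"
inductive_cases recf_Prim: "recf_eval (Prim f g) xs y"
inductive_cases recf_Mu: "recf_eval (Mu f) xs y"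

lemma recf_eval_det: "recf_eval f xs y \<Longrightarrow> recf_eval f xs z \<Longrightarrow> y = z"
proof (induction arbitrary: z rule: recf_eval.induct)
  case (comp xs gs ys f y)
  from comp.prems obtain ys' where ys': "list_all2 (\<lambda>g y. recf_eval g xs y) gs ys'" "recf_eval f ys' z"
    by (auto elim: recf_Comp)
  have "ys = ys'"
    using comp.IH(1) ys'(1) by (intro nth_equalityI) (auto simp: list_all2_conv_all_nth)
  then show ?case using comp.IH(2) ys'(2) by simp
next
  case (primS f g n xs r y)
  from primS.prems obtain r' where "recf_eval (Prim f g) (n # xs) r'" "recf_eval g (r' # n # xs) z"
    by (auto elim: recf_Prim)
  then show ?case using primS.IH by blast
next
  case (mu f n xs)
  from mu.prems have z: "recf_eval f (z # xs) 0" "\<forall>k<z. \<exists>y. y \<noteq> 0 \<and> recf_eval f (k # xs) y"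
    by (auto elim: recf_Mu)
  \<comment> \<open>At the smaller of two candidate minima \<open>f\<close> would evaluate both to 0
    and to a nonzero number.\<close>
  have "\<not> n < z"
    using z(2) mu.IH(1) by blast
  moreover have "\<not> z < n"
    using z(1) mu.IH(2) by blast
  ultimately show ?case by simp
next
  case (prim0 f xs y g)
  from prim0.prems have "recf_eval f xs z"
    by (auto elim: recf_Prim)
  then show ?case by (rule prim0.IH)
next
  case zero
  then show ?case by (auto elim: recf_Zero)
next
  case succ
  then show ?case by (auto elim: recf_Succ)
next
  case proj
  then show ?case by (auto elim: recf_Proj)
qed

definition computable1 :: "(nat \<Rightarrow> nat) \<Rightarrow> bool" where
  "computable1 F \<longleftrightarrow> (\<exists>f. \<forall>x. recf_eval f [x] (F x))"

definition computable2 :: "(nat \<Rightarrow> nat \<Rightarrow> nat) \<Rightarrow> bool" where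
  "computable2 H \<longleftrightarrow> (\<exists>f. \<forall>x y. recf_eval f [x, y] (H x y))"

lemma recf_eval_comp1: "recf_eval g xs a \<Longrightarrow> recf_eval f [a] z \<Longrightarrow> recf_eval (Comp f [g]) xs z"
  by (rule recf_eval.comp[where ys = "[a]"]) auto

lemma recf_eval_comp2:
  "recf_eval g xs a \<Longrightarrow> recf_eval h xs b \<Longrightarrow> recf_eval f [a, b] z \<Longrightarrow> recf_eval (Comp f [g, h]) xs z"
  by (rule recf_eval.comp[where ys = "[a, b]"]) auto

lemma recf_eval_Proj: "i < length xs \<Longrightarrow> y = xs ! i \<Longrightarrow> recf_eval (Proj i) xs y"
  using recf_eval.proj by simp

lemma computable1_id: "computable1 (\<lambda>x. x)"
  unfolding computable1_def by (rule exI[of _ "Proj 0"]) (auto intro: recf_eval_Proj)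

lemma computable1_comp: "computable1 F \<Longrightarrow> computable1 G \<Longrightarrow> computable1 (\<lambda>x. F (G x))"
  unfolding computable1_def by (meson recf_eval_comp1)

lemma computable2_comp:
  "computable2 H \<Longrightarrow> computable1 F \<Longrightarrow> computable1 G \<Longrightarrow> computable1 (\<lambda>x. H (F x) (G x))"
  unfolding computable1_def computable2_def by (meson recf_eval_comp2)

lemma computable1_Suc: "computable1 F \<Longrightarrow> computable1 (\<lambda>x. Suc (F x))"
  by (rule computable1_comp[where F = Suc])
    (auto simp: computable1_def intro: exI[of _ Succ] recf_eval.succ)

lemma computable1_const: "computable1 (\<lambda>_. c)"
proof (induction c)
  case 0
  show ?case unfolding computable1_def by (rule exI[of _ Zero]) (auto intro: recf_eval.zero)
qed (rule computable1_Suc)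

lemma computable2_primrec:
  assumes "computable1 A" "\<And>r n x. recf_eval g [r, n, x] (G r n x)"
    and "\<And>x. H 0 x = A x" "\<And>n x. H (Suc n) x = G (H n x) n x"
  shows "computable2 H"
proof -
  obtain f where f: "\<And>x. recf_eval f [x] (A x)"
    using assms(1) by (auto simp: computable1_def)
  have "recf_eval (Prim f g) [n, x] (H n x)" for n x
  proof (induction n)
    case 0
    show ?case using f by (auto simp: assms(3) intro: recf_eval.prim0)
  next
    case (Suc n)
    show ?case using Suc assms(2) by (auto simp: assms(4) intro: recf_eval.primS)
  qed
  then show ?thesis unfolding computable2_def by blast
qed

lemma computable1_primrec:
  assumes "computable2 G" "\<And>n. F (Suc n) = G (F n) n"
  shows "computable1 F"
proof -
  obtain g where g: "\<And>r n. recf_eval g [r, n] (G r n)"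
    using assms(1) by (auto simp: computable2_def)
  obtain c where c: "\<And>x. recf_eval c [x] (F 0)"
    using computable1_const[of "F 0"] by (auto simp: computable1_def)
  \<comment> \<open>Without parameters the base function is evaluated on the empty list;
    \<open>Zero\<close> accepts that list and feeds the constant function \<open>c\<close>.\<close>
  have "recf_eval (Prim (Comp c [Zero]) g) [n] (F n)" for n
  proof (induction n)
    case 0
    show ?case using c by (auto intro!: recf_eval.prim0 recf_eval_comp1 recf_eval.zero)
  next
    case (Suc n)
    show ?case using Suc g by (auto simp: assms(2) intro: recf_eval.primS)
  qed
  then show ?thesis unfolding computable1_def by blast
qed

lemma computable2_add: "computable2 (+)"
proof (rule computable2_primrec[OF computable1_id])
  show "recf_eval (Comp Succ [Proj 0]) [r, n, x] (Suc r)" for r n x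
    by (auto intro!: recf_eval_comp1 recf_eval_Proj recf_eval.succ)
qed auto

lemma computable1_add: "computable1 F \<Longrightarrow> computable1 G \<Longrightarrow> computable1 (\<lambda>x. F x + G x)"
  by (rule computable2_comp[OF computable2_add])

lemma computable1_pred: "computable1 (\<lambda>x. x - 1)"
proof (rule computable1_primrec[where G = "\<lambda>r n. n"])
  show "computable2 (\<lambda>r n. n)"
    unfolding computable2_def by (rule exI[of _ "Proj 1"]) (auto intro: recf_eval_Proj)
qed simp

text \<open>The subtrahend comes first because \<open>Prim\<close> recurses on its first argument:
  \<open>x - Suc n\<close> is the predecessor of \<open>x - n\<close>.\<close>

lemma computable2_diff: "computable2 (\<lambda>n x. x - n)"
proof -
  obtain p where p: "\<And>x. recf_eval p [x] (x - 1)"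
    using computable1_pred by (auto simp: computable1_def)
  show ?thesis
  proof (rule computable2_primrec[OF computable1_id])
    show "recf_eval (Comp p [Proj 0]) [r, n, x] (r - 1)" for r n x
      using p by (auto intro!: recf_eval_comp1[where a = r] recf_eval_Proj)
  qed auto
qed

lemma computable1_diff: "computable1 F \<Longrightarrow> computable1 G \<Longrightarrow> computable1 (\<lambda>x. F x - G x)"
  by (rule computable2_comp[OF computable2_diff])

lemma computable1_mult:
  assumes "computable1 F" "computable1 G"
  shows "computable1 (\<lambda>x. F x * G x)"
proof -
  obtain p where p: "\<And>x y. recf_eval p [x, y] (x + y)"
    using computable2_add by (auto simp: computable2_def)
  have "computable2 (*)"
  proof (rule computable2_primrec[OF computable1_const[of 0]])
    show "recf_eval (Comp p [Proj 2, Proj 0]) [r, n, x] (x + r)" for r n x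
      using p by (auto intro!: recf_eval_comp2[where a = x and b = r] recf_eval_Proj)
  qed auto
  then show ?thesis
    by (rule computable2_comp[OF _ assms])
qed

section \<open>Computability of the pairing function and of its inverse\<close>

lemma computable1_triangle:
  assumes "computable1 F"
  shows "computable1 (\<lambda>x. triangle (F x))"
proof -
  obtain p where p: "\<And>x y. recf_eval p [x, y] (x + y)"
    using computable2_add by (auto simp: computable2_def)
  have "computable2 (\<lambda>r n. r + Suc n)"
    unfolding computable2_def
    by (rule exI[of _ "Comp p [Proj 0, Comp Succ [Proj 1]]"], intro allI,
        rule recf_eval_comp2[OF _ recf_eval_comp1 p])
      (auto intro!: recf_eval_Proj recf_eval.succ)
  then have "computable1 triangle"
    by (rule computable1_primrec) (rule triangle_Suc)
  then show ?thesis
    by (rule computable1_comp[OF _ assms])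
qed

lemma computable1_prod_encode:
  "computable1 F \<Longrightarrow> computable1 G \<Longrightarrow> computable1 (\<lambda>x. prod_encode (F x, G x))"
  unfolding prod_encode_def prod.case by (intro computable1_add computable1_triangle)

text \<open>As \<open>prod_encode (a, b) = triangle (a + b) + a\<close>, the searched number is
  \<open>a + b\<close> for the code of \<open>(a, b)\<close>. The truncated difference
  \<open>Suc c - triangle (Suc k)\<close> vanishes exactly if \<open>c < triangle (Suc k)\<close>,
  which turns the search into a minimisation.\<close>

lemma computable1_inverse_triangle: "computable1 (\<lambda>c. LEAST k. c < triangle (Suc k))"
proof -
  have "computable1 (\<lambda>k. triangle (Suc k))"
    by (intro computable1_triangle computable1_Suc computable1_id)
  then obtain t where t: "\<And>k. recf_eval t [k] (triangle (Suc k))"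
    by (auto simp: computable1_def)
  obtain m where m: "\<And>n x. recf_eval m [n, x] (x - n)"
    using computable2_diff by (auto simp: computable2_def)
  define f where "f = Comp m [Comp t [Proj 0], Comp Succ [Proj 1]]"
  have f: "recf_eval f [k, c] (Suc c - triangle (Suc k))" for k c
    unfolding f_def
    by (rule recf_eval_comp2[OF _ _ m]; rule recf_eval_comp1)
      (auto intro!: recf_eval_Proj recf_eval.succ t simp del: triangle_Suc)
  have "recf_eval (Mu f) [c] (LEAST k. c < triangle (Suc k))" (is "recf_eval _ _ ?l") for c
  proof (rule recf_eval.mu)
    have "c < triangle (Suc c)"
      by (induction c) auto
    then have "c < triangle (Suc ?l)"
      by (rule LeastI)
    then have "Suc c - triangle (Suc ?l) = 0"
      by simp
    then show "recf_eval f [?l, c] 0"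
      using f[of ?l c] by metis
    show "\<forall>k<?l. \<exists>y. y \<noteq> 0 \<and> recf_eval f [k, c] y"
    proof (intro allI impI)
      fix k assume "k < ?l"
      then have "\<not> c < triangle (Suc k)"
        by (rule not_less_Least)
      then show "\<exists>y. y \<noteq> 0 \<and> recf_eval f [k, c] y"
        using f[of k c] by (intro exI[of _ "Suc c - triangle (Suc k)"]) auto
    qed
  qed
  then show ?thesis unfolding computable1_def by blast
qed

lemma triangle_mono: "m \<le> n \<Longrightarrow> triangle m \<le> triangle n"
  by (rule lift_Suc_mono_le[of triangle]) auto

lemma inverse_triangle_prod_encode:
  "(LEAST k. prod_encode (a, b) < triangle (Suc k)) = a + b"
proof (rule Least_equality)
  fix k assume k: "prod_encode (a, b) < triangle (Suc k)"
  show "a + b \<le> k"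
  proof (rule ccontr)
    assume "\<not> a + b \<le> k"
    then have "triangle (Suc k) \<le> triangle (a + b)"
      by (intro triangle_mono) simp
    then show False using k by (simp add: prod_encode_def)
  qed
qed (simp add: prod_encode_def)

lemma computable1_fst_prod_decode:
  assumes "computable1 F"
  shows "computable1 (\<lambda>x. fst (prod_decode (F x)))"
proof -
  have "fst (prod_decode c) = c - triangle (LEAST k. c < triangle (Suc k))" for c
  proof -
    obtain a b where "c = prod_encode (a, b)"
      by (metis prod_decode_inverse surj_pair)
    then show ?thesis
      by (simp only: inverse_triangle_prod_encode prod_encode_inverse) (simp add: prod_encode_def)
  qed
  moreover have "computable1 (\<lambda>c. c - triangle (LEAST k. c < triangle (Suc k)))"
    by (intro computable1_diff computable1_triangle computable1_inverse_triangle computable1_id)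
  ultimately show ?thesis
    using computable1_comp[OF _ assms] by simp
qed

lemma computable1_snd_prod_decode:
  assumes "computable1 F"
  shows "computable1 (\<lambda>x. snd (prod_decode (F x)))"
proof -
  have "snd (prod_decode c) = (LEAST k. c < triangle (Suc k)) - fst (prod_decode c)" for c
  proof -
    obtain a b where "c = prod_encode (a, b)"
      by (metis prod_decode_inverse surj_pair)
    then show ?thesis
      by (simp only: inverse_triangle_prod_encode prod_encode_inverse) simp
  qed
  moreover have "computable1 (\<lambda>c. (LEAST k. c < triangle (Suc k)) - fst (prod_decode c))"
    by (intro computable1_diff computable1_fst_prod_decode computable1_inverse_triangle computable1_id)
  ultimately show ?thesis
    using computable1_comp[OF _ assms] by simp
qed

section \<open>Compilation into guess-and-check programs\<close>

datatype act = Clr nat | Cpy nat nat | Inc nat | Chk nat nat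

fun act_upd :: "act \<Rightarrow> (nat \<Rightarrow> nat) \<Rightarrow> nat \<Rightarrow> nat" where
  "act_upd (Clr r) s = s(r := 0)"
| "act_upd (Cpy r q) s = s(r := s q)"
| "act_upd (Inc r) s = s(r := Suc (s r))"
| "act_upd (Chk r q) s = s"

fun act_ok :: "act \<Rightarrow> (nat \<Rightarrow> nat) \<Rightarrow> bool" where
  "act_ok (Chk r q) s \<longleftrightarrow> s r = s q"
| "act_ok _ s \<longleftrightarrow> True"

definition act_rel :: "act \<Rightarrow> ((nat \<Rightarrow> nat) \<times> (nat \<Rightarrow> nat)) set" where
  "act_rel a = {(s, t). act_ok a s \<and> t = act_upd a s}"

lemma mem_act_rel: "(s, t) \<in> act_rel a \<longleftrightarrow> act_ok a s \<and> t = act_upd a s"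
  by (simp add: act_rel_def)

text \<open>Regular expressions over instructions in which the star is the only source of
  nondeterminism; a later \<open>Chk\<close> discards the runs with a wrong number of
  rounds.\<close>

inductive_set regular_rel :: "((nat \<Rightarrow> nat) \<times> (nat \<Rightarrow> nat)) set set" where
  act: "act_rel a \<in> regular_rel"
| seq: "R \<in> regular_rel \<Longrightarrow> S \<in> regular_rel \<Longrightarrow> R O S \<in> regular_rel"
| star: "R \<in> regular_rel \<Longrightarrow> R\<^sup>* \<in> regular_rel"

text \<open>The program reads \<open>as\<close>, writes \<open>r\<close> and uses the registers from \<open>n\<close> on as scratch space.\<close>

definition implements ::
  "recf \<Rightarrow> nat list \<Rightarrow> nat \<Rightarrow> nat \<Rightarrow> ((nat \<Rightarrow> nat) \<times> (nat \<Rightarrow> nat)) set \<Rightarrow> bool" where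
  "implements f as r n R \<longleftrightarrow>
     (\<forall>s t. (s, t) \<in> R \<longrightarrow> recf_eval f (map s as) (t r) \<and> (\<forall>p<n. p \<noteq> r \<longrightarrow> t p = s p)) \<and>
     (\<forall>s z. recf_eval f (map s as) z \<longrightarrow> (\<exists>t. (s, t) \<in> R))"

lemma implements_sound:
  "implements f as r n R \<Longrightarrow> (s, t) \<in> R \<Longrightarrow> recf_eval f (map s as) (t r)"
  "implements f as r n R \<Longrightarrow> (s, t) \<in> R \<Longrightarrow> p < n \<Longrightarrow> p \<noteq> r \<Longrightarrow> t p = s p"
  unfolding implements_def by blast+

text \<open>\<open>implements\<close> only promises that some final state exists; that it holds
  \<open>z\<close> follows from soundness and determinacy.\<close>

lemma implements_complete:
  assumes "implements f as r n R" "recf_eval f (map s as) z"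
  obtains t where "(s, t) \<in> R" "t r = z"
  using assms unfolding implements_def by (metis recf_eval_det)

text \<open>The quantification over all register layouts allows subprograms to be placed in fresh
  registers above those of the caller.\<close>

definition compilable :: "recf \<Rightarrow> bool" where
  "compilable f \<longleftrightarrow> (\<forall>as r n. set as \<subseteq> {..<n} \<and> r < n \<and> r \<notin> set as \<longrightarrow>
     (\<exists>R\<in>regular_rel. implements f as r n R))"

lemma compilableD:
  assumes "compilable f" "set as \<subseteq> {..<n}" "r < n" "r \<notin> set as"
  obtains R where "R \<in> regular_rel" "implements f as r n R"
  using assms unfolding compilable_def by blast

text \<open>A program whose check always fails. It implements functions that are undefined for the
  given number of arguments, such as \<open>Succ\<close> without any.\<close>

lemma empty_regular_rel: "{} \<in> regular_rel"
proof -
  have "act_rel (Clr 0) O act_rel (Clr 1) O act_rel (Inc 0) O act_rel (Chk 0 1) = {}"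
    by (auto simp: act_rel_def)
  moreover have "act_rel (Clr 0) O act_rel (Clr 1) O act_rel (Inc 0) O act_rel (Chk 0 1) \<in> regular_rel"
    by (intro regular_rel.intros)
  ultimately show ?thesis by metis
qed

lemma map_agree: "set as \<subseteq> {..<m} \<Longrightarrow> (\<And>p. p < m \<Longrightarrow> t p = s p) \<Longrightarrow> map t as = map s as"
  by auto

definition implements_args ::
  "recf list \<Rightarrow> nat list \<Rightarrow> nat \<Rightarrow> ((nat \<Rightarrow> nat) \<times> (nat \<Rightarrow> nat)) set \<Rightarrow> bool" where
  "implements_args gs as m R \<longleftrightarrow>
     (\<forall>s t. (s, t) \<in> R \<longrightarrow>
        list_all2 (\<lambda>g y. recf_eval g (map s as) y) gs (map t [m..<m + length gs]) \<and>
        (\<forall>p<m. t p = s p)) \<and>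
     (\<forall>s ys. list_all2 (\<lambda>g y. recf_eval g (map s as) y) gs ys \<longrightarrow> (\<exists>t. (s, t) \<in> R))"

lemma implements_argsD:
  assumes "implements_args gs as m R"
  shows "(s, t) \<in> R \<Longrightarrow> list_all2 (\<lambda>g y. recf_eval g (map s as) y) gs (map t [m..<m + length gs])"
    and "(s, t) \<in> R \<Longrightarrow> p < m \<Longrightarrow> t p = s p"
    and "list_all2 (\<lambda>g y. recf_eval g (map s as) y) gs ys \<Longrightarrow> \<exists>t. (s, t) \<in> R"
  using assms unfolding implements_args_def by blast+

text \<open>Each function writes to the first free register \<open>m\<close>, and the remaining ones
  are compiled with boundary \<open>Suc m\<close>, so that they preserve this result together with
  the arguments.\<close>

lemma compilable_args:
  assumes "\<And>g. g \<in> set gs \<Longrightarrow> compilable g" "set as \<subseteq> {..<m}"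
  shows "\<exists>R\<in>regular_rel. implements_args gs as m R"
  using assms
proof (induction gs arbitrary: m)
  case Nil
  show ?case
    by (rule bexI[OF _ regular_rel.act[of "Chk 0 0"]]) (auto simp: act_rel_def implements_args_def)
next
  case (Cons g gs)
  have "set as \<subseteq> {..<Suc m}" "m < Suc m" "m \<notin> set as" using Cons.prems(2) by auto
  moreover have "compilable g" using Cons.prems(1) by simp
  ultimately obtain R1 where R1: "R1 \<in> regular_rel" "implements g as m (Suc m) R1"
    by (metis compilableD)
  have "\<exists>R\<in>regular_rel. implements_args gs as (Suc m) R"
    using Cons.prems(1) \<open>set as \<subseteq> {..<Suc m}\<close> by (intro Cons.IH) auto
  then obtain R2 where R2: "R2 \<in> regular_rel" "implements_args gs as (Suc m) R2" by blast
  note R2D = implements_argsD[OF R2(2)]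
  have keep: "map u as = map s as" if "(s, u) \<in> R1" for s u
    using that implements_sound(2)[OF R1(2)] Cons.prems(2) by (intro map_agree[of as m]) auto
  show ?case unfolding implements_args_def
  proof (intro bexI conjI allI impI)
    show "R1 O R2 \<in> regular_rel" using R1 R2 by (intro regular_rel.seq)
    fix s t assume "(s, t) \<in> R1 O R2"
    then obtain u where u: "(s, u) \<in> R1" "(u, t) \<in> R2" by blast
    have "recf_eval g (map s as) (t m)"
      using implements_sound(1)[OF R1(2) u(1)] R2D(2)[OF u(2), of m] by simp
    moreover have "list_all2 (\<lambda>g y. recf_eval g (map s as) y) gs (map t [Suc m..<Suc m + length gs])"
      using R2D(1)[OF u(2)] keep[OF u(1)] by (simp del: map_eq_conv)
    ultimately show "list_all2 (\<lambda>g y. recf_eval g (map s as) y) (g # gs) (map t [m..<m + length (g # gs)])"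
      by (simp add: upt_conv_Cons del: upt_Suc)
    show "t p = s p" if "p < m" for p
      using R2D(2)[OF u(2), of p] implements_sound(2)[OF R1(2) u(1), of p] that by simp
  next
    fix s ys assume "list_all2 (\<lambda>g y. recf_eval g (map s as) y) (g # gs) ys"
    then obtain y ys' where y: "recf_eval g (map s as) y" "list_all2 (\<lambda>g y. recf_eval g (map s as) y) gs ys'"
      by (auto simp: list_all2_Cons1)
    then obtain u where u: "(s, u) \<in> R1" using implements_complete[OF R1(2)] by metis
    then obtain t where "(u, t) \<in> R2" using R2D(3)[of u ys'] y(2) keep by auto
    then show "\<exists>t. (s, t) \<in> R1 O R2" using u by blast
  qed
qed

lemma compilable_Comp:
  assumes "compilable f" "\<And>g. g \<in> set gs \<Longrightarrow> compilable g"
  shows "compilable (Comp f gs)"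
  unfolding compilable_def
proof (intro allI impI, elim conjE)
  fix as :: "nat list" and r n :: nat assume as: "set as \<subseteq> {..<n}" "r < n" "r \<notin> set as"
  let ?m = "n + length gs"
  obtain R1 where R1: "R1 \<in> regular_rel" "implements_args gs as n R1"
    using compilable_args[OF assms(2) as(1)] by blast
  note R1D = implements_argsD[OF R1(2)]
  have "set [n..<?m] \<subseteq> {..<?m}" "r < ?m" "r \<notin> set [n..<?m]" using as by auto
  then obtain R2 where R2: "R2 \<in> regular_rel" "implements f [n..<?m] r ?m R2"
    by (rule compilableD[OF assms(1)])
  have "implements (Comp f gs) as r n (R1 O R2)"
    unfolding implements_def
  proof (intro conjI allI impI)
    fix s t assume "(s, t) \<in> R1 O R2"
    then obtain u where u: "(s, u) \<in> R1" "(u, t) \<in> R2" by blast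
    show "recf_eval (Comp f gs) (map s as) (t r)"
      using R1D(1)[OF u(1)] implements_sound(1)[OF R2(2) u(2)] by (rule recf_eval.comp)
    show "t p = s p" if "p < n" "p \<noteq> r" for p
      using R1D(2)[OF u(1), of p] implements_sound(2)[OF R2(2) u(2), of p] that by simp
  next
    fix s z assume "recf_eval (Comp f gs) (map s as) z"
    then obtain ys where ys: "list_all2 (\<lambda>g y. recf_eval g (map s as) y) gs ys" "recf_eval f ys z"
      by (auto elim: recf_Comp)
    then obtain u where u: "(s, u) \<in> R1" using R1D(3) by blast
    \<comment> \<open>The run to \<open>u\<close> was obtained without control over its results;
      determinacy identifies them with the values of the given evaluation.\<close>
    have "ys = map u [n..<?m]"
      using R1D(1)[OF u] ys(1)
      by (intro nth_equalityI) (simp_all add: list_all2_conv_all_nth, metis recf_eval_det)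
    then obtain t where "(u, t) \<in> R2" using implements_complete[OF R2(2), of u z] ys(2) by metis
    then show "\<exists>t. (s, t) \<in> R1 O R2" using u by blast
  qed
  then show "\<exists>R\<in>regular_rel. implements (Comp f gs) as r n R"
    using R1(1) R2(1) by (blast intro: regular_rel.seq)
qed

lemma compilable_Prim:
  assumes "compilable f" "compilable g"
  shows "compilable (Prim f g)"
  unfolding compilable_def
proof (intro allI impI, elim conjE)
  fix as :: "nat list" and r n :: nat assume as: "set as \<subseteq> {..<n}" "r < n" "r \<notin> set as"
  show "\<exists>R\<in>regular_rel. implements (Prim f g) as r n R"
  proof (cases as)
    case Nil
    have "\<not> recf_eval (Prim f g) [] z" for z by (auto elim: recf_Prim)
    then have "implements (Prim f g) as r n {}" using Nil by (simp add: implements_def)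
    then show ?thesis using empty_regular_rel by blast
  next
    case (Cons a bs)
    have bs: "set bs \<subseteq> {..<n}" "a < n" using as Cons by auto
    \<comment> \<open>Register \<open>n\<close> is the loop counter, \<open>n+1\<close> the
      accumulator and \<open>n+2\<close> receives the new value of \<open>g\<close>.\<close>
    have "set bs \<subseteq> {..<n+3}" "n+1 < n+3" "n+1 \<notin> set bs" using bs by auto
    then obtain F where F: "F \<in> regular_rel" "implements f bs (n+1) (n+3) F"
      by (rule compilableD[OF assms(1)])
    have "set ((n+1) # n # bs) \<subseteq> {..<n+3}" "n+2 < n+3" "n+2 \<notin> set ((n+1) # n # bs)" using bs by auto
    then obtain G where G: "G \<in> regular_rel" "implements g ((n+1) # n # bs) (n+2) (n+3) G"
      by (rule compilableD[OF assms(2)])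
    define B where "B = G O act_rel (Cpy (n+1) (n+2)) O act_rel (Inc n)"
    define A where "A = F O act_rel (Clr n)"
    \<comment> \<open>The loop is left at a guessed moment; \<open>Chk n a\<close> keeps only runs
      whose counter has reached the recursion argument.\<close>
    define R where "R = (A O B\<^sup>*) O act_rel (Chk n a) O act_rel (Cpy r (n+1))"
    have R: "R \<in> regular_rel"
      unfolding R_def A_def B_def by (intro regular_rel.intros F G)
    have A: "(s, t) \<in> A \<longleftrightarrow> (\<exists>u. (s, u) \<in> F \<and> t = u(n := 0))" for s t
      unfolding A_def by (auto simp: relcomp_unfold act_rel_def)
    have B: "(u, t) \<in> B \<longleftrightarrow> (\<exists>v. (u, v) \<in> G \<and> t = v(n + 1 := v (n + 2), n := Suc (v n)))" for u t
      unfolding B_def by (auto simp: relcomp_unfold act_rel_def)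
    define I where "I = (\<lambda>s t. recf_eval (Prim f g) (t n # map s bs) (t (n+1)) \<and> (\<forall>p<n. t p = s p))"
    have I0: "I s t" if "(s, t) \<in> A" for s t
    proof -
      from that obtain u where u: "(s, u) \<in> F" "t = u(n := 0)"
        unfolding A by blast
      show ?thesis
        using implements_sound[OF F(2) u(1)] unfolding I_def u(2) by (auto intro: recf_eval.prim0)
    qed
    have IS: "I s t" if "I s u" "(u, t) \<in> B" for s u t
    proof -
      from that obtain v where v: "(u, v) \<in> G" "t = v(n + 1 := v (n + 2), n := Suc (v n))"
        unfolding B by blast
      have "map u bs = map s bs"
        using that(1) bs by (intro map_agree[of bs n]) (auto simp: I_def)
      then have "recf_eval g (u (n+1) # u n # map s bs) (v (n+2))"
        using implements_sound(1)[OF G(2) v(1)] by (simp del: map_eq_conv)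
      then have "recf_eval (Prim f g) (Suc (u n) # map s bs) (v (n+2))"
        using that(1) recf_eval.primS unfolding I_def by blast
      then show ?thesis
        using implements_sound(2)[OF G(2) v(1)] that(1) unfolding I_def v(2) by auto
    qed
    have Istar: "I s t" if "(u, t) \<in> B\<^sup>*" "(s, u) \<in> A" for s u t
      using that by (induction rule: rtrancl_induct) (auto intro: I0 IS)
    have reach: "\<exists>t. (s, t) \<in> A O B\<^sup>* \<and> t n = k" if "recf_eval (Prim f g) (k # map s bs) z" for s k z
      using that
    proof (induction k arbitrary: z)
      case 0
      then have "recf_eval f (map s bs) z" by (auto elim: recf_Prim)
      then obtain u where "(s, u) \<in> F" using implements_complete[OF F(2)] by metis
      then have "(s, u(n := 0)) \<in> A" unfolding A by blast
      then have "(s, u(n := 0)) \<in> A O B\<^sup>*" by blast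
      then show ?case by (metis fun_upd_same)
    next
      case (Suc k)
      from Suc.prems obtain y where y: "recf_eval (Prim f g) (k # map s bs) y"
        "recf_eval g (y # k # map s bs) z"
        by (auto elim: recf_Prim)
      from Suc.IH[OF y(1)] obtain u where u: "(s, u) \<in> A O B\<^sup>*" "u n = k" by blast
      then have I: "I s u" using Istar by blast
      then have "u (n+1) = y" using y(1) u(2) recf_eval_det unfolding I_def by blast
      moreover have "map u bs = map s bs"
        using I bs by (intro map_agree[of bs n]) (auto simp: I_def)
      ultimately have "recf_eval g (map u ((n+1) # n # bs)) z" using y(2) u(2) by (simp del: map_eq_conv)
      then obtain v where v: "(u, v) \<in> G" using implements_complete[OF G(2)] by metis
      let ?t = "v(n + 1 := v (n + 2), n := Suc (v n))"
      have "(u, ?t) \<in> B" unfolding B using v by blast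
      then have "(s, ?t) \<in> A O B\<^sup>*" using u(1) by (meson relcomp.cases relcomp.relcompI rtrancl.rtrancl_into_rtrancl)
      moreover have "?t n = Suc k" using implements_sound(2)[OF G(2) v, of n] u(2) by simp
      ultimately show ?case by blast
    qed
    have "implements (Prim f g) as r n R"
      unfolding implements_def
    proof (intro conjI allI impI)
      fix s t assume "(s, t) \<in> R"
      then obtain u v where u: "(s, v) \<in> A" "(v, u) \<in> B\<^sup>*" "u n = u a" "t = u(r := u (n+1))"
        by (auto simp: R_def act_rel_def)
      have "I s u" using Istar u by blast
      then show "recf_eval (Prim f g) (map s as) (t r)" using u(3,4) Cons bs by (auto simp: I_def)
      show "t p = s p" if "p < n" "p \<noteq> r" for p using \<open>I s u\<close> u(4) that by (simp add: I_def)
    next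
      fix s z assume "recf_eval (Prim f g) (map s as) z"
      then obtain u where u: "(s, u) \<in> A O B\<^sup>*" "u n = s a"
        using reach[of "s a" s z] Cons by auto
      then have "I s u" using Istar by blast
      then have "u n = u a" using u(2) bs by (simp add: I_def)
      then have "(s, u(r := u (n+1))) \<in> R" using u(1) by (auto simp: R_def act_rel_def)
      then show "\<exists>t. (s, t) \<in> R" by blast
    qed
    then show ?thesis using R by blast
  qed
qed

text \<open>The guessing device: a starred increment adds an arbitrary number, to be tested
  afterwards.\<close>

lemma Inc_star: "(s, t) \<in> (act_rel (Inc r))\<^sup>* \<longleftrightarrow> (\<exists>k. t = s(r := s r + k))"
proof
  assume "(s, t) \<in> (act_rel (Inc r))\<^sup>*"
  then show "\<exists>k. t = s(r := s r + k)"
  proof (induction rule: rtrancl_induct)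
    case base
    show ?case by (rule exI[of _ 0]) simp
  next
    case (step u v)
    then obtain k where "u = s(r := s r + k)" by blast
    then show ?case using step(2) by (intro exI[of _ "Suc k"]) (simp add: act_rel_def)
  qed
next
  have "(s, s(r := s r + k)) \<in> (act_rel (Inc r))\<^sup>*" for k
  proof (induction k)
    case (Suc k)
    have "(s(r := s r + k), s(r := s r + Suc k)) \<in> act_rel (Inc r)" by (simp add: act_rel_def)
    then show ?case using Suc by (rule rtrancl_into_rtrancl[rotated])
  qed simp
  then show "\<exists>k. t = s(r := s r + k) \<Longrightarrow> (s, t) \<in> (act_rel (Inc r))\<^sup>*" by blast
qed

text \<open>A value \<open>y\<close> is certified to be nonzero by guessing some \<open>z \<ge> 1\<close> and testing \<open>y = z\<close>.\<close>

lemma compilable_Mu: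
  assumes "compilable f"
  shows "compilable (Mu f)"
  unfolding compilable_def
proof (intro allI impI, elim conjE)
  fix as :: "nat list" and r n :: nat assume as: "set as \<subseteq> {..<n}" "r < n" "r \<notin> set as"
  have "set (n # as) \<subseteq> {..<n+3}" "n+1 < n+3" "n+1 \<notin> set (n # as)" using as by auto
  then obtain F where F: "F \<in> regular_rel" "implements f (n # as) (n+1) (n+3) F"
    by (rule compilableD[OF assms])
  define A where "A = act_rel (Clr n)"
  \<comment> \<open>\<open>B\<close> refutes the candidate in register \<open>n\<close> by a nonzero
    value and passes to the next one; \<open>C\<close> accepts the candidate if the value is 0.
    Choosing wrongly between them fails a check.\<close>
  define B where "B = F O act_rel (Clr (n+2)) O act_rel (Inc (n+2)) O (act_rel (Inc (n+2)))\<^sup>* O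
    act_rel (Chk (n+1) (n+2)) O act_rel (Inc n)"
  define C where "C = F O act_rel (Clr (n+2)) O act_rel (Chk (n+1) (n+2)) O act_rel (Cpy r n)"
  define R where "R = (A O B\<^sup>*) O C"
  have R: "R \<in> regular_rel"
    unfolding R_def A_def B_def C_def by (intro regular_rel.intros F)
  have B: "(u, t) \<in> B \<longleftrightarrow> (\<exists>v k. (u, v) \<in> F \<and> v (n+1) = Suc k \<and> t = v(n+2 := Suc k, n := Suc (v n)))" for u t
  proof
    assume "(u, t) \<in> B"
    then show "\<exists>v k. (u, v) \<in> F \<and> v (n+1) = Suc k \<and> t = v(n+2 := Suc k, n := Suc (v n))"
      unfolding B_def by (auto simp: relcomp_unfold Inc_star mem_act_rel)
  next
    assume "\<exists>v k. (u, v) \<in> F \<and> v (n+1) = Suc k \<and> t = v(n+2 := Suc k, n := Suc (v n))"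
    then obtain v k where v: "(u, v) \<in> F" "v (n+1) = Suc k" "t = v(n+2 := Suc k, n := Suc (v n))" by blast
    have "(v, v(n+2 := Suc k)) \<in> act_rel (Clr (n+2)) O act_rel (Inc (n+2)) O (act_rel (Inc (n+2)))\<^sup>*"
      by (auto simp: relcomp_unfold Inc_star mem_act_rel)
    moreover have "(v(n+2 := Suc k), t) \<in> act_rel (Chk (n+1) (n+2)) O act_rel (Inc n)"
      using v by (auto simp: relcomp_unfold mem_act_rel)
    ultimately show "(u, t) \<in> B" using v(1) unfolding B_def by blast
  qed
  have C: "(u, t) \<in> C \<longleftrightarrow> (\<exists>v. (u, v) \<in> F \<and> v (n+1) = 0 \<and> t = v(n+2 := 0, r := v n))" for u t
    unfolding C_def using as(2) by (auto simp: relcomp_unfold act_rel_def)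
  define I where "I = (\<lambda>s t. (\<forall>k<t n. \<exists>y. y \<noteq> 0 \<and> recf_eval f (k # map s as) y) \<and> (\<forall>p<n. t p = s p))"
  have I_args: "map t as = map s as" if "I s t" for s t
    using that as by (intro map_agree[of as n]) (auto simp: I_def)
  have I0: "I s t" if "(s, t) \<in> A" for s t
    using that by (auto simp: A_def act_rel_def I_def)
  have IS: "I s t" if I: "I s u" and ut: "(u, t) \<in> B" for s u t
  proof -
    from ut obtain v k where v: "(u, v) \<in> F" "v (n+1) = Suc k" "t = v(n+2 := Suc k, n := Suc (v n))"
      unfolding B by blast
    have n: "v n = u n" using implements_sound(2)[OF F(2) v(1), of n] by simp
    have "recf_eval f (u n # map s as) (Suc k)"
      using implements_sound(1)[OF F(2) v(1)] v(2) I_args[OF I] by (simp del: map_eq_conv)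
    then have "\<forall>k<Suc (u n). \<exists>y. y \<noteq> 0 \<and> recf_eval f (k # map s as) y"
      using I by (auto simp: I_def less_Suc_eq)
    then show ?thesis
      using implements_sound(2)[OF F(2) v(1)] I n unfolding I_def v(3) by auto
  qed
  have Istar: "I s t" if "(u, t) \<in> B\<^sup>*" "(s, u) \<in> A" for s u t
    using that by (induction rule: rtrancl_induct) (auto intro: I0 IS)
  have reach: "\<exists>t. (s, t) \<in> A O B\<^sup>* \<and> t n = k"
    if "\<forall>j<k. \<exists>y. y \<noteq> 0 \<and> recf_eval f (j # map s as) y" for s k
    using that
  proof (induction k)
    case 0
    have "(s, s(n := 0)) \<in> A O B\<^sup>*" by (auto simp: A_def act_rel_def)
    then show ?case by (metis fun_upd_same)
  next
    case (Suc k)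
    then obtain u where u: "(s, u) \<in> A O B\<^sup>*" "u n = k" by auto
    then have I: "I s u" using Istar by blast
    obtain y where y: "y \<noteq> 0" "recf_eval f (k # map s as) y" using Suc.prems by blast
    then have "recf_eval f (map u (n # as)) y" using I_args[OF I] u(2) by (simp del: map_eq_conv)
    then obtain v where v: "(u, v) \<in> F" "v (n+1) = y" using implements_complete[OF F(2)] by metis
    obtain j where j: "y = Suc j" using y(1) by (cases y) auto
    let ?t = "v(n+2 := Suc j, n := Suc (v n))"
    have "(u, ?t) \<in> B" unfolding B using v j by blast
    then have "(s, ?t) \<in> A O B\<^sup>*" using u(1) by (meson relcomp.cases relcomp.relcompI rtrancl.rtrancl_into_rtrancl)
    moreover have "?t n = Suc k" using implements_sound(2)[OF F(2) v(1), of n] u(2) by simp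
    ultimately show ?case by blast
  qed
  have "implements (Mu f) as r n R"
    unfolding implements_def
  proof (intro conjI allI impI)
    fix s t assume "(s, t) \<in> R"
    then obtain w u where w: "(s, w) \<in> A" "(w, u) \<in> B\<^sup>*" "(u, t) \<in> C" unfolding R_def by blast
    then obtain v where v: "(u, v) \<in> F" "v (n+1) = 0" "t = v(n+2 := 0, r := v n)" unfolding C by blast
    have I: "I s u" using Istar w by blast
    have n: "v n = u n" using implements_sound(2)[OF F(2) v(1), of n] by simp
    have "recf_eval f (u n # map s as) 0"
      using implements_sound(1)[OF F(2) v(1)] v(2) I_args[OF I] by (simp del: map_eq_conv)
    then have "recf_eval (Mu f) (map s as) (u n)"
      using I by (intro recf_eval.mu) (auto simp: I_def)
    then show "recf_eval (Mu f) (map s as) (t r)" by (simp add: v(3) n)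
    show "t p = s p" if "p < n" "p \<noteq> r" for p
      using implements_sound(2)[OF F(2) v(1), of p] I that by (simp add: v(3) I_def)
  next
    fix s z assume "recf_eval (Mu f) (map s as) z"
    then have z: "recf_eval f (z # map s as) 0" "\<forall>k<z. \<exists>y. y \<noteq> 0 \<and> recf_eval f (k # map s as) y"
      by (auto elim: recf_Mu)
    then obtain u where u: "(s, u) \<in> A O B\<^sup>*" "u n = z" using reach by blast
    then have I: "I s u" using Istar by blast
    have "recf_eval f (map u (n # as)) 0" using z(1) u(2) I_args[OF I] by (simp del: map_eq_conv)
    then obtain v where "(u, v) \<in> F" "v (n+1) = 0" using implements_complete[OF F(2)] by metis
    then have "(u, v(n+2 := 0, r := v n)) \<in> C" unfolding C by blast
    then show "\<exists>t. (s, t) \<in> R" using u(1) unfolding R_def by blast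
  qed
  then show "\<exists>R\<in>regular_rel. implements (Mu f) as r n R" using R by blast
qed

lemma compilable_all: "compilable f"
proof (induction f)
  case Zero
  have "implements Zero as r n (act_rel (Clr r))" for as r n
    by (auto simp: implements_def act_rel_def intro: recf_eval.zero)
  then show ?case unfolding compilable_def by (blast intro: regular_rel.act)
next
  case Succ
  show ?case unfolding compilable_def
  proof (intro allI impI)
    fix as :: "nat list" and r n :: nat assume as: "set as \<subseteq> {..<n} \<and> r < n \<and> r \<notin> set as"
    show "\<exists>R\<in>regular_rel. implements Succ as r n R"
    proof (cases as)
      case Nil
      then have "implements Succ as r n {}" by (auto simp: implements_def elim: recf_Succ)
      then show ?thesis using empty_regular_rel by blast
    next
      case (Cons a bs)
      then have "implements Succ as r n (act_rel (Cpy r a) O act_rel (Inc r))"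
        by (auto simp: implements_def act_rel_def relcomp_unfold intro: recf_eval.succ)
      then show ?thesis by (blast intro: regular_rel.intros)
    qed
  qed
next
  case (Proj i)
  show ?case unfolding compilable_def
  proof (intro allI impI)
    fix as :: "nat list" and r n :: nat assume as: "set as \<subseteq> {..<n} \<and> r < n \<and> r \<notin> set as"
    show "\<exists>R\<in>regular_rel. implements (Proj i) as r n R"
    proof (cases "i < length as")
      case False
      then have "implements (Proj i) as r n {}" by (auto simp: implements_def elim: recf_Proj)
      then show ?thesis using empty_regular_rel by blast
    next
      case True
      then have "implements (Proj i) as r n (act_rel (Cpy r (as ! i)))"
        by (auto simp: implements_def act_rel_def intro: recf_eval_Proj)
      then show ?thesis by (blast intro: regular_rel.intros)
    qed
  qed
next
  case (Comp f gs)
  then show ?case by (intro compilable_Comp)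
next
  case (Prim f g)
  then show ?case by (rule compilable_Prim)
next
  case (Mu f)
  then show ?case by (rule compilable_Mu)
qed

section \<open>Regular relations as reachability in finite control-flow graphs\<close>

definition edge_step :: "(nat \<times> act \<times> nat) set \<Rightarrow> ((nat \<times> (nat \<Rightarrow> nat)) \<times> (nat \<times> (nat \<Rightarrow> nat))) set" where
  "edge_step E = {((i, s), (j, t)). \<exists>a. (i, a, j) \<in> E \<and> (s, t) \<in> act_rel a}"

text \<open>No edge leaves the exit \<open>l'\<close>, but edges may lead back to the entry
  \<open>l\<close>. The former makes it sound to glue two graphs at a common node: a run that has
  passed it cannot return to the first graph.\<close>

definition flow_graph ::
  "nat \<Rightarrow> ((nat \<Rightarrow> nat) \<times> (nat \<Rightarrow> nat)) set \<Rightarrow> nat \<Rightarrow> (nat \<times> act \<times> nat) set \<Rightarrow> bool" where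
  "flow_graph l R l' E \<longleftrightarrow> finite E \<and> l < l' \<and>
     (\<forall>i a j. (i, a, j) \<in> E \<longrightarrow> l \<le> i \<and> i < l' \<and> l \<le> j \<and> j \<le> l') \<and>
     (\<forall>s t. (s, t) \<in> R \<longleftrightarrow> ((l, s), (l', t)) \<in> (edge_step E)\<^sup>*)"

lemma flow_graphD:
  assumes "flow_graph l R l' E"
  shows "l < l'" and "(i, a, j) \<in> E \<Longrightarrow> l \<le> i \<and> i < l' \<and> l \<le> j \<and> j \<le> l'"
    and "(s, t) \<in> R \<longleftrightarrow> ((l, s), (l', t)) \<in> (edge_step E)\<^sup>*"
  using assms unfolding flow_graph_def by blast+

lemma edge_step_mono: "E \<subseteq> E' \<Longrightarrow> (x, y) \<in> (edge_step E)\<^sup>* \<Longrightarrow> (x, y) \<in> (edge_step E')\<^sup>*"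
  by (rule rtrancl_mono[THEN subsetD]) (auto simp: edge_step_def)

lemma edge_stepI: "(i, a, j) \<in> E \<Longrightarrow> (s, t) \<in> act_rel a \<Longrightarrow> ((i, s), (j, t)) \<in> edge_step E"
  by (auto simp: edge_step_def)

lemma flow_graph_act: "flow_graph l (act_rel a) (Suc l) {(l, a, Suc l)}"
proof -
  let ?E = "{(l, a, Suc l)}"
  have "(p = l \<and> u = s) \<or> (p = Suc l \<and> (s, u) \<in> act_rel a)"
    if "((l, s), (p, u)) \<in> (edge_step ?E)\<^sup>*" for s p u
    using that by (induction "(p, u)" arbitrary: p u rule: rtrancl_induct) (auto simp: edge_step_def)
  moreover have "((l, s), (Suc l, t)) \<in> (edge_step ?E)\<^sup>*" if "(s, t) \<in> act_rel a" for s t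
    using that by (intro r_into_rtrancl) (auto simp: edge_step_def)
  ultimately show ?thesis unfolding flow_graph_def by fastforce
qed

lemma flow_graph_seq:
  assumes E: "flow_graph l R m E" and F: "flow_graph m S l' F"
  shows "flow_graph l (R O S) l' (E \<union> F)"
proof -
  have inv: "(p < m \<and> ((l, s), (p, u)) \<in> (edge_step E)\<^sup>*) \<or>
      (m \<le> p \<and> (\<exists>v. (s, v) \<in> R \<and> ((m, v), (p, u)) \<in> (edge_step F)\<^sup>*))"
    if "((l, s), (p, u)) \<in> (edge_step (E \<union> F))\<^sup>*" for s p u
    using that
  proof (induction "(p, u)" arbitrary: p u rule: rtrancl_induct)
    case base
    then show ?case using E by (simp add: flow_graph_def)
  next
    case (step y)
    obtain q w where y: "y = (q, w)" by force
    from step(2) y obtain a where a: "(q, a, p) \<in> E \<union> F" "(w, u) \<in> act_rel a"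
      by (auto simp: edge_step_def)
    show ?case
    proof (cases "q < m")
      case True
      then have qE: "(q, a, p) \<in> E" using a(1) flow_graphD(2)[OF F] by fastforce
      have "((l, s), (q, w)) \<in> (edge_step E)\<^sup>*" using step(3)[OF y] True by simp
      then have r: "((l, s), (p, u)) \<in> (edge_step E)\<^sup>*"
        using edge_stepI[OF qE a(2)] by (rule rtrancl_into_rtrancl)
      have "p \<le> m" using flow_graphD(2)[OF E qE] by simp
      then show ?thesis
      proof (cases "p = m")
        case True
        then have "(s, u) \<in> R" using r by (simp add: flow_graphD(3)[OF E])
        then show ?thesis using True by blast
      qed (use r in auto)
    next
      case False
      then have qF: "(q, a, p) \<in> F" using a(1) flow_graphD(2)[OF E] by fastforce
      obtain v where v: "(s, v) \<in> R" "((m, v), (q, w)) \<in> (edge_step F)\<^sup>*"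
        using step(3)[OF y] False by auto
      have "((m, v), (p, u)) \<in> (edge_step F)\<^sup>*"
        using v(2) edge_stepI[OF qF a(2)] by (rule rtrancl_into_rtrancl)
      moreover have "m \<le> p" using flow_graphD(2)[OF F qF] by simp
      ultimately show ?thesis using v(1) by blast
    qed
  qed
  have "(s, t) \<in> R O S \<longleftrightarrow> ((l, s), (l', t)) \<in> (edge_step (E \<union> F))\<^sup>*" for s t
  proof
    assume "(s, t) \<in> R O S"
    then obtain u where u: "(s, u) \<in> R" "(u, t) \<in> S" by blast
    have "((l, s), (m, u)) \<in> (edge_step (E \<union> F))\<^sup>*"
      by (rule edge_step_mono[OF _ flow_graphD(3)[OF E, THEN iffD1, OF u(1)]]) auto
    moreover have "((m, u), (l', t)) \<in> (edge_step (E \<union> F))\<^sup>*"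
      by (rule edge_step_mono[OF _ flow_graphD(3)[OF F, THEN iffD1, OF u(2)]]) auto
    ultimately show "((l, s), (l', t)) \<in> (edge_step (E \<union> F))\<^sup>*" by (rule rtrancl_trans)
  next
    assume "((l, s), (l', t)) \<in> (edge_step (E \<union> F))\<^sup>*"
    then show "(s, t) \<in> R O S" using inv[of s l' t] flow_graphD(1)[OF F] flow_graphD(3)[OF F, THEN iffD2] by fastforce
  qed
  moreover have "l \<le> i \<and> i < l' \<and> l \<le> j \<and> j \<le> l'" if "(i, a, j) \<in> E \<union> F" for i a j
  proof -
    have "l < m" "m < l'" using E F by (auto simp: flow_graph_def)
    moreover have "(l \<le> i \<and> i < m \<and> l \<le> j \<and> j \<le> m) \<or> (m \<le> i \<and> i < l' \<and> m \<le> j \<and> j \<le> l')"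
      using that E F unfolding flow_graph_def by blast
    ultimately show ?thesis by linarith
  qed
  ultimately show ?thesis using E F unfolding flow_graph_def by simp
qed

text \<open>\<open>Chk 0 0\<close> always succeeds and acts as a no-op. The loop needs a fresh
  entry: edges of the body may lead back to the body's own entry, so leaving from there could cut
  off a round in the middle.\<close>

lemma flow_graph_star:
  assumes E: "flow_graph (Suc l) R m E"
  shows "flow_graph l (R\<^sup>*) (Suc m)
    (E \<union> {(l, Chk 0 0, Suc l), (m, Chk 0 0, l), (l, Chk 0 0, Suc m)})" (is "flow_graph _ _ _ ?F")
proof -
  have nop: "(s, t) \<in> act_rel (Chk 0 0) \<longleftrightarrow> t = s" for s t by (auto simp: act_rel_def)
  have lm: "Suc l < m" using E by (simp add: flow_graph_def)
  have inv: "(p = l \<and> (s, u) \<in> R\<^sup>*) \<or> (p = Suc m \<and> (s, u) \<in> R\<^sup>*) \<or>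
      (Suc l \<le> p \<and> p \<le> m \<and> (\<exists>v. (s, v) \<in> R\<^sup>* \<and> ((Suc l, v), (p, u)) \<in> (edge_step E)\<^sup>*))"
    if "((l, s), (p, u)) \<in> (edge_step ?F)\<^sup>*" for s p u
    using that
  proof (induction "(p, u)" arbitrary: p u rule: rtrancl_induct)
    case base
    then show ?case by simp
  next
    case (step y)
    obtain q w where y: "y = (q, w)" by force
    from step(2) y obtain a where a: "(q, a, p) \<in> ?F" "(w, u) \<in> act_rel a"
      by (auto simp: edge_step_def)
    note IH = step(3)[OF y]
    consider "(q, a, p) \<in> E" | "q = l" "p = Suc l" "u = w" | "q = m" "p = l" "u = w" | "q = l" "p = Suc m" "u = w"
      using a nop by auto
    then show ?case
    proof cases
      case 1
      then have q: "Suc l \<le> q" "q < m" "Suc l \<le> p" "p \<le> m" using flow_graphD(2)[OF E 1] by auto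
      then obtain v where v: "(s, v) \<in> R\<^sup>*" "((Suc l, v), (q, w)) \<in> (edge_step E)\<^sup>*" using IH by auto
      have "((Suc l, v), (p, u)) \<in> (edge_step E)\<^sup>*"
        using v(2) edge_stepI[OF 1 a(2)] by (rule rtrancl_into_rtrancl)
      then show ?thesis using q v(1) by blast
    next
      case 2
      then show ?thesis using IH lm by auto
    next
      case 3
      then obtain v where v: "(s, v) \<in> R\<^sup>*" "((Suc l, v), (m, w)) \<in> (edge_step E)\<^sup>*" using IH lm by auto
      then have "(v, w) \<in> R" using flow_graphD(3)[OF E] by blast
      then show ?thesis using v(1) 3 by (meson rtrancl.rtrancl_into_rtrancl)
    next
      case 4
      then show ?thesis using IH lm by auto
    qed
  qed
  have fwd: "((l, s), (l, t)) \<in> (edge_step ?F)\<^sup>*" if "(s, t) \<in> R\<^sup>*" for s t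
    using that
  proof (induction rule: rtrancl_induct)
    case (step u t)
    have "((l, u), (Suc l, u)) \<in> edge_step ?F" "((m, t), (l, t)) \<in> edge_step ?F"
      by (auto intro!: edge_stepI simp: nop)
    moreover have "((Suc l, u), (m, t)) \<in> (edge_step ?F)\<^sup>*"
      by (rule edge_step_mono[OF _ flow_graphD(3)[OF E, THEN iffD1, OF step(2)]]) auto
    ultimately show ?case using step(3) by (meson converse_rtrancl_into_rtrancl rtrancl.rtrancl_into_rtrancl rtrancl_trans)
  qed simp
  have "(s, t) \<in> R\<^sup>* \<longleftrightarrow> ((l, s), (Suc m, t)) \<in> (edge_step ?F)\<^sup>*" for s t
  proof
    assume "(s, t) \<in> R\<^sup>*"
    moreover have "((l, t), (Suc m, t)) \<in> edge_step ?F" by (auto intro!: edge_stepI simp: nop)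
    ultimately show "((l, s), (Suc m, t)) \<in> (edge_step ?F)\<^sup>*" using fwd by (meson rtrancl.rtrancl_into_rtrancl)
  next
    assume "((l, s), (Suc m, t)) \<in> (edge_step ?F)\<^sup>*"
    then show "(s, t) \<in> R\<^sup>*" using inv[of s "Suc m" t] lm by auto
  qed
  moreover have "l \<le> i \<and> i < Suc m \<and> l \<le> j \<and> j \<le> Suc m" if "(i, a, j) \<in> ?F" for i a j
  proof -
    have "(Suc l \<le> i \<and> i < m \<and> Suc l \<le> j \<and> j \<le> m) \<or> (i, a, j) \<notin> E"
      using E unfolding flow_graph_def by blast
    then show ?thesis using that lm by auto
  qed
  ultimately show ?thesis using E lm unfolding flow_graph_def by simp
qed

lemma regular_rel_flow_graph: "R \<in> regular_rel \<Longrightarrow> \<exists>l' E. flow_graph l R l' E"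
proof (induction arbitrary: l rule: regular_rel.induct)
  case (act a)
  show ?case using flow_graph_act by blast
next
  case (seq R S)
  then show ?case using flow_graph_seq by metis
next
  case (star R)
  then show ?case using flow_graph_star by metis
qed

text \<open>The input is in register 0, the output in register 1, and scratch space starts at 2.
  Only halting matters, so the final register contents are forgotten.\<close>

theorem recf_flow_graph:
  obtains l E where "finite E"
    "\<And>n. (\<exists>y. recf_eval f [n] y) \<longleftrightarrow> (\<exists>t. ((0, (\<lambda>_. 0)(0 := n)), (l, t)) \<in> (edge_step E)\<^sup>*)"
proof -
  obtain R where R: "R \<in> regular_rel" "implements f [0] 1 2 R"
    using compilableD[OF compilable_all, of "[0]" 2 1 f] by auto
  obtain l E where E: "flow_graph 0 R l E" using regular_rel_flow_graph[OF R(1)] by blast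
  have "(\<exists>y. recf_eval f [n] y) \<longleftrightarrow> (\<exists>t. ((\<lambda>_. 0)(0 := n), t) \<in> R)" for n
    using implements_sound(1)[OF R(2), of "(\<lambda>_. 0)(0 := n)"]
      implements_complete[OF R(2), of "(\<lambda>_. 0)(0 := n)"] by fastforce
  then show ?thesis using that[of E l] E by (auto simp: flow_graph_def)
qed

section \<open>The bisimilarity distance as a least fixed point\<close>

lemma couplings_nonempty: "couplings \<mu> \<nu> \<noteq> {}"
proof -
  have "pair_pmf \<mu> \<nu> \<in> couplings \<mu> \<nu>"
    by (simp add: couplings_def map_fst_pair_pmf map_snd_pair_pmf)
  then show ?thesis by blast
qed

definition unit_valued :: "('s \<Rightarrow> 's \<Rightarrow> real) \<Rightarrow> bool" where
  "unit_valued e \<longleftrightarrow> (\<forall>s t. 0 \<le> e s t \<and> e s t \<le> 1)"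

lemma integrable_unit_valued:
  "unit_valued e \<Longrightarrow> integrable (measure_pmf \<omega>) (\<lambda>(u, v). e u v)"
  by (rule measure_pmf.integrable_const_bound[where B = 1])
    (auto simp: unit_valued_def intro!: AE_I2)

lemma expectation_unit_valued:
  assumes "unit_valued e"
  shows "0 \<le> measure_pmf.expectation \<omega> (\<lambda>(u, v). e u v)"
    and "measure_pmf.expectation \<omega> (\<lambda>(u, v). e u v) \<le> 1"
proof -
  show "0 \<le> measure_pmf.expectation \<omega> (\<lambda>(u, v). e u v)"
    using assms by (intro integral_nonneg_AE) (auto simp: unit_valued_def)
  have "measure_pmf.expectation \<omega> (\<lambda>(u, v). e u v) \<le> measure_pmf.expectation \<omega> (\<lambda>_. 1)"
    using assms by (intro integral_mono integrable_unit_valued) (auto simp: unit_valued_def)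
  then show "measure_pmf.expectation \<omega> (\<lambda>(u, v). e u v) \<le> 1" by simp
qed

lemma Delta_le:
  assumes "unit_valued e" "lb s = lb t" "\<omega> \<in> couplings (\<tau> s) (\<tau> t)"
  shows "Delta \<tau> lb e s t \<le> measure_pmf.expectation \<omega> (\<lambda>(u, v). e u v)"
proof -
  have "bdd_below ((\<lambda>\<omega>. measure_pmf.expectation \<omega> (\<lambda>(u, v). e u v)) ` couplings (\<tau> s) (\<tau> t))"
    using expectation_unit_valued(1)[OF assms(1)] by (intro bdd_belowI2[of _ 0]) auto
  then show ?thesis
    using assms(2,3) by (auto simp: Delta_def intro: cINF_lower)
qed

lemma Delta_ge:
  assumes "\<And>\<omega>. lb s = lb t \<Longrightarrow> \<omega> \<in> couplings (\<tau> s) (\<tau> t) \<Longrightarrow> c \<le> measure_pmf.expectation \<omega> (\<lambda>(u, v). e u v)"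
    and "c \<le> 1"
  shows "c \<le> Delta \<tau> lb e s t"
  using assms by (auto simp: Delta_def intro!: cINF_greatest couplings_nonempty)

lemma Delta_unit_valued:
  assumes "unit_valued e"
  shows "unit_valued (Delta \<tau> lb e)"
  unfolding unit_valued_def
proof (intro allI conjI)
  fix s t
  show "0 \<le> Delta \<tau> lb e s t"
    using expectation_unit_valued(1)[OF assms] by (intro Delta_ge) auto
  obtain \<omega> where "\<omega> \<in> couplings (\<tau> s) (\<tau> t)" using couplings_nonempty by blast
  then show "Delta \<tau> lb e s t \<le> 1"
    using Delta_le[OF assms, of lb s t \<omega> \<tau>] expectation_unit_valued(2)[OF assms, of \<omega>]
    by (cases "lb s = lb t") (auto simp: Delta_def)
qed

lemma Delta_mono:
  assumes "unit_valued e" "unit_valued e'" "\<And>s t. e s t \<le> e' s t"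
  shows "Delta \<tau> lb e s t \<le> Delta \<tau> lb e' s t"
proof (rule Delta_ge)
  fix \<omega> assume w: "lb s = lb t" "\<omega> \<in> couplings (\<tau> s) (\<tau> t)"
  have "Delta \<tau> lb e s t \<le> measure_pmf.expectation \<omega> (\<lambda>(u, v). e u v)"
    by (rule Delta_le[OF assms(1) w])
  also have "\<dots> \<le> measure_pmf.expectation \<omega> (\<lambda>(u, v). e' u v)"
    using assms by (intro integral_mono integrable_unit_valued) auto
  finally show "Delta \<tau> lb e s t \<le> measure_pmf.expectation \<omega> (\<lambda>(u, v). e' u v)" .
next
  show "Delta \<tau> lb e s t \<le> 1"
    using Delta_unit_valued[OF assms(1)] by (auto simp: unit_valued_def)
qed

definition prefixpoints :: "('s \<Rightarrow> 's pmf) \<Rightarrow> ('s \<Rightarrow> 'l) \<Rightarrow> ('s \<Rightarrow> 's \<Rightarrow> real) set" where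
  "prefixpoints \<tau> lb = {e. unit_valued e \<and> (\<forall>s t. Delta \<tau> lb e s t \<le> e s t)}"

text \<open>The Knaster-Tarski argument for unit-valued functions: by monotonicity the pointwise
  infimum \<open>d\<close> of all pre-fixed points is one, and so is its image under
  \<open>Delta\<close>, whence equality. Uniqueness of the least fixed point then justifies the
  definite description in \<open>bisim_dist\<close>.\<close>

lemma bisim_dist_least:
  fixes \<tau> :: "'s \<Rightarrow> 's pmf" and lb :: "'s \<Rightarrow> 'l"
  shows "bisim_dist \<tau> lb \<in> Delta_fixpoints \<tau> lb"
    and "e \<in> prefixpoints \<tau> lb \<Longrightarrow> bisim_dist \<tau> lb s t \<le> e s t"
proof -
  define d where "d = (\<lambda>s t. INF e\<in>prefixpoints \<tau> lb. e s t)"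
  have one: "(\<lambda>_ _. 1) \<in> prefixpoints \<tau> lb"
    using Delta_unit_valued[of "\<lambda>_ _. 1" \<tau> lb] by (auto simp: prefixpoints_def unit_valued_def)
  have d_le: "d s t \<le> e s t" if "e \<in> prefixpoints \<tau> lb" for e s t
    unfolding d_def using that
    by (intro cINF_lower bdd_belowI2[of _ 0]) (auto simp: prefixpoints_def unit_valued_def)
  have d_ge: "c \<le> d s t" if "\<And>e. e \<in> prefixpoints \<tau> lb \<Longrightarrow> c \<le> e s t" for c s t
    unfolding d_def using that one by (intro cINF_greatest) auto
  have u: "unit_valued d"
    unfolding unit_valued_def
    using d_le[OF one] d_ge[of 0] by (auto simp: prefixpoints_def unit_valued_def)
  have le: "Delta \<tau> lb d s t \<le> d s t" for s t
  proof (rule d_ge)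
    fix e assume e: "e \<in> prefixpoints \<tau> lb"
    have "Delta \<tau> lb d s t \<le> Delta \<tau> lb e s t"
      using e by (intro Delta_mono[OF u] d_le) (auto simp: prefixpoints_def)
    also have "\<dots> \<le> e s t" using e by (simp add: prefixpoints_def)
    finally show "Delta \<tau> lb d s t \<le> e s t" .
  qed
  have "Delta \<tau> lb d \<in> prefixpoints \<tau> lb"
    unfolding prefixpoints_def
    using Delta_unit_valued[OF u, of \<tau> lb] Delta_mono[OF Delta_unit_valued[OF u, of \<tau> lb] u le] by auto
  then have fixp: "Delta \<tau> lb d = d"
    using le d_le by (intro ext antisym) auto
  have d: "d \<in> Delta_fixpoints \<tau> lb"
    using u fixp by (simp add: Delta_fixpoints_def unit_valued_def)
  have sub: "Delta_fixpoints \<tau> lb \<subseteq> prefixpoints \<tau> lb"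
    by (auto simp: Delta_fixpoints_def prefixpoints_def unit_valued_def)
  have "bisim_dist \<tau> lb = d"
    unfolding bisim_dist_def
  proof (rule the_equality)
    show "d \<in> Delta_fixpoints \<tau> lb \<and> (\<forall>e\<in>Delta_fixpoints \<tau> lb. \<forall>s t. d s t \<le> e s t)"
      using d d_le sub by blast
    fix d' assume d': "d' \<in> Delta_fixpoints \<tau> lb \<and> (\<forall>e\<in>Delta_fixpoints \<tau> lb. \<forall>s t. d' s t \<le> e s t)"
    show "d' = d"
    proof (intro ext antisym)
      fix s t
      show "d' s t \<le> d s t" using d d' by blast
      show "d s t \<le> d' s t" using d_le[of d'] d' sub by blast
    qed
  qed
  then show "bisim_dist \<tau> lb \<in> Delta_fixpoints \<tau> lb"
    and "e \<in> prefixpoints \<tau> lb \<Longrightarrow> bisim_dist \<tau> lb s t \<le> e s t"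
    using d d_le by auto
qed

lemma bisim_dist_unit_valued: "unit_valued (bisim_dist \<tau> lb)"
  using bisim_dist_least(1)[of \<tau> lb] by (auto simp: Delta_fixpoints_def unit_valued_def)

lemma bisim_dist_bounds: "0 \<le> bisim_dist \<tau> lb s t" "bisim_dist \<tau> lb s t \<le> 1"
  using bisim_dist_unit_valued[of \<tau> lb] by (auto simp: unit_valued_def)

lemma Delta_bisim_dist: "Delta \<tau> lb (bisim_dist \<tau> lb) = bisim_dist \<tau> lb"
  using bisim_dist_least(1)[of \<tau> lb] by (auto simp: Delta_fixpoints_def)

lemma bisim_dist_label: "lb s \<noteq> lb t \<Longrightarrow> bisim_dist \<tau> lb s t = 1"
  by (subst Delta_bisim_dist[symmetric]) (simp add: Delta_def)

lemma bisim_dist_ge: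
  assumes "\<And>\<omega>. lb s = lb t \<Longrightarrow> \<omega> \<in> couplings (\<tau> s) (\<tau> t) \<Longrightarrow>
      c \<le> measure_pmf.expectation \<omega> (\<lambda>(u, v). bisim_dist \<tau> lb u v)"
    and "c \<le> 1"
  shows "c \<le> bisim_dist \<tau> lb s t"
  by (subst Delta_bisim_dist[symmetric]) (rule Delta_ge[OF assms])

text \<open>A Dirac measure leaves no freedom to the coupling. Wherever the second run moves
  deterministically, the infimum in \<open>Delta\<close> is therefore a plain expectation.\<close>

lemma couplings_return_right:
  "couplings \<mu> (return_pmf y) = {map_pmf (\<lambda>x. (x, y)) \<mu>}"
proof (intro set_eqI iffI)
  fix \<omega> assume "\<omega> \<in> couplings \<mu> (return_pmf y)"
  then have w: "map_pmf fst \<omega> = \<mu>" "map_pmf snd \<omega> = return_pmf y" by (auto simp: couplings_def)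
  have "snd p = y" if "p \<in> set_pmf \<omega>" for p
    using that w(2) by (metis imageI pmf.set_map set_return_pmf singletonD)
  then have "map_pmf (\<lambda>p. (fst p, y)) \<omega> = map_pmf (\<lambda>p. p) \<omega>"
    by (intro map_pmf_cong) (auto simp: prod_eq_iff)
  then show "\<omega> \<in> {map_pmf (\<lambda>x. (x, y)) \<mu>}"
    by (simp add: w(1)[symmetric] pmf.map_comp comp_def)
next
  fix \<omega> assume "\<omega> \<in> {map_pmf (\<lambda>x. (x, y)) \<mu>}"
  then show "\<omega> \<in> couplings \<mu> (return_pmf y)"
    by (auto simp: couplings_def pmf.map_comp comp_def map_pmf_const)
qed

lemma bisim_dist_return_right:
  assumes "lb s = lb t" "\<tau> t = return_pmf y"
  shows "bisim_dist \<tau> lb s t = measure_pmf.expectation (\<tau> s) (\<lambda>x. bisim_dist \<tau> lb x y)"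
  using assms
  by (subst Delta_bisim_dist[symmetric]) (simp add: Delta_def couplings_return_right)

text \<open>The indicator of the complement of \<open>R\<close> is a pre-fixed point. The case of
  deterministic steps is the one that arises for two runs in copies of the announcing state under a
  deterministic strategy.\<close>

lemma bisim_dist_bisimulation:
  assumes "\<And>s t. (s, t) \<in> R \<Longrightarrow> lb s = lb t"
    and "\<And>s t. (s, t) \<in> R \<Longrightarrow> \<exists>s' t'. \<tau> s = return_pmf s' \<and> \<tau> t = return_pmf t' \<and> (s', t') \<in> R"
    and "(s, t) \<in> R"
  shows "bisim_dist \<tau> lb s t = 0"
proof -
  define e :: "'a \<Rightarrow> 'a \<Rightarrow> real" where "e = (\<lambda>s t. if (s, t) \<in> R then 0 else 1)"
  have u: "unit_valued e" by (auto simp: unit_valued_def e_def)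
  have "Delta \<tau> lb e s t \<le> e s t" for s t
  proof (cases "(s, t) \<in> R")
    case True
    then obtain s' t' where st: "\<tau> s = return_pmf s'" "\<tau> t = return_pmf t'" "(s', t') \<in> R"
      using assms(2) by blast
    then show ?thesis
      using True assms(1)[OF True] by (simp add: Delta_def couplings_return_right e_def)
  next
    case False
    then show ?thesis using Delta_unit_valued[OF u, of \<tau> lb] by (auto simp: e_def unit_valued_def)
  qed
  then have "e \<in> prefixpoints \<tau> lb" using u by (simp add: prefixpoints_def)
  then have "bisim_dist \<tau> lb s t \<le> e s t" by (rule bisim_dist_least(2))
  then show ?thesis using bisim_dist_bounds(1)[of \<tau> lb s t] assms(3) by (auto simp: e_def)
qed

section \<open>The MDP of a probabilistic automaton\<close>

lemma last_st_extend [simp]: "last_st (extend \<rho> m t) = t"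
  by (simp add: last_st_def extend_def)

lemma length_extend [simp]: "length (snd (extend \<rho> m t)) = Suc (length (snd \<rho>))"
  by (simp add: extend_def)

lemma steps_ok_snoc:
  "steps_ok I s (r @ [(m, t)]) \<longleftrightarrow> steps_ok I s r \<and>
    (\<exists>ps. phi I (last_st (s, r)) m = Some ps \<and> t < length ps \<and> 0 < ps ! t)"
proof (induction r arbitrary: s)
  case Nil
  show ?case by (auto simp: last_st_def split: option.splits)
next
  case (Cons q r)
  obtain a b where "q = (a, b)" by force
  moreover have "last_st (s, (a, b) # r) = last_st (b, r)" by (simp add: last_st_def)
  ultimately show ?case using Cons by (auto split: option.splits)
qed

lemma is_path_extend:
  "is_path I \<rho> \<Longrightarrow> phi I (last_st \<rho>) m = Some ps \<Longrightarrow> t < length ps \<Longrightarrow> 0 < ps ! t \<Longrightarrow>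
   is_path I (extend \<rho> m t)"
  by (cases \<rho>) (auto simp: is_path_def extend_def steps_ok_snoc)

lemma pmf_dist_pmf:
  assumes "\<forall>p\<in>set ps. 0 \<le> p" "sum_list ps = 1"
  shows "pmf (dist_pmf ps) t = (if t < length ps then real_of_rat (ps ! t) else 0)"
  unfolding dist_pmf_def
proof (rule pmf_embed_pmf)
  let ?f = "\<lambda>t. if t < length ps then real_of_rat (ps ! t) else 0"
  show nn: "0 \<le> ?f x" for x using assms(1) by auto
  have "(\<integral>\<^sup>+x. ennreal (?f x) \<partial>count_space UNIV) = (\<Sum>x<length ps. ennreal (?f x))"
    by (rule nn_integral_count_space') auto
  also have "\<dots> = ennreal (\<Sum>x<length ps. ?f x)"
    using nn by (intro sum_ennreal)
  also have "(\<Sum>x<length ps. ?f x) = real_of_rat (\<Sum>x<length ps. ps ! x)"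
    by (simp add: of_rat_sum)
  also have "(\<Sum>x<length ps. ps ! x) = 1"
    using assms(2) by (simp add: sum_list_sum_nth atLeast0LessThan)
  finally show "(\<integral>\<^sup>+x. ennreal (?f x) \<partial>count_space UNIV) = 1" by simp
qed

lemma expectation_dist_pmf:
  assumes "\<forall>p\<in>set ps. 0 \<le> p" "sum_list ps = 1"
  shows "measure_pmf.expectation (dist_pmf ps) f = (\<Sum>t<length ps. real_of_rat (ps ! t) * f t)"
proof -
  have "measure_pmf.expectation (dist_pmf ps) f = (\<Sum>t<length ps. f t * pmf (dist_pmf ps) t)"
    by (rule integral_measure_pmf_real) (auto simp: set_pmf_iff pmf_dist_pmf[OF assms] split: if_splits)
  then show ?thesis by (simp add: pmf_dist_pmf[OF assms] mult.commute)
qed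

lemma sum_list_unit_list: "k < n \<Longrightarrow> sum_list (map (\<lambda>u. if u = k then 1 else (0::rat)) [0..<n]) = 1"
  by (simp add: interv_sum_list_conv_sum_set_nat sum.delta)

lemma dist_pmf_unit_list:
  assumes "k < n"
  shows "dist_pmf (map (\<lambda>u. if u = k then 1 else 0) [0..<n]) = return_pmf k"
proof (rule pmf_eqI)
  fix t
  show "pmf (dist_pmf (map (\<lambda>u. if u = k then 1 else 0) [0..<n])) t = pmf (return_pmf k) t"
    using assms by (subst pmf_dist_pmf) (auto simp: sum_list_unit_list pmf_return)
qed

text \<open>
  State \<open>i < D\<close> is a state of the automaton, and \<open>D\<close> is the state that merely announces letters.
  State \<open>i + Suc D * Suc a\<close> is \<open>i\<close> after announcing the letter \<open>a\<close>; from it the automaton moves to \<open>j\<close>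
  with probability \<open>P a i j\<close>, rejects with probability \<open>R a i\<close>, and otherwise escapes to \<open>D\<close>. The last
  three states are the two sources and the rejecting sink. Separating announcement and random move
  makes the cost of a coupling linear in the announced letters, even for randomised strategies.
  The label of \<open>s\<close> is \<open>s div Suc D\<close>.
\<close>

definition mdp_size :: "nat \<Rightarrow> nat \<Rightarrow> nat" where
  "mdp_size D L = Suc D * Suc L + 3"

definition mdp_prob ::
  "nat \<Rightarrow> nat \<Rightarrow> (nat \<Rightarrow> nat \<Rightarrow> nat \<Rightarrow> rat) \<Rightarrow> (nat \<Rightarrow> nat \<Rightarrow> rat) \<Rightarrow> (nat \<Rightarrow> rat) \<Rightarrow> nat \<Rightarrow> nat \<Rightarrow> nat \<Rightarrow> rat" where
  "mdp_prob D L P R v s m u =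
    (if s < Suc D then (if u = s + Suc D * Suc m then 1 else 0)
     else if s < Suc D * Suc L then
       (let i = s mod Suc D; a = s div Suc D - 1 in
        if i = D then (if u = D then 1 else 0)
        else if u < D then P a i u
        else if u = D then 1 - R a i - (\<Sum>j<D. P a i j)
        else if u = Suc D * Suc L + 2 then R a i else 0)
     else if s = Suc D * Suc L then (if u < D then v u else 0)
     else if s = Suc D * Suc L + 1 then (if u = D then 1 else 0)
     else (if u = s then 1 else 0))"

definition mdp_row ::
  "nat \<Rightarrow> nat \<Rightarrow> (nat \<Rightarrow> nat \<Rightarrow> nat \<Rightarrow> rat) \<Rightarrow> (nat \<Rightarrow> nat \<Rightarrow> rat) \<Rightarrow> (nat \<Rightarrow> rat) \<Rightarrow> nat \<Rightarrow> nat \<Rightarrow> rat list" where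
  "mdp_row D L P R v s m = map (mdp_prob D L P R v s m) [0..<mdp_size D L]"

text \<open>Actions are letters in the states below \<open>Suc D\<close>; everywhere else the only
  action is 0. The first source is left out because its row is listed separately.\<close>

definition mdp_keys :: "nat \<Rightarrow> nat \<Rightarrow> (nat \<times> nat) list" where
  "mdp_keys D L = filter (\<lambda>(s, m). (s < Suc D \<or> m = 0) \<and> s \<noteq> Suc D * Suc L)
     (List.product [0..<mdp_size D L] [0..<L])"

text \<open>These rows do not depend on \<open>v\<close>, so the dummy 0 is put in its place. The
  initial distribution then occurs only in the head entry of \<open>trans\<close> in
  \<open>mdp_inst\<close>, and changing the input means replacing a single row.\<close>

definition mdp_rest ::
  "nat \<Rightarrow> nat \<Rightarrow> (nat \<Rightarrow> nat \<Rightarrow> nat \<Rightarrow> rat) \<Rightarrow> (nat \<Rightarrow> nat \<Rightarrow> rat) \<Rightarrow> (nat \<times> nat \<times> rat list) list" where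
  "mdp_rest D L P R = map (\<lambda>(s, m). (s, m, mdp_row D L P R (\<lambda>_. 0) s m)) (mdp_keys D L)"

definition mdp_inst ::
  "nat \<Rightarrow> nat \<Rightarrow> (nat \<Rightarrow> nat \<Rightarrow> nat \<Rightarrow> rat) \<Rightarrow> (nat \<Rightarrow> nat \<Rightarrow> rat) \<Rightarrow> (nat \<Rightarrow> rat) \<Rightarrow> dm_instance" where
  "mdp_inst D L P R v = \<lparr>n_states = mdp_size D L, n_acts = L,
     lab = map (\<lambda>s. s div Suc D) [0..<mdp_size D L],
     trans = (Suc D * Suc L, 0, mdp_row D L P R v (Suc D * Suc L) 0) # mdp_rest D L P R,
     src1 = Suc D * Suc L, src2 = Suc D * Suc L + 1, thr = 1 / 2\<rparr>"

locale pfa_mdp =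
  fixes D L :: nat and P :: "nat \<Rightarrow> nat \<Rightarrow> nat \<Rightarrow> rat" and R :: "nat \<Rightarrow> nat \<Rightarrow> rat" and v :: "nat \<Rightarrow> rat"
  assumes D_ge: "2 \<le> D" and L_pos: "0 < L"
    and P_nonneg: "a < L \<Longrightarrow> i < D \<Longrightarrow> j < D \<Longrightarrow> 0 \<le> P a i j"
    and R_nonneg: "a < L \<Longrightarrow> i < D \<Longrightarrow> 0 \<le> R a i"
    and P_R_sum: "a < L \<Longrightarrow> i < D \<Longrightarrow> R a i + (\<Sum>j<D. P a i j) \<le> 1"
    and v_nonneg: "i < D \<Longrightarrow> 0 \<le> v i"
    and v_sum: "(\<Sum>i<D. v i) = 1"
begin

section \<open>Transition structure and validity of the instance\<close>

abbreviation "B \<equiv> Suc D"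
abbreviation "N \<equiv> mdp_size D L"
abbreviation "bad \<equiv> B * Suc L + 2"
abbreviation "inst \<equiv> mdp_inst D L P R v"
abbreviation "tprob \<equiv> mdp_prob D L P R v"
abbreviation "trow \<equiv> mdp_row D L P R v"
abbreviation "lstate i a \<equiv> i + B * Suc a"

lemma lstate_less: "i \<le> D \<Longrightarrow> a < L \<Longrightarrow> lstate i a < B * Suc L"
proof -
  assume "i \<le> D" "a < L"
  then have "lstate i a < B + B * Suc a" by simp
  also have "\<dots> = B * Suc (Suc a)" by simp
  also have "\<dots> \<le> B * Suc L" using \<open>a < L\<close> by (intro mult_le_mono) auto
  finally show ?thesis .
qed

lemma lstate_div_mod:
  assumes "i \<le> D"
  shows "lstate i a div B = Suc a" "lstate i a mod B = i" "\<not> lstate i a < B"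
proof -
  have "i < B" using assms by simp
  then show "lstate i a div B = Suc a" "lstate i a mod B = i"
    using div_mult_self2[of B i "Suc a"] mod_mult_self2[of i B "Suc a"]
    by (simp_all del: mult_Suc mult_Suc_right)
qed simp

lemma N_eq: "N = B * Suc L + 3" by (simp add: mdp_size_def)

lemma less_N: "i \<le> D \<Longrightarrow> i < N" "bad < N" "B * Suc L < N" "B * Suc L + 1 < N"
  "Suc (Suc (B * Suc L)) < N" "Suc (B * Suc L) < N" "D \<le> N"
  by (simp_all add: N_eq)

text \<open>A block has at least three elements by \<open>D_ge\<close>, so both sources and the sink
  share the label \<open>Suc L\<close>. The sources thus agree, whereas the sink differs in label
  from all other states that can occur after the first step.\<close>

lemma special_div:
  assumes "k < 3"
  shows "(B * Suc L + k) div B = Suc L"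
proof -
  have "(k + B * Suc L) div B = Suc L + k div B" by (rule div_mult_self2) simp
  then show ?thesis using assms D_ge by (simp add: add.commute del: mult_Suc mult_Suc_right)
qed

lemma bad_gt: "Suc (Suc (B * Suc L)) \<noteq> D" "D \<noteq> Suc (Suc (B * Suc L))" "\<not> Suc (Suc (B * Suc L)) < D"
  by simp_all

lemma prob_choice: "s < B \<Longrightarrow> tprob s m = (\<lambda>u. if u = lstate s m then 1 else 0)"
  by (auto simp: mdp_prob_def)

lemma prob_letter:
  assumes "i < D" "a < L"
  shows "tprob (lstate i a) m = (\<lambda>u. if u < D then P a i u
    else if u = D then 1 - R a i - (\<Sum>j<D. P a i j) else if u = bad then R a i else 0)"
proof
  fix u
  show "tprob (lstate i a) m u = (if u < D then P a i u
    else if u = D then 1 - R a i - (\<Sum>j<D. P a i j) else if u = bad then R a i else 0)"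
    using lstate_less[of i a] lstate_div_mod[of i a] assms
    by (simp add: mdp_prob_def Let_def del: mult_Suc mult_Suc_right)
qed

lemma prob_copy:
  assumes "a < L"
  shows "tprob (lstate D a) m = (\<lambda>u. if u = D then 1 else 0)"
  using lstate_less[of D a] lstate_div_mod[of D a] assms
  by (intro ext) (simp add: mdp_prob_def Let_def del: mult_Suc mult_Suc_right)

lemma prob_src: 
  "tprob (B * Suc L) m = (\<lambda>u. if u < D then v u else 0)"
  "tprob (B * Suc L + 1) m = (\<lambda>u. if u = D then 1 else 0)"
  "tprob bad m = (\<lambda>u. if u = bad then 1 else 0)"
  "tprob (Suc (B * Suc L)) m = (\<lambda>u. if u = D then 1 else 0)"
  "tprob (Suc (Suc (B * Suc L))) m = (\<lambda>u. if u = bad then 1 else 0)"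
proof -
  define S where "S = B * Suc L"
  have "B \<le> S" by (simp add: S_def)
  then show "tprob (B * Suc L) m = (\<lambda>u. if u < D then v u else 0)"
    "tprob (B * Suc L + 1) m = (\<lambda>u. if u = D then 1 else 0)"
    "tprob bad m = (\<lambda>u. if u = bad then 1 else 0)"
    "tprob (Suc (B * Suc L)) m = (\<lambda>u. if u = D then 1 else 0)"
    "tprob (Suc (Suc (B * Suc L))) m = (\<lambda>u. if u = bad then 1 else 0)"
    unfolding mdp_prob_def S_def[symmetric] by auto
qed

lemma state_cases:
  assumes "s < N"
  obtains "s < B" | i a where "s = lstate i a" "i \<le> D" "a < L" 
    | "s = B * Suc L" | "s = B * Suc L + 1" | "s = bad"
proof (cases "s < B * Suc L")
  case True
  show ?thesis
  proof (cases "s < B")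
    case False
    have "s = lstate (s mod B) (s div B - 1)"
    proof -
      have "s div B \<noteq> 0" using False by (simp add: div_eq_0_iff)
      then have "Suc (s div B - 1) = s div B" by simp
      then show ?thesis by (metis add.commute mult_div_mod_eq)
    qed
    moreover have "s mod B \<le> D" using mod_less_divisor[of B s] by linarith
    moreover have "s div B < Suc L" using True by (simp add: less_mult_imp_div_less mult.commute del: mult_Suc mult_Suc_right)
    moreover have "s div B \<noteq> 0" using False by (simp add: div_eq_0_iff)
    ultimately show ?thesis using that(2)[of "s mod B" "s div B - 1"] by linarith
  qed (use that in blast)
next
  case False
  then have "s = B * Suc L \<or> s = B * Suc L + 1 \<or> s = bad" using assms unfolding N_eq by linarith
  then show ?thesis using that by blast
qed

lemma phi_inst: "phi inst s m = (if s < N \<and> m < L \<and> (s < B \<or> m = 0) then Some (trow s m) else None)"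
proof (cases "s = B * Suc L \<and> m = 0")
  case True
  then show ?thesis using L_pos by (simp add: phi_def mdp_inst_def N_eq del: mult_Suc mult_Suc_right)
next
  case False
  have "map (\<lambda>(s, m, ps). ((s, m), ps)) (mdp_rest D L P R) =
      map (\<lambda>k. (k, mdp_row D L P R (\<lambda>_. 0) (fst k) (snd k))) (mdp_keys D L)"
    by (simp add: mdp_rest_def case_prod_unfold)
  then have "phi inst s m = map_of (map (\<lambda>k. (k, mdp_row D L P R (\<lambda>_. 0) (fst k) (snd k))) (mdp_keys D L)) (s, m)"
    using False by (auto simp: phi_def mdp_inst_def)
  also have "\<dots> = (if (s, m) \<in> set (mdp_keys D L) then Some (mdp_row D L P R (\<lambda>_. 0) s m) else None)"
    by (simp add: map_of_map_restrict restrict_map_def)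
  also have "(s, m) \<in> set (mdp_keys D L) \<longleftrightarrow> s < N \<and> m < L \<and> (s < B \<or> m = 0)"
  proof -
    have "s \<noteq> B * Suc L" if "s < B \<or> m = 0" using that False by auto
    then show ?thesis by (auto simp: mdp_keys_def simp del: mult_Suc mult_Suc_right)
  qed
  also have "mdp_row D L P R (\<lambda>_. 0) s m = trow s m" if "s < N \<and> m < L \<and> (s < B \<or> m = 0)"
  proof -
    have "s \<noteq> B * Suc L" using that False by auto
    then show ?thesis by (simp add: mdp_row_def mdp_prob_def del: mult_Suc mult_Suc_right)
  qed
  ultimately show ?thesis by simp
qed

lemma row_nonneg_sum:
  assumes "s < N" "m < L"
  shows "\<forall>p\<in>set (trow s m). 0 \<le> p" "sum_list (trow s m) = 1"
proof -
  have unit: "(\<forall>p\<in>set (trow s m). 0 \<le> p) \<and> sum_list (trow s m) = 1"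
    if "tprob s m = (\<lambda>u. if u = k then 1 else 0)" "k < N" for k
    using sum_list_unit_list[OF that(2)] by (auto simp: mdp_row_def that(1))
  have "(\<forall>p\<in>set (trow s m). 0 \<le> p) \<and> sum_list (trow s m) = 1"
    using assms(1)
  proof (cases rule: state_cases)
    case 1
    then show ?thesis using lstate_less[of s m] assms(2) by (intro unit[OF prob_choice]) (auto simp: N_eq)
  next
    case (2 i a)
    show ?thesis
    proof (cases "i = D")
      case True
      then show ?thesis using 2 by (intro unit[of D]) (auto simp: less_N prob_copy simp del: mult_Suc mult_Suc_right)
    next
      case False
      then have i: "i < D" using 2 by simp
      have "0 \<le> tprob s m u" for u
        using P_nonneg[OF 2(3) i] R_nonneg[OF 2(3) i] P_R_sum[OF 2(3) i]
        by (simp add: 2(1) prob_letter[OF i 2(3)] del: mult_Suc mult_Suc_right)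
      moreover have "(\<Sum>u<N. tprob s m u) = 1"
      proof -
        have "(\<Sum>u<N. tprob s m u) = (\<Sum>u\<in>{..<D} \<union> {D, bad}. tprob s m u)"
          by (rule sum.mono_neutral_right)
            (auto simp: less_N 2(1) prob_letter[OF i 2(3)] simp del: mult_Suc mult_Suc_right)
        also have "\<dots> = (\<Sum>u<D. tprob s m u) + (tprob s m D + tprob s m bad)"
          by (subst sum.union_disjoint) (auto simp: bad_gt simp del: mult_Suc mult_Suc_right)
        also have "\<dots> = 1"
          by (simp add: 2(1) prob_letter[OF i 2(3)] bad_gt del: mult_Suc mult_Suc_right)
        finally show ?thesis .
      qed
      ultimately show ?thesis
        by (auto simp: mdp_row_def interv_sum_list_conv_sum_set_nat atLeast0LessThan)
    qed
  next
    case 3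
    have "(\<Sum>u<N. tprob s m u) = (\<Sum>u<D. tprob s m u)"
      by (rule sum.mono_neutral_right) (auto simp: less_N 3 prob_src simp del: mult_Suc mult_Suc_right)
    also have "\<dots> = 1" using v_sum by (simp add: 3 prob_src del: mult_Suc mult_Suc_right)
    finally have "(\<Sum>u<N. tprob s m u) = 1" .
    moreover have "0 \<le> tprob s m u" for u using v_nonneg by (simp add: 3 prob_src del: mult_Suc mult_Suc_right)
    ultimately show ?thesis
      by (auto simp: mdp_row_def interv_sum_list_conv_sum_set_nat atLeast0LessThan)
  next
    case 4
    then show ?thesis by (intro unit[of D]) (auto simp: less_N prob_src simp del: mult_Suc mult_Suc_right)
  next
    case 5
    then show ?thesis by (intro unit[of bad]) (auto simp: less_N prob_src simp del: mult_Suc mult_Suc_right)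
  qed
  then show "\<forall>p\<in>set (trow s m). 0 \<le> p" "sum_list (trow s m) = 1" by auto
qed

lemma valid_inst: "valid_instance inst"
proof -
  have trow: "length (trow s m) = N" for s m by (simp add: mdp_row_def)
  have dist: "distinct (map (\<lambda>(s, m, ps). (s, m)) (trans inst))"
  proof -
    have "map (\<lambda>(s, m, ps). (s, m)) (mdp_rest D L P R) = mdp_keys D L"
      by (simp add: mdp_rest_def case_prod_unfold comp_def)
    moreover have "distinct (mdp_keys D L)"
      unfolding mdp_keys_def by (intro distinct_filter distinct_product) auto
    moreover have "(B * Suc L, 0) \<notin> set (mdp_keys D L)" by (simp add: mdp_keys_def)
    ultimately show ?thesis by (simp add: mdp_inst_def del: mult_Suc mult_Suc_right)
  qed
  have "s < N \<and> m < L \<and> length ps = N \<and> (\<forall>p\<in>set ps. 0 \<le> p) \<and> sum_list ps = 1"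
    if "(s, m, ps) \<in> set (trans inst)" for s m ps
  proof -
    have "phi inst s m = Some ps"
      unfolding phi_def
    proof (rule map_of_is_SomeI)
      show "distinct (map fst (map (\<lambda>(s, m, ps). ((s, m), ps)) (trans inst)))"
        using dist by (simp add: case_prod_unfold comp_def)
      show "((s, m), ps) \<in> set (map (\<lambda>(s, m, ps). ((s, m), ps)) (trans inst))"
        using that by force
    qed
    then have "s < N \<and> m < L \<and> ps = trow s m" by (auto simp: phi_inst split: if_splits)
    then show ?thesis using row_nonneg_sum[of s m] by (simp add: trow)
  qed
  then show ?thesis
    unfolding valid_instance_def using dist
    by (auto simp: mdp_inst_def less_N simp del: mult_Suc mult_Suc_right)
qed

lemma enabled_inst: "enabled inst s = {m. s < N \<and> m < L \<and> (s < B \<or> m = 0)}"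
  by (auto simp: enabled_def phi_inst)

lemma is_path_last: "is_path inst \<rho> \<Longrightarrow> last_st \<rho> < N"
proof -
  assume p: "is_path inst \<rho>"
  obtain s r where \<rho>: "\<rho> = (s, r)" by force
  show ?thesis
  proof (cases r rule: rev_cases)
    case Nil
    then show ?thesis using p \<rho> by (simp add: is_path_def last_st_def mdp_inst_def)
  next
    case (snoc r' q)
    obtain m t where q: "q = (m, t)" by force
    have "\<exists>ps. phi inst (last_st (s, r')) m = Some ps \<and> t < length ps"
      using p \<rho> snoc q by (auto simp: is_path_def steps_ok_snoc)
    then have "t < N" by (auto simp: phi_inst mdp_row_def split: if_splits)
    then show ?thesis using \<rho> snoc q by (simp add: last_st_def)
  qed
qed

lemma is_path_extend_inst:
  assumes "is_path inst \<rho>" "m < L" "last_st \<rho> < B \<or> m = 0" "t < N" "0 < tprob (last_st \<rho>) m t"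
  shows "is_path inst (extend \<rho> m t)"
proof (rule is_path_extend[OF assms(1)])
  show "phi inst (last_st \<rho>) m = Some (trow (last_st \<rho>) m)"
    using assms is_path_last by (simp add: phi_inst)
qed (use assms in \<open>auto simp: mdp_row_def\<close>)

lemma lmc_lab_inst: "last_st \<rho> < N \<Longrightarrow> lmc_lab inst \<rho> = last_st \<rho> div B"
  by (simp add: lmc_lab_def mdp_inst_def)

lemma strategyD:
  assumes "is_strategy inst \<alpha>" "is_path inst \<rho>" "m \<in> set_pmf (\<alpha> \<rho>)"
  shows "m < L" "last_st \<rho> < B \<or> m = 0"
proof -
  have "m \<in> enabled inst (last_st \<rho>)" using assms unfolding is_strategy_def by blast
  then show "m < L" "last_st \<rho> < B \<or> m = 0" by (simp_all add: enabled_inst)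
qed

lemma tau_choice:
  assumes "is_path inst \<rho>" "last_st \<rho> < B" "is_strategy inst \<alpha>"
  shows "lmc_tau inst \<alpha> \<rho> = map_pmf (\<lambda>m. extend \<rho> m (lstate (last_st \<rho>) m)) (\<alpha> \<rho>)"
proof -
  let ?s = "last_st \<rho>"
  have "map_pmf (extend \<rho> m) (dist_pmf (the (phi inst ?s m))) = return_pmf (extend \<rho> m (lstate ?s m))"
    if "m \<in> set_pmf (\<alpha> \<rho>)" for m
  proof -
    have m: "m < L" using strategyD assms that by blast
    have "the (phi inst ?s m) = map (\<lambda>u. if u = lstate ?s m then 1 else 0) [0..<N]"
      using m assms(2) is_path_last[OF assms(1)] by (simp add: phi_inst mdp_row_def prob_choice)
    moreover have "lstate ?s m < N" using lstate_less[of ?s m] m assms(2) by (simp add: N_eq)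
    ultimately show ?thesis by (simp add: dist_pmf_unit_list del: mult_Suc mult_Suc_right)
  qed
  then have "lmc_tau inst \<alpha> \<rho> = bind_pmf (\<alpha> \<rho>) (\<lambda>m. return_pmf (extend \<rho> m (lstate ?s m)))"
    using assms(1) by (auto simp: lmc_tau_def intro!: bind_pmf_cong)
  then show ?thesis by (simp add: map_pmf_def)
qed

lemma tau_other:
  assumes "is_path inst \<rho>" "\<not> last_st \<rho> < B" "is_strategy inst \<alpha>"
  shows "lmc_tau inst \<alpha> \<rho> = map_pmf (extend \<rho> 0) (dist_pmf (trow (last_st \<rho>) 0))"
proof -
  have "set_pmf (\<alpha> \<rho>) \<subseteq> {0}" using strategyD assms by blast
  then have "\<alpha> \<rho> = return_pmf 0" by (simp add: set_pmf_subset_singleton)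
  then show ?thesis
    using assms(1) L_pos is_path_last[OF assms(1)] by (simp add: lmc_tau_def bind_return_pmf phi_inst)
qed

lemma expectation_tau_other:
  assumes "is_path inst \<rho>" "\<not> last_st \<rho> < B" "is_strategy inst \<alpha>"
  shows "measure_pmf.expectation (lmc_tau inst \<alpha> \<rho>) f =
    (\<Sum>u<N. real_of_rat (tprob (last_st \<rho>) 0 u) * f (extend \<rho> 0 u))"
proof -
  have "measure_pmf.expectation (lmc_tau inst \<alpha> \<rho>) f =
      measure_pmf.expectation (dist_pmf (trow (last_st \<rho>) 0)) (\<lambda>u. f (extend \<rho> 0 u))"
    by (simp add: tau_other[OF assms])
  also have "\<dots> = (\<Sum>u<length (trow (last_st \<rho>) 0). real_of_rat (trow (last_st \<rho>) 0 ! u) * f (extend \<rho> 0 u))"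
    using row_nonneg_sum[OF is_path_last[OF assms(1)] L_pos] by (rule expectation_dist_pmf)
  also have "\<dots> = (\<Sum>u<N. real_of_rat (tprob (last_st \<rho>) 0 u) * f (extend \<rho> 0 u))"
    by (intro sum.cong) (auto simp: mdp_row_def)
  finally show ?thesis .
qed

lemma tau_unit:
  assumes "is_path inst \<rho>" "\<not> last_st \<rho> < B" "is_strategy inst \<alpha>"
    and "tprob (last_st \<rho>) 0 = (\<lambda>u. if u = k then 1 else 0)" "k < N"
  shows "lmc_tau inst \<alpha> \<rho> = return_pmf (extend \<rho> 0 k)"
  using tau_other[OF assms(1-3)] dist_pmf_unit_list[OF assms(5)] by (simp add: mdp_row_def assms(4))

lemma expectation_letter:
  assumes "is_path inst \<rho>" "last_st \<rho> = lstate i a" "i < D" "a < L" "is_strategy inst \<alpha>"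
  shows "measure_pmf.expectation (lmc_tau inst \<alpha> \<rho>) f =
    (\<Sum>j<D. real_of_rat (P a i j) * f (extend \<rho> 0 j)) +
    (real_of_rat (1 - R a i - (\<Sum>j<D. P a i j)) * f (extend \<rho> 0 D) + real_of_rat (R a i) * f (extend \<rho> 0 bad))"
proof -
  let ?g = "\<lambda>u. real_of_rat (tprob (last_st \<rho>) 0 u) * f (extend \<rho> 0 u)"
  note p = prob_letter[OF assms(3,4)]
  have "\<not> last_st \<rho> < B" by (simp add: assms(2))
  then have "measure_pmf.expectation (lmc_tau inst \<alpha> \<rho>) f = (\<Sum>u<N. ?g u)"
    by (rule expectation_tau_other[OF assms(1) _ assms(5)])
  also have "\<dots> = (\<Sum>u\<in>{..<D} \<union> {D, bad}. ?g u)"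
    by (rule sum.mono_neutral_right) (auto simp: less_N assms(2) p simp del: mult_Suc mult_Suc_right)
  also have "\<dots> = (\<Sum>u<D. ?g u) + (?g D + ?g bad)"
    by (subst sum.union_disjoint) (auto simp: bad_gt simp del: mult_Suc mult_Suc_right)
  finally show ?thesis by (simp add: assms(2) p bad_gt del: mult_Suc mult_Suc_right)
qed

lemma expectation_src1:
  assumes "is_strategy inst \<alpha>"
  shows "measure_pmf.expectation (lmc_tau inst \<alpha> (src1 inst, [])) f =
    (\<Sum>i<D. real_of_rat (v i) * f (extend (src1 inst, []) 0 i))"
proof -
  let ?\<rho> = "(src1 inst, [])"
  let ?g = "\<lambda>u. real_of_rat (tprob (last_st ?\<rho>) 0 u) * f (extend ?\<rho> 0 u)"
  have l: "last_st ?\<rho> = B * Suc L" by (simp add: last_st_def mdp_inst_def)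
  have "is_path inst ?\<rho>" by (simp add: is_path_def mdp_inst_def N_eq)
  moreover have "\<not> last_st ?\<rho> < B" unfolding l by simp
  ultimately have "measure_pmf.expectation (lmc_tau inst \<alpha> ?\<rho>) f = (\<Sum>u<N. ?g u)"
    by (rule expectation_tau_other[OF _ _ assms])
  also have "\<dots> = (\<Sum>u<D. ?g u)"
    by (rule sum.mono_neutral_right) (auto simp: less_N l prob_src simp del: mult_Suc mult_Suc_right)
  finally show ?thesis by (simp add: l prob_src del: mult_Suc mult_Suc_right)
qed

section \<open>Distances between paths of the two runs\<close>

abbreviation "dst \<alpha> \<equiv> bisim_dist (lmc_tau inst \<alpha>) (lmc_lab inst)"

lemma src_paths:
  "is_path inst (src1 inst, [])" "is_path inst (src2 inst, [])"
  "is_path inst (extend (src2 inst, []) 0 D)"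
  "i < D \<Longrightarrow> 0 < v i \<Longrightarrow> is_path inst (extend (src1 inst, []) 0 i)"
proof -
  show 1: "is_path inst (src1 inst, [])" "is_path inst (src2 inst, [])"
    by (simp_all add: is_path_def mdp_inst_def N_eq)
  have l: "last_st (src1 inst, []) = B * Suc L" "last_st (src2 inst, []) = B * Suc L + 1"
    by (simp_all add: last_st_def mdp_inst_def)
  show "is_path inst (extend (src2 inst, []) 0 D)"
    using L_pos by (intro is_path_extend_inst 1) (simp_all add: l prob_src less_N del: mult_Suc mult_Suc_right)
  show "i < D \<Longrightarrow> 0 < v i \<Longrightarrow> is_path inst (extend (src1 inst, []) 0 i)"
    using L_pos by (intro is_path_extend_inst 1) (simp_all add: l prob_src less_N del: mult_Suc mult_Suc_right)
qed

lemma dist_src: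
  assumes "is_strategy inst \<alpha>"
  shows "dst \<alpha> (src1 inst, []) (src2 inst, []) =
    (\<Sum>i<D. real_of_rat (v i) * dst \<alpha> (extend (src1 inst, []) 0 i) (extend (src2 inst, []) 0 D))"
proof -
  have l: "last_st (src1 inst, []) = B * Suc L" "last_st (src2 inst, []) = B * Suc L + 1"
    by (simp_all add: last_st_def mdp_inst_def)
  have "(B * Suc L + 1) div B = Suc L" "(B * Suc L) div B = Suc L"
    using special_div[of 1] special_div[of 0] by (simp_all del: mult_Suc mult_Suc_right)
  then have lab: "lmc_lab inst (src1 inst, []) = lmc_lab inst (src2 inst, [])"
    by (simp add: lmc_lab_inst l less_N del: mult_Suc mult_Suc_right)
  have "\<not> last_st (src2 inst, []) < B" unfolding l by simp
  then have "lmc_tau inst \<alpha> (src2 inst, []) = return_pmf (extend (src2 inst, []) 0 D)"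
    by (rule tau_unit[OF src_paths(2) _ assms]) (simp_all add: l prob_src less_N del: mult_Suc mult_Suc_right)
  from bisim_dist_return_right[of "lmc_lab inst" "(src1 inst, [])" "(src2 inst, [])" "lmc_tau inst \<alpha>", OF lab this] show ?thesis
    by (simp add: expectation_src1[OF assms])
qed

lemma path_choice:
  assumes "is_path inst \<rho>" "last_st \<rho> = i" "i \<le> D" "a < L"
  shows "is_path inst (extend \<rho> a (lstate i a))"
  using assms lstate_less[of i a] by (intro is_path_extend_inst) (auto simp: prob_choice N_eq)

lemma path_copy:
  assumes "is_path inst \<pi>" "last_st \<pi> = lstate D a" "a < L"
  shows "is_path inst (extend \<pi> 0 D)"
  using assms L_pos by (intro is_path_extend_inst) (simp_all add: prob_copy less_N del: mult_Suc mult_Suc_right)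

lemma path_letter:
  assumes "is_path inst \<rho>" "last_st \<rho> = lstate i a" "i < D" "a < L" "j < D" "0 < P a i j"
  shows "is_path inst (extend \<rho> 0 j)"
  using assms L_pos by (intro is_path_extend_inst) (simp_all add: prob_letter less_N del: mult_Suc mult_Suc_right)

text \<open>After the announcement the second run returns to \<open>D\<close> with certainty, which
  forces the coupling; the sink contributes its whole probability because its label differs from
  that of \<open>D\<close>.\<close>

lemma dist_letter:
  assumes "is_strategy inst \<alpha>" "is_path inst \<rho>" "last_st \<rho> = lstate i a" "i < D" "a < L"
    and "is_path inst \<pi>" "last_st \<pi> = lstate D a"
  shows "dst \<alpha> \<rho> \<pi> = (\<Sum>j<D. real_of_rat (P a i j) * dst \<alpha> (extend \<rho> 0 j) (extend \<pi> 0 D)) +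
    (real_of_rat (1 - R a i - (\<Sum>j<D. P a i j)) * dst \<alpha> (extend \<rho> 0 D) (extend \<pi> 0 D) + real_of_rat (R a i))"
proof -
  have lab: "lmc_lab inst \<rho> = lmc_lab inst \<pi>"
    using is_path_last[OF assms(2)] is_path_last[OF assms(6)] assms(4) lstate_div_mod[of i a] lstate_div_mod[of D a]
    by (simp add: lmc_lab_inst assms(3,7) del: mult_Suc mult_Suc_right)
  have "\<not> last_st \<pi> < B" unfolding assms by simp
  then have "lmc_tau inst \<alpha> \<pi> = return_pmf (extend \<pi> 0 D)"
    by (rule tau_unit[OF assms(6) _ assms(1)])
      (simp_all add: assms(5,7) prob_copy less_N del: mult_Suc mult_Suc_right)
  note * = bisim_dist_return_right[of "lmc_lab inst" \<rho> \<pi> "lmc_tau inst \<alpha>", OF lab this]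
  have "bad div B = Suc L"
    by (rule special_div) simp
  then have "lmc_lab inst (extend \<rho> 0 bad) \<noteq> lmc_lab inst (extend \<pi> 0 D)"
    by (simp add: lmc_lab_inst less_N del: mult_Suc mult_Suc_right)
  then have "dst \<alpha> (extend \<rho> 0 bad) (extend \<pi> 0 D) = 1" by (rule bisim_dist_label)
  then show ?thesis
    unfolding * expectation_letter[OF assms(2-5,1)] by simp
qed

text \<open>A coupled pair with different letters has distance 1, which is no less than the distance
  if the first run had announced the letter of the second. So every coupling costs at least as much
  as the diagonal one, which is governed by \<open>\<alpha>\<close> on \<open>\<pi>\<close>
  alone.\<close>

lemma dist_choice_ge:
  assumes "is_strategy inst \<alpha>" "is_path inst \<rho>" "last_st \<rho> = i" "i < D" "is_path inst \<pi>" "last_st \<pi> = D"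
  shows "measure_pmf.expectation (\<alpha> \<pi>) (\<lambda>b. dst \<alpha> (extend \<rho> b (lstate i b)) (extend \<pi> b (lstate D b))) \<le> dst \<alpha> \<rho> \<pi>"
proof (rule bisim_dist_ge)
  define f where "f = (\<lambda>b. extend \<rho> b (lstate i b))"
  define g where "g = (\<lambda>b. extend \<pi> b (lstate D b))"
  \<comment> \<open>\<open>h\<close> reads the letter off the last action of the second path, so
    that its expectation depends only on the second marginal of the coupling.\<close>
  define h where "h = (\<lambda>w :: path. let b = fst (last (snd w)) in dst \<alpha> (f b) (g b))"
  have hg: "h (g b) = dst \<alpha> (f b) (g b)" for b
    by (simp add: h_def g_def extend_def)
  have hb: "0 \<le> h w" "h w \<le> 1" for w using bisim_dist_bounds by (auto simp: h_def Let_def)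
  fix \<omega> assume w: "\<omega> \<in> couplings (lmc_tau inst \<alpha> \<rho>) (lmc_tau inst \<alpha> \<pi>)"
  have t: "lmc_tau inst \<alpha> \<rho> = map_pmf f (\<alpha> \<rho>)" "lmc_tau inst \<alpha> \<pi> = map_pmf g (\<alpha> \<pi>)"
    unfolding f_def g_def using assms tau_choice by auto
  have wm: "map_pmf fst \<omega> = map_pmf f (\<alpha> \<rho>)" "map_pmf snd \<omega> = map_pmf g (\<alpha> \<pi>)"
    using w t by (auto simp: couplings_def)
  have "measure_pmf.expectation (\<alpha> \<pi>) (\<lambda>b. h (g b)) = measure_pmf.expectation (map_pmf g (\<alpha> \<pi>)) h"
    by simp
  also have "\<dots> = measure_pmf.expectation \<omega> (\<lambda>p. h (snd p))"
    unfolding wm(2)[symmetric] by simp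
  also have "\<dots> \<le> measure_pmf.expectation \<omega> (\<lambda>(u, v). dst \<alpha> u v)"
  proof (rule integral_mono_AE)
    show "integrable (measure_pmf \<omega>) (\<lambda>p. h (snd p))"
      by (rule measure_pmf.integrable_const_bound[where B = 1]) (use hb in \<open>auto simp: abs_le_iff intro: order_trans[of _ 0]\<close>)
    show "integrable (measure_pmf \<omega>) (\<lambda>(u, v). dst \<alpha> u v)"
      by (rule integrable_unit_valued[OF bisim_dist_unit_valued])
    show "AE p in measure_pmf \<omega>. h (snd p) \<le> (case p of (u, v) \<Rightarrow> dst \<alpha> u v)"
    proof (rule AE_pmfI)
      fix p assume p: "p \<in> set_pmf \<omega>"
      have "fst p \<in> f ` set_pmf (\<alpha> \<rho>)" "snd p \<in> g ` set_pmf (\<alpha> \<pi>)"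
        using p wm by (metis imageI pmf.set_map)+
      then obtain m b where mb: "fst p = f m" "m \<in> set_pmf (\<alpha> \<rho>)" "snd p = g b" "b \<in> set_pmf (\<alpha> \<pi>)" by blast
      have L: "m < L" "b < L" using strategyD(1)[OF assms(1)] assms mb by blast+
      have "h (g b) \<le> dst \<alpha> (f m) (g b)"
      proof (cases "m = b")
        case True
        then show ?thesis by (simp add: hg)
      next
        case False
        have "lstate i m < N" "lstate D b < N" using lstate_less[of i m] lstate_less[of D b] assms(4) L by (auto simp: N_eq)
        then have "lmc_lab inst (f m) \<noteq> lmc_lab inst (g b)"
          using False lstate_div_mod[of i m] lstate_div_mod[of D b] assms(4)
          by (simp add: lmc_lab_inst f_def g_def del: mult_Suc mult_Suc_right)
        then have "dst \<alpha> (f m) (g b) = 1" by (rule bisim_dist_label)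
        then show ?thesis using hb by simp
      qed
      then show "h (snd p) \<le> (case p of (u, v) \<Rightarrow> dst \<alpha> u v)"
        using mb by (simp add: case_prod_unfold)
    qed
  qed
  finally show "measure_pmf.expectation (\<alpha> \<pi>) (\<lambda>b. dst \<alpha> (extend \<rho> b (lstate i b)) (extend \<pi> b (lstate D b)))
      \<le> measure_pmf.expectation \<omega> (\<lambda>(u, v). dst \<alpha> u v)"
    unfolding hg by (simp add: f_def g_def)
next
  show "measure_pmf.expectation (\<alpha> \<pi>) (\<lambda>b. dst \<alpha> (extend \<rho> b (lstate i b)) (extend \<pi> b (lstate D b))) \<le> 1"
    by (intro measure_pmf.integral_le_const measure_pmf.integrable_const_bound[where B = 1])
      (auto intro!: AE_I2 simp: bisim_dist_bounds)
qed

text \<open>The probability that the automaton started in \<open>i\<close> rejects within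
  \<open>n\<close> letters if these are drawn by \<open>\<alpha>\<close> along the second run. The
  path \<open>\<pi>\<close> does not depend on \<open>i\<close>: the letters cannot react to the
  state of the automaton.\<close>

fun horizon_reject :: "(path \<Rightarrow> nat pmf) \<Rightarrow> nat \<Rightarrow> path \<Rightarrow> nat \<Rightarrow> real" where
  "horizon_reject \<alpha> 0 \<pi> i = 0"
| "horizon_reject \<alpha> (Suc n) \<pi> i = measure_pmf.expectation (\<alpha> \<pi>) (\<lambda>a. real_of_rat (R a i) +
     (\<Sum>j<D. real_of_rat (P a i j) * horizon_reject \<alpha> n (extend (extend \<pi> a (lstate D a)) 0 D) j))"

text \<open>A least fixed point is bounded from below by unfolding it finitely often, hence the
  horizon. The announcement is handled by \<open>dist_choice_ge\<close>, and the escape term of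
  \<open>dist_letter\<close> is dropped as nonnegative.\<close>

lemma dist_ge_horizon_reject:
  assumes "is_strategy inst \<alpha>" "is_path inst \<rho>" "last_st \<rho> = i" "i < D" "is_path inst \<pi>" "last_st \<pi> = D"
  shows "horizon_reject \<alpha> n \<pi> i \<le> dst \<alpha> \<rho> \<pi>"
  using assms(2-)
proof (induction n arbitrary: \<rho> \<pi> i)
  case 0
  then show ?case using bisim_dist_bounds by simp
next
  case (Suc n)
  have fin: "finite (set_pmf (\<alpha> \<pi>))"
    by (rule finite_subset[of _ "{..<L}"]) (use strategyD(1)[OF assms(1) Suc.prems(4)] in auto)
  have "horizon_reject \<alpha> (Suc n) \<pi> i \<le>
      measure_pmf.expectation (\<alpha> \<pi>) (\<lambda>a. dst \<alpha> (extend \<rho> a (lstate i a)) (extend \<pi> a (lstate D a)))"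
    unfolding horizon_reject.simps
  proof (intro integral_mono_AE integrable_measure_pmf_finite fin AE_pmfI)
    fix a assume "a \<in> set_pmf (\<alpha> \<pi>)"
    then have a: "a < L" using strategyD(1)[OF assms(1) Suc.prems(4)] by blast
    let ?\<rho> = "extend \<rho> a (lstate i a)" and ?\<pi> = "extend \<pi> a (lstate D a)"
    have p: "is_path inst ?\<rho>" "is_path inst ?\<pi>" using Suc.prems a path_choice by auto
    have p': "is_path inst (extend ?\<pi> 0 D)" by (rule path_copy[OF p(2) _ a]) simp
    have "real_of_rat (P a i j) * horizon_reject \<alpha> n (extend ?\<pi> 0 D) j \<le>
        real_of_rat (P a i j) * dst \<alpha> (extend ?\<rho> 0 j) (extend ?\<pi> 0 D)" if "j < D" for j
    \<comment> \<open>A successor of probability 0 does not yield a path, so the induction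
      hypothesis says nothing about it.\<close>
    proof (cases "P a i j = 0")
      case False
      then have P: "0 < P a i j" using P_nonneg[OF a Suc.prems(3) that] by simp
      have "is_path inst (extend ?\<rho> 0 j)"
        using path_letter[OF p(1) _ Suc.prems(3) a that P] by simp
      then show ?thesis using P that p' by (intro mult_left_mono Suc.IH) auto
    qed simp
    then have "(\<Sum>j<D. real_of_rat (P a i j) * horizon_reject \<alpha> n (extend ?\<pi> 0 D) j) \<le>
        (\<Sum>j<D. real_of_rat (P a i j) * dst \<alpha> (extend ?\<rho> 0 j) (extend ?\<pi> 0 D))"
      by (intro sum_mono) auto
    moreover have "0 \<le> real_of_rat (1 - R a i - (\<Sum>j<D. P a i j)) * dst \<alpha> (extend ?\<rho> 0 D) (extend ?\<pi> 0 D)"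
      using P_R_sum[OF a Suc.prems(3)] bisim_dist_bounds by (intro mult_nonneg_nonneg) auto
    ultimately show "real_of_rat (R a i) + (\<Sum>j<D. real_of_rat (P a i j) * horizon_reject \<alpha> n (extend ?\<pi> 0 D) j)
        \<le> dst \<alpha> ?\<rho> ?\<pi>"
      using dist_letter[OF assms(1) p(1) _ Suc.prems(3) a p(2)] by simp
  qed
  also have "\<dots> \<le> dst \<alpha> \<rho> \<pi>" by (rule dist_choice_ge[OF assms(1) Suc.prems])
  finally show ?case .
qed

lemma dist_src_ge:
  assumes "is_strategy inst \<alpha>"
  shows "(\<Sum>i<D. real_of_rat (v i) * horizon_reject \<alpha> n (extend (src2 inst, []) 0 D) i)
    \<le> dst \<alpha> (src1 inst, []) (src2 inst, [])"
  unfolding dist_src[OF assms]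
proof (rule sum_mono)
  fix i assume "i \<in> {..<D}"
  then have i: "i < D" by simp
  show "real_of_rat (v i) * horizon_reject \<alpha> n (extend (src2 inst, []) 0 D) i
    \<le> real_of_rat (v i) * dst \<alpha> (extend (src1 inst, []) 0 i) (extend (src2 inst, []) 0 D)"
  proof (cases "v i = 0")
    case False
    then have "0 < v i" using v_nonneg[OF i] by simp
    then show ?thesis
      using src_paths i by (intro mult_left_mono dist_ge_horizon_reject assms) auto
  qed simp
qed

text \<open>The value 1 at the end is the trivial bound on the distance once the word is used up. It
  costs nothing if the last letter kills all mass.\<close>

fun word_reject :: "nat list \<Rightarrow> nat \<Rightarrow> real" where
  "word_reject [] i = 1"
| "word_reject (a # w) i = real_of_rat (R a i) + (\<Sum>j<D. real_of_rat (P a i j) * word_reject w j)"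

text \<open>A run from a source has \<open>2 * k + 1\<close> steps when letter number
  \<open>k\<close> is due, hence \<open>div 2\<close>. Looking only at the length makes both runs
  announce the same letters; 0 is the only enabled action elsewhere and serves as a default after
  the word.\<close>

definition word_strategy :: "nat list \<Rightarrow> path \<Rightarrow> nat pmf" where
  "word_strategy w \<rho> = return_pmf (if last_st \<rho> < B \<and> length (snd \<rho>) div 2 < length w
     then w ! (length (snd \<rho>) div 2) else 0)"

section \<open>Upper bound: strategies that announce a fixed word\<close>

context
  fixes w :: "nat list"
  assumes w: "set w \<subseteq> {..<L}"
begin

lemma word_strategy: "is_strategy inst (word_strategy w)"
  unfolding is_strategy_def
proof (intro allI impI)
  fix \<rho> assume "is_path inst \<rho>"
  then have "last_st \<rho> < N" by (rule is_path_last)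
  then show "set_pmf (word_strategy w \<rho>) \<subseteq> enabled inst (last_st \<rho>)"
    using w L_pos nth_mem by (auto simp: word_strategy_def enabled_inst)
qed

text \<open>One letter serves all paths of the same length, as both runs have to be advanced
  together.\<close>

lemma word_strategy_tau:
  assumes "is_path inst \<rho>" "last_st \<rho> < B"
  shows "\<exists>a<L. (\<forall>k. length (snd \<rho>) div 2 = k \<longrightarrow> k < length w \<longrightarrow> a = w ! k) \<and>
    (\<forall>\<pi>. is_path inst \<pi> \<longrightarrow> last_st \<pi> < B \<longrightarrow> length (snd \<pi>) = length (snd \<rho>) \<longrightarrow>
       lmc_tau inst (word_strategy w) \<pi> = return_pmf (extend \<pi> a (lstate (last_st \<pi>) a)))"
proof -
  let ?k = "length (snd \<rho>) div 2"
  define a where "a = (if ?k < length w then w ! ?k else 0)"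
  have "a < L" using w L_pos nth_mem by (auto simp: a_def)
  moreover have "lmc_tau inst (word_strategy w) \<pi> = return_pmf (extend \<pi> a (lstate (last_st \<pi>) a))"
    if "is_path inst \<pi>" "last_st \<pi> < B" "length (snd \<pi>) = length (snd \<rho>)" for \<pi>
    unfolding tau_choice[OF that(1,2) word_strategy] using that(2,3)
    by (simp add: word_strategy_def a_def)
  ultimately show ?thesis by (intro exI[of _ a]) (auto simp: a_def)
qed

text \<open>Escaped mass costs nothing: from then on both runs go through copies of \<open>D\<close>
  and announce the same letters forever.\<close>

lemma word_strategy_copy_dist:
  assumes "is_path inst \<rho>" "is_path inst \<pi>" "last_st \<rho> = D" "last_st \<pi> = D" "length (snd \<rho>) = length (snd \<pi>)"
  shows "dst (word_strategy w) \<rho> \<pi> = 0"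
proof -
  define Z where "Z = {(\<rho>, \<pi>). is_path inst \<rho> \<and> is_path inst \<pi> \<and> last_st \<rho> = last_st \<pi> \<and>
    length (snd \<rho>) = length (snd \<pi>) \<and> (last_st \<rho> = D \<or> (\<exists>a<L. last_st \<rho> = lstate D a))}"
  show ?thesis
  proof (rule bisim_dist_bisimulation)
    show "(\<rho>, \<pi>) \<in> Z" using assms by (simp add: Z_def)
    fix s t assume st: "(s, t) \<in> Z"
    then show "lmc_lab inst s = lmc_lab inst t" by (auto simp: Z_def lmc_lab_def)
    from st have p: "is_path inst s" "is_path inst t" "last_st t = last_st s" "length (snd t) = length (snd s)"
      by (auto simp: Z_def)
    from st consider "last_st s = D" | a where "a < L" "last_st s = lstate D a" by (auto simp: Z_def)
    then show "\<exists>s' t'. lmc_tau inst (word_strategy w) s = return_pmf s' \<and>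
        lmc_tau inst (word_strategy w) t = return_pmf t' \<and> (s', t') \<in> Z"
    proof cases
      case 1
      obtain a where a: "a < L" "\<And>\<pi>. is_path inst \<pi> \<Longrightarrow> last_st \<pi> < B \<Longrightarrow> length (snd \<pi>) = length (snd s) \<Longrightarrow>
          lmc_tau inst (word_strategy w) \<pi> = return_pmf (extend \<pi> a (lstate (last_st \<pi>) a))"
        using word_strategy_tau[OF p(1)] 1 by auto
      have "(extend s a (lstate D a), extend t a (lstate D a)) \<in> Z"
        using p 1 a(1) path_choice[of s D a] path_choice[of t D a] by (auto simp: Z_def)
      then show ?thesis using a(2)[of s] a(2)[of t] p 1 by auto
    next
      case (2 a)
      have "lmc_tau inst (word_strategy w) \<sigma> = return_pmf (extend \<sigma> 0 D)" if "is_path inst \<sigma>" "last_st \<sigma> = lstate D a" for \<sigma>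
      proof -
        have "\<not> last_st \<sigma> < B" unfolding that by simp
        then show ?thesis
          by (rule tau_unit[OF that(1) _ word_strategy])
            (simp_all add: 2(1) that(2) prob_copy less_N del: mult_Suc mult_Suc_right)
      qed
      moreover have "(extend s 0 D, extend t 0 D) \<in> Z"
        using p 2 path_copy[of s a] path_copy[of t a] by (simp add: Z_def del: mult_Suc mult_Suc_right)
      ultimately show ?thesis using p 2 by metis
    qed
  qed
qed

text \<open>Induction on the number of letters left. Both runs announce the same letter, after which
  \<open>dist_letter\<close> differs from the recursion of \<open>word_reject\<close> only by the
  escape term.\<close>

lemma word_strategy_dist_le:
  assumes "is_path inst \<rho>" "last_st \<rho> = i" "i < D" "is_path inst \<pi>" "last_st \<pi> = D"
    and "length (snd \<rho>) = 2 * k + 1" "length (snd \<pi>) = 2 * k + 1" "k \<le> length w"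
  shows "dst (word_strategy w) \<rho> \<pi> \<le> word_reject (drop k w) i"
  using assms
proof (induction "length w - k" arbitrary: k \<rho> \<pi> i)
  case 0
  then show ?case using bisim_dist_bounds by simp
next
  case (Suc n)
  let ?d = "dst (word_strategy w)"
  have k: "k < length w" using Suc.hyps(2) by simp
  obtain a where a: "a < L" "a = w ! k"
    "\<And>\<pi>. is_path inst \<pi> \<Longrightarrow> last_st \<pi> < B \<Longrightarrow> length (snd \<pi>) = length (snd \<rho>) \<Longrightarrow>
      lmc_tau inst (word_strategy w) \<pi> = return_pmf (extend \<pi> a (lstate (last_st \<pi>) a))"
    using word_strategy_tau[OF Suc.prems(1)] Suc.prems k by auto
  let ?\<rho> = "extend \<rho> a (lstate i a)" and ?\<pi> = "extend \<pi> a (lstate D a)"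
  have p: "is_path inst ?\<rho>" "is_path inst ?\<pi>" using Suc.prems a(1) path_choice by auto
  have p': "is_path inst (extend ?\<pi> 0 D)" by (rule path_copy[OF p(2) _ a(1)]) simp
  have lab: "lmc_lab inst \<rho> = lmc_lab inst \<pi>"
    using Suc.prems is_path_last[OF Suc.prems(1)] is_path_last[OF Suc.prems(4)] by (simp add: lmc_lab_inst)
  have "?d \<rho> \<pi> = ?d ?\<rho> ?\<pi>"
    using bisim_dist_return_right[of "lmc_lab inst" \<rho> \<pi> "lmc_tau inst (word_strategy w)", OF lab] a(3)[of \<rho>] a(3)[of \<pi>] Suc.prems by simp
  then have eq: "?d \<rho> \<pi> = (\<Sum>j<D. real_of_rat (P a i j) * ?d (extend ?\<rho> 0 j) (extend ?\<pi> 0 D)) +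
    (real_of_rat (1 - R a i - (\<Sum>j<D. P a i j)) * ?d (extend ?\<rho> 0 D) (extend ?\<pi> 0 D) + real_of_rat (R a i))"
    using dist_letter[OF word_strategy p(1) _ Suc.prems(3) a(1) p(2)] by simp
  \<comment> \<open>The escape has probability 0 or leads to two copies of \<open>D\<close> at
    distance 0.\<close>
  have z: "real_of_rat (1 - R a i - (\<Sum>j<D. P a i j)) * ?d (extend ?\<rho> 0 D) (extend ?\<pi> 0 D) = 0"
  proof (cases "1 - R a i - (\<Sum>j<D. P a i j) = 0")
    case False
    then have "0 < 1 - R a i - (\<Sum>j<D. P a i j)" using P_R_sum[OF a(1) Suc.prems(3)] by simp
    then have "is_path inst (extend ?\<rho> 0 D)"
      using L_pos prob_letter[OF Suc.prems(3) a(1)]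
      by (intro is_path_extend_inst[OF p(1)]) (simp_all add: less_N del: mult_Suc mult_Suc_right)
    then show ?thesis using word_strategy_copy_dist[of "extend ?\<rho> 0 D" "extend ?\<pi> 0 D"] p' Suc.prems by simp
  qed simp
  have le: "(\<Sum>j<D. real_of_rat (P a i j) * ?d (extend ?\<rho> 0 j) (extend ?\<pi> 0 D)) \<le>
      (\<Sum>j<D. real_of_rat (P a i j) * word_reject (drop (Suc k) w) j)"
  proof (rule sum_mono)
    fix j assume "j \<in> {..<D}"
    then have j: "j < D" by simp
    show "real_of_rat (P a i j) * ?d (extend ?\<rho> 0 j) (extend ?\<pi> 0 D) \<le> real_of_rat (P a i j) * word_reject (drop (Suc k) w) j"
    proof (cases "P a i j = 0")
      case False
      then have P: "0 < P a i j" using P_nonneg[OF a(1) Suc.prems(3) j] by simp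
      have "is_path inst (extend ?\<rho> 0 j)"
        using path_letter[OF p(1) _ Suc.prems(3) a(1) j P] by simp
      then show ?thesis
        using P j p' k Suc.prems Suc.hyps(2) by (intro mult_left_mono Suc.hyps(1)) auto
    qed simp
  qed
  have "?d \<rho> \<pi> \<le> word_reject (a # drop (Suc k) w) i"
    unfolding eq z word_reject.simps using le by linarith
  then show ?case using k by (simp only: a(2) Cons_nth_drop_Suc)
qed

lemma word_dist_src_le:
  "dst (word_strategy w) (src1 inst, []) (src2 inst, []) \<le> (\<Sum>i<D. real_of_rat (v i) * word_reject w i)"
  unfolding dist_src[OF word_strategy]
proof (rule sum_mono)
  fix i assume "i \<in> {..<D}"
  then have i: "i < D" by simp
  show "real_of_rat (v i) * dst (word_strategy w) (extend (src1 inst, []) 0 i) (extend (src2 inst, []) 0 D)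
      \<le> real_of_rat (v i) * word_reject w i"
  proof (cases "v i = 0")
    case False
    then have "0 < v i" using v_nonneg[OF i] by simp
    then show ?thesis
      using src_paths i
        word_strategy_dist_le[of "extend (src1 inst, []) 0 i" i "extend (src2 inst, []) 0 D" 0]
      by (intro mult_left_mono) auto
  qed simp
qed

end

end

section \<open>Error-weighted automata\<close>

text \<open>\<open>X c\<close> is the unnormalised mass vector of the configuration
  \<open>c\<close>. Letters below \<open>M\<close> apply \<open>nxt\<close> to it at scale
  \<open>1 / C\<close>, and \<open>M\<close> is the final letter, whose \<open>- 1\<close> in
  \<open>R_final\<close> is the saving for a halting run. \<open>P_half\<close> yields the geometric
  decay of the mass; the gap in \<open>err\<close> makes a single error outweigh the saving.\<close>

locale weighted_pfa = pfa_mdp D L P R v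
  for D L P R v +
  fixes X :: "'c \<Rightarrow> nat \<Rightarrow> real" and nxt :: "nat \<Rightarrow> 'c \<Rightarrow> 'c" and err :: "nat \<Rightarrow> 'c \<Rightarrow> real"
    and M :: nat and C \<delta> :: real and c0 :: 'c
  assumes L_eq: "L = Suc M" and C_ge: "1 \<le> C" and \<delta>_pos: "0 < \<delta>"
    and X_nonneg: "i < D \<Longrightarrow> 0 \<le> X c i"
    and P_step: "a < M \<Longrightarrow> j < D \<Longrightarrow> (\<Sum>i<D. X c i * real_of_rat (P a i j)) = X (nxt a c) j / C"
    and P_final: "i < D \<Longrightarrow> j < D \<Longrightarrow> P M i j = 0"
    and P_half: "a < L \<Longrightarrow> i < D \<Longrightarrow> (\<Sum>j<D. P a i j) \<le> 1 / 2"
    and R_step: "a < M \<Longrightarrow> (\<Sum>i<D. X c i * real_of_rat (R a i)) =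
      1 / 2 * ((\<Sum>i<D. X c i) - (\<Sum>j<D. X (nxt a c) j) / C) + \<delta> * err a c"
    and R_final: "(\<Sum>i<D. X c i * real_of_rat (R M i)) = 1 / 2 * (\<Sum>i<D. X c i) + \<delta> * (err M c - 1)"
    and err: "a < L \<Longrightarrow> err a c = 0 \<or> 1 \<le> err a c"
    and init_pos: "0 < (\<Sum>i<D. X c0 i)"
    and v_init: "i < D \<Longrightarrow> real_of_rat (v i) * (\<Sum>i<D. X c0 i) = X c0 i"
begin

inductive good :: "'c \<Rightarrow> bool" where
  final: "err M c = 0 \<Longrightarrow> good c"
| step: "a < M \<Longrightarrow> err a c = 0 \<Longrightarrow> good (nxt a c) \<Longrightarrow> good c"

text \<open>Exchanging the sums turns the average over \<open>X c\<close> of the values after one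
  letter into an average over \<open>X (nxt a c)\<close>. From here on it is possible to argue about
  configurations instead of states.\<close>

lemma sum_letter:
  assumes "a < M"
  shows "(\<Sum>i<D. X c i * (real_of_rat (R a i) + (\<Sum>j<D. real_of_rat (P a i j) * f j))) =
    1 / 2 * ((\<Sum>i<D. X c i) - (\<Sum>j<D. X (nxt a c) j) / C) + \<delta> * err a c + (\<Sum>j<D. X (nxt a c) j * f j) / C"
proof -
  have "(\<Sum>i<D. X c i * (\<Sum>j<D. real_of_rat (P a i j) * f j)) = (\<Sum>i<D. \<Sum>j<D. X c i * real_of_rat (P a i j) * f j)"
    by (simp add: sum_distrib_left mult.assoc)
  also have "\<dots> = (\<Sum>j<D. \<Sum>i<D. X c i * real_of_rat (P a i j) * f j)" by (rule sum.swap)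
  also have "\<dots> = (\<Sum>j<D. X (nxt a c) j / C * f j)"
    using P_step[OF assms] by (intro sum.cong) (simp_all add: sum_distrib_right[symmetric])
  also have "\<dots> = (\<Sum>j<D. X (nxt a c) j * f j) / C" by (simp add: sum_divide_distrib)
  finally show ?thesis using R_step[OF assms, of c] by (simp add: distrib_left sum.distrib)
qed

lemma sum_final:
  "(\<Sum>i<D. X c i * (real_of_rat (R M i) + (\<Sum>j<D. real_of_rat (P M i j) * f j))) =
    1 / 2 * (\<Sum>i<D. X c i) + \<delta> * (err M c - 1)"
  using R_final[of c] P_final by simp

lemma step_mass: 
  assumes "a < M"
  shows "(\<Sum>j<D. X (nxt a c) j) / C \<le> 1 / 2 * (\<Sum>i<D. X c i)"
proof -
  have "(\<Sum>j<D. X (nxt a c) j) / C = (\<Sum>j<D. \<Sum>i<D. X c i * real_of_rat (P a i j))"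
    using P_step[OF assms] by (simp add: sum_divide_distrib)
  also have "\<dots> = (\<Sum>i<D. X c i * (\<Sum>j<D. real_of_rat (P a i j)))"
    by (subst sum.swap) (simp add: sum_distrib_left)
  also have "\<dots> \<le> (\<Sum>i<D. X c i * (1 / 2))"
  proof (intro sum_mono mult_left_mono X_nonneg)
    fix i assume "i \<in> {..<D}"
    then have "real_of_rat (\<Sum>j<D. P a i j) \<le> real_of_rat (1 / 2)"
      using P_half[of a i] assms L_eq by (simp add: of_rat_less_eq)
    then show "(\<Sum>j<D. real_of_rat (P a i j)) \<le> 1 / 2" by (simp add: of_rat_sum of_rat_divide)
  qed auto
  finally show ?thesis by (simp add: sum_divide_distrib[symmetric])
qed

text \<open>At most the fraction \<open>(1 / 2) ^ n\<close> of the mass survives \<open>n\<close>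
  letters, and half of the rest is rejected. Only a \<open>good\<close> configuration can fall short
  of this, and at most by \<open>\<delta>\<close>: if a letter leads to a \<open>good\<close>
  configuration from one that is not, its error costs at least \<open>\<delta>\<close>, while the
  later saving is at most \<open>\<delta> / C\<close>.\<close>

lemma horizon_reject_ge:
  assumes "is_strategy inst \<alpha>" "is_path inst \<pi>" "last_st \<pi> = D"
  shows "1 / 2 * (\<Sum>i<D. X c i) * (1 - (1 / 2) ^ n) - (if good c then \<delta> else 0)
    \<le> (\<Sum>i<D. X c i * horizon_reject \<alpha> n \<pi> i)"
  using assms(2-)
proof (induction n arbitrary: \<pi> c)
  case 0
  then show ?case using \<delta>_pos by simp
next
  case (Suc n)
  let ?S = "\<lambda>c. \<Sum>i<D. X c i"
  let ?p = "\<lambda>a. extend (extend \<pi> a (lstate D a)) 0 D"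
  let ?f = "\<lambda>a. \<Sum>i<D. X c i * (real_of_rat (R a i) + (\<Sum>j<D. real_of_rat (P a i j) * horizon_reject \<alpha> n (?p a) j))"
  have fin: "finite (set_pmf (\<alpha> \<pi>))"
    by (rule finite_subset[of _ "{..<L}"]) (use strategyD(1)[OF assms(1) Suc.prems(1)] in auto)
  have "(\<Sum>i<D. X c i * horizon_reject \<alpha> (Suc n) \<pi> i) = measure_pmf.expectation (\<alpha> \<pi>) ?f"
    using fin by (subst Bochner_Integration.integral_sum) (auto intro!: integrable_measure_pmf_finite)
  also have "1 / 2 * ?S c * (1 - (1 / 2) ^ Suc n) - (if good c then \<delta> else 0) \<le> \<dots>"
  \<comment> \<open>The bound does not mention the letter, so it suffices to show it for each letter
    that \<open>\<alpha>\<close> may announce; randomisation gains nothing.\<close>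
  proof (intro measure_pmf.integral_ge_const integrable_measure_pmf_finite fin AE_pmfI)
    fix a assume "a \<in> set_pmf (\<alpha> \<pi>)"
    then have a: "a < L" using strategyD(1)[OF assms(1) Suc.prems(1)] by blast
    have S: "0 \<le> ?S c" by (intro sum_nonneg X_nonneg) auto
    have pow: "0 \<le> (1 / 2 :: real) ^ n" by simp
    show "1 / 2 * ?S c * (1 - (1 / 2) ^ Suc n) - (if good c then \<delta> else 0) \<le> ?f a"
    proof (cases "a = M")
      case True
      \<comment> \<open>The saving of the final letter is consumed by its own error unless
        \<open>c\<close> is \<open>good\<close>.\<close>
      have "- (if good c then \<delta> else 0) \<le> \<delta> * (err M c - 1)"
      proof (cases "err M c = 0")
        case True
        then show ?thesis using good.final by simp
      next
        case False
        then have "1 \<le> err M c" using err[of M c] L_eq by simp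
        then have "0 \<le> \<delta> * (err M c - 1)" using \<delta>_pos by simp
        then show ?thesis using \<delta>_pos by (simp split: if_splits)
      qed
      moreover have "1 / 2 * ?S c * (1 - (1 / 2) ^ Suc n) \<le> 1 / 2 * ?S c"
        using S by (intro mult_left_le) auto
      ultimately show ?thesis unfolding True sum_final by linarith
    next
      case False
      then have aM: "a < M" using a L_eq by simp
      have p: "is_path inst (?p a)"
        by (rule path_copy[OF path_choice[OF Suc.prems _ a] _ a]) simp_all
      let ?S' = "?S (nxt a c)" and ?g = "if good (nxt a c) then \<delta> else 0"
      have "(1 / 2 * ?S' * (1 - (1 / 2) ^ n) - ?g) / C \<le> (\<Sum>j<D. X (nxt a c) j * horizon_reject \<alpha> n (?p a) j) / C"
        using Suc.IH[OF p] C_ge by (intro divide_right_mono) auto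
      moreover have "(1 / 2 * ?S' * (1 - (1 / 2) ^ n) - ?g) / C = 1 / 2 * (?S' / C) - 1 / 2 * (?S' / C) * (1 / 2) ^ n - ?g / C"
      proof -
        have "(1 / 2 * S * (1 - q) - g) / C = 1 / 2 * (S / C) - 1 / 2 * (S / C) * q - g / C" for S q g :: real
          by (simp add: diff_divide_distrib right_diff_distrib)
        then show ?thesis .
      qed
      moreover have "1 / 2 * (?S' / C) * (1 / 2) ^ n \<le> 1 / 2 * (1 / 2 * ?S c) * (1 / 2) ^ n"
        using step_mass[OF aM, of c] pow by (intro mult_right_mono mult_left_mono) auto
      moreover have "1 / 2 * (1 / 2 * ?S c) * (1 / 2) ^ n = 1 / 2 * ?S c - 1 / 2 * ?S c * (1 - (1 / 2) ^ Suc n)"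
        by (simp add: field_simps)
      moreover have "- (if good c then \<delta> else 0) \<le> \<delta> * err a c - ?g / C"
      proof -
        have g: "?g / C \<le> \<delta>" "0 \<le> ?g / C"
        proof -
          have "?g / C \<le> ?g / 1" using C_ge \<delta>_pos by (intro divide_left_mono) auto
          then show "?g / C \<le> \<delta>" using \<delta>_pos by (simp split: if_splits)
          show "0 \<le> ?g / C" using C_ge \<delta>_pos by simp
        qed
        show ?thesis
        proof (cases "err a c = 0")
          case True
          then have "good (nxt a c) \<Longrightarrow> good c" using good.step aM by blast
          then show ?thesis using g True by (cases "good (nxt a c)") auto
        next
          case False
          then have "1 \<le> err a c" using err[of a c] a by simp
          then have "\<delta> \<le> \<delta> * err a c" using \<delta>_pos by simp
          moreover have "- (if good c then \<delta> else 0) \<le> 0" using \<delta>_pos by simp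
          ultimately show ?thesis using g by linarith
        qed
      qed
      ultimately show ?thesis unfolding sum_letter[OF aM] right_diff_distrib by linarith
    qed
  qed
  finally show ?case .
qed

text \<open>The word is the error-free run followed by \<open>M\<close>. Only strictness is
  recorded, since the saving shrinks by the factor \<open>C\<close> with each letter.\<close>

lemma good_word:
  assumes "good c"
  shows "\<exists>w. set w \<subseteq> {..<L} \<and> (\<Sum>i<D. X c i * word_reject w i) < 1 / 2 * (\<Sum>i<D. X c i)"
  using assms
proof induction
  case (final c)
  have "(\<Sum>i<D. X c i * word_reject [M] i) < 1 / 2 * (\<Sum>i<D. X c i)"
    using sum_final[of c "\<lambda>_. 1"] final \<delta>_pos by simp
  then show ?case using L_eq by (intro exI[of _ "[M]"]) auto
next
  case (step a c)
  then obtain w where w: "set w \<subseteq> {..<L}"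
    "(\<Sum>i<D. X (nxt a c) i * word_reject w i) < 1 / 2 * (\<Sum>i<D. X (nxt a c) i)" by blast
  have "(\<Sum>i<D. X (nxt a c) i * word_reject w i) / C < 1 / 2 * ((\<Sum>i<D. X (nxt a c) i) / C)"
    using divide_strict_right_mono[OF w(2), of C] C_ge by simp
  then have "(\<Sum>i<D. X c i * word_reject (a # w) i) < 1 / 2 * (\<Sum>i<D. X c i)"
    unfolding word_reject.simps sum_letter[OF step(1)] step(2) right_diff_distrib by linarith
  then show ?case using w(1) step(1) L_eq by (intro exI[of _ "a # w"]) auto
qed

lemma sum_v: "(\<Sum>i<D. real_of_rat (v i) * f i) = (\<Sum>i<D. X c0 i * f i) / (\<Sum>i<D. X c0 i)"
proof -
  have "real_of_rat (v i) = X c0 i / (\<Sum>i<D. X c0 i)" if "i < D" for i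
    using v_init[OF that] init_pos by (simp add: field_simps)
  then show ?thesis by (simp add: sum_divide_distrib)
qed

text \<open>If \<open>c0\<close> is not \<open>good\<close>, every strategy has distance at least
  \<open>1 / 2 * (1 - (1 / 2) ^ n)\<close> for all \<open>n\<close>. No single horizon gives 1/2,
  but the limit does, and this contradicts a distance strictly below the threshold.\<close>

theorem yes_iff_good: "gen_dist_min_yes inst \<longleftrightarrow> good c0"
proof
  have thr: "real_of_rat (thr inst) = 1 / 2" by (simp add: mdp_inst_def of_rat_divide)
  let ?S = "\<Sum>i<D. X c0 i"
  {
    assume "good c0"
    then obtain w where w: "set w \<subseteq> {..<L}" "(\<Sum>i<D. X c0 i * word_reject w i) < 1 / 2 * ?S"
      using good_word by blast
    have "(\<Sum>i<D. real_of_rat (v i) * word_reject w i) < 1 / 2"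
      unfolding sum_v using w(2) init_pos by (simp add: field_simps)
    then have "dst (word_strategy w) (src1 inst, []) (src2 inst, []) < 1 / 2"
      using word_dist_src_le[OF w(1)] by linarith
    then show "gen_dist_min_yes inst"
      unfolding gen_dist_min_yes_def thr using word_strategy[OF w(1)] by blast
  }
  assume "gen_dist_min_yes inst"
  then obtain \<alpha> where \<alpha>: "is_strategy inst \<alpha>" "dst \<alpha> (src1 inst, []) (src2 inst, []) < 1 / 2"
    unfolding gen_dist_min_yes_def thr by blast
  show "good c0"
  proof (rule ccontr)
    assume "\<not> good c0"
    let ?d = "dst \<alpha> (src1 inst, []) (src2 inst, [])"
    have lower: "1 / 2 * (1 - (1 / 2) ^ n) \<le> ?d" for n
    proof -
      have "1 / 2 * ?S * (1 - (1 / 2) ^ n) \<le> (\<Sum>i<D. X c0 i * horizon_reject \<alpha> n (extend (src2 inst, []) 0 D) i)"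
        using horizon_reject_ge[OF \<alpha>(1) src_paths(3), of c0 n] \<open>\<not> good c0\<close> by simp
      then have "1 / 2 * (1 - (1 / 2) ^ n) \<le> (\<Sum>i<D. X c0 i * horizon_reject \<alpha> n (extend (src2 inst, []) 0 D) i) / ?S"
        using init_pos by (simp add: field_simps)
      also have "\<dots> \<le> ?d"
        using dist_src_ge[OF \<alpha>(1), of n] unfolding sum_v .
      finally show ?thesis .
    qed
    \<comment> \<open>A horizon long enough for the surviving mass to be smaller than twice the gap
      between \<open>?d\<close> and 1/2.\<close>
    obtain n where "(1 / 2 :: real) ^ n < 1 - 2 * ?d"
      using real_arch_pow_inv[of "1 - 2 * ?d" "1 / 2"] \<alpha>(2) by auto
    then show False using lower[of n] by simp
  qed
qed

end

section \<open>The automaton of a program\<close>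

text \<open>Configurations are pairs, and simplification should not split the quantifiers over
  them.\<close>

declare split_paired_All [simp del] split_paired_Ex [simp del]

type_synonym config = "nat \<times> (nat \<Rightarrow> nat)"

fun act_regs :: "act \<Rightarrow> nat set" where
  "act_regs (Clr r) = {r}"
| "act_regs (Cpy r q) = {r, q}"
| "act_regs (Inc r) = {r}"
| "act_regs (Chk r q) = {r, q}"

fun act_err :: "act \<Rightarrow> (nat \<Rightarrow> nat) \<Rightarrow> real" where
  "act_err (Chk r q) s = real (s r) - real (s q)"
| "act_err _ s = 0"

text \<open>The update is total and ignores the source \<open>i\<close> of the edge: a wrongly
  chosen edge is carried out as well, and the mistake shows only in \<open>edge_err\<close>.\<close>

definition edge_nxt :: "nat \<times> act \<times> nat \<Rightarrow> config \<Rightarrow> config" where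
  "edge_nxt e c = (case e of (i, a, j) \<Rightarrow> (j, act_upd a (snd c)))"

definition edge_err :: "nat \<times> act \<times> nat \<Rightarrow> config \<Rightarrow> real" where
  "edge_err e c = (case e of (i, a, j) \<Rightarrow> (real (fst c) - real i)\<^sup>2 + (act_err a (snd c))\<^sup>2)"

lemma edge_err_eq_0: "edge_err (i, a, j) c = 0 \<longleftrightarrow> fst c = i \<and> act_ok a (snd c)"
proof -
  have "act_err a s = 0 \<longleftrightarrow> act_ok a s" for s by (cases a) auto
  then show ?thesis by (simp add: edge_err_def sum_power2_eq_zero_iff)
qed

lemma Ints_nonneg_cases: "x \<in> \<int> \<Longrightarrow> 0 \<le> x \<Longrightarrow> x = 0 \<or> 1 \<le> x" for x :: real
  by (auto elim!: Ints_cases)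

text \<open>A sum of squares of integers leaves a gap between 0 and 1, as required by the assumption
  \<open>err\<close> of \<open>weighted_pfa\<close>.\<close>

lemma edge_err_cases: "edge_err e c = 0 \<or> 1 \<le> edge_err e c"
proof -
  obtain i a j where e: "e = (i, a, j)" by (metis surj_pair)
  have "act_err a s \<in> \<int>" for s by (cases a) auto
  then show ?thesis by (intro Ints_nonneg_cases) (auto simp: edge_err_def e)
qed

text \<open>The constant coordinate makes affine updates linear, such as \<open>Inc\<close> and the
  jump to a fixed location.\<close>

definition config_vec :: "nat \<Rightarrow> config \<Rightarrow> nat \<Rightarrow> nat" where
  "config_vec K c p = (if K \<le> p then 0 else if p = 0 then 1 else if p = 1 then fst c else snd c (p - 2))"

definition config_tensor :: "nat \<Rightarrow> config \<Rightarrow> nat \<Rightarrow> real" where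
  "config_tensor K c i = real (config_vec K c (fst (prod_decode i))) * real (config_vec K c (snd (prod_decode i)))"

text \<open>For \<open>p, q < K\<close> the code of the pair is at most
  \<open>triangle (2 * K) + K\<close>. Indices in this range that code other pairs are idle, as
  \<open>config_tensor\<close> vanishes there. Thanks to this indexing the positions of the initial
  entries do not depend on \<open>K\<close>.\<close>

definition tensor_dim :: "nat \<Rightarrow> nat" where
  "tensor_dim K = Suc (triangle (2 * K) + K)"

lemma prod_encode_less_tensor_dim: "p < K \<Longrightarrow> q < K \<Longrightarrow> prod_encode (p, q) < tensor_dim K"
  using triangle_mono[of "p + q" "2 * K"] by (simp add: prod_encode_def tensor_dim_def)

lemma sum_tensor_dim:
  fixes f :: "nat \<times> nat \<Rightarrow> real"
  assumes "\<And>p q. K \<le> p \<or> K \<le> q \<Longrightarrow> f (p, q) = 0"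
  shows "(\<Sum>i<tensor_dim K. f (prod_decode i)) = (\<Sum>p<K. \<Sum>q<K. f (p, q))"
proof -
  let ?A = "{..<K} \<times> {..<K}"
  have "(\<Sum>i<tensor_dim K. f (prod_decode i)) = (\<Sum>i\<in>prod_encode ` ?A. f (prod_decode i))"
  proof (rule sum.mono_neutral_right)
    show "prod_encode ` ?A \<subseteq> {..<tensor_dim K}" using prod_encode_less_tensor_dim by auto
    show "\<forall>i\<in>{..<tensor_dim K} - prod_encode ` ?A. f (prod_decode i) = 0"
    proof
      fix i assume i: "i \<in> {..<tensor_dim K} - prod_encode ` ?A"
      obtain p q where pq: "prod_decode i = (p, q)" by force
      have "i = prod_encode (p, q)" by (metis pq prod_decode_inverse)
      then have "K \<le> p \<or> K \<le> q" using i by auto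
      then show "f (prod_decode i) = 0" unfolding pq by (rule assms)
    qed
  qed simp
  also have "\<dots> = (\<Sum>x\<in>?A. f x)"
    by (subst sum.reindex[OF inj_prod_encode]) simp
  also have "\<dots> = (\<Sum>p<K. \<Sum>q<K. f (p, q))" by (simp add: sum.cartesian_product)
  finally show ?thesis .
qed

section \<open>Linear and quadratic forms in a configuration\<close>

definition lin_form :: "nat \<Rightarrow> (nat \<Rightarrow> rat) \<Rightarrow> (config \<Rightarrow> real) \<Rightarrow> bool" where
  "lin_form K u F \<longleftrightarrow> (\<forall>c. F c = (\<Sum>p<K. real_of_rat (u p) * real (config_vec K c p)))"

definition quad_form :: "nat \<Rightarrow> (nat \<Rightarrow> rat) \<Rightarrow> (config \<Rightarrow> real) \<Rightarrow> bool" where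
  "quad_form K w F \<longleftrightarrow> (\<forall>c. F c = (\<Sum>i<tensor_dim K. real_of_rat (w i) * config_tensor K c i))"

text \<open>The reason for passing to the tensor: a product of two linear forms in the vector is
  linear in \<open>config_tensor\<close>. This serves both the updated tensor entries and the
  squared errors.\<close>

lemma lin_form_mult:
  assumes "lin_form K u F" "lin_form K u' G"
  shows "quad_form K (\<lambda>i. u (fst (prod_decode i)) * u' (snd (prod_decode i))) (\<lambda>c. F c * G c)"
  unfolding quad_form_def
proof
  fix c
  let ?x = "\<lambda>p. real (config_vec K c p)"
  let ?f = "\<lambda>(p, q). real_of_rat (u p) * ?x p * (real_of_rat (u' q) * ?x q)"
  have "F c * G c = (\<Sum>p<K. \<Sum>q<K. ?f (p, q))"
    using assms by (simp add: lin_form_def sum_product)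
  also have "\<dots> = (\<Sum>i<tensor_dim K. ?f (prod_decode i))"
    by (rule sum_tensor_dim[symmetric]) (auto simp: config_vec_def)
  also have "\<dots> = (\<Sum>i<tensor_dim K. real_of_rat (u (fst (prod_decode i)) * u' (snd (prod_decode i))) * config_tensor K c i)"
    by (intro sum.cong) (auto simp: config_tensor_def case_prod_unfold of_rat_mult)
  finally show "F c * G c = \<dots>" .
qed

lemma quad_form_add: "quad_form K u F \<Longrightarrow> quad_form K w G \<Longrightarrow> quad_form K (\<lambda>i. u i + w i) (\<lambda>c. F c + G c)"
  by (simp add: quad_form_def of_rat_add distrib_right sum.distrib)

lemma quad_form_diff: "quad_form K u F \<Longrightarrow> quad_form K w G \<Longrightarrow> quad_form K (\<lambda>i. u i - w i) (\<lambda>c. F c - G c)"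
  by (simp add: quad_form_def of_rat_diff left_diff_distrib sum_subtractf)

text \<open>The coefficients of an updated coordinate end up in transition probabilities, so they
  must be nonnegative. Errors may use differences, since they only perturb \<open>R\<close>.\<close>

definition nonneg_lin :: "nat \<Rightarrow> (config \<Rightarrow> real) \<Rightarrow> bool" where
  "nonneg_lin K F \<longleftrightarrow> (\<exists>u. (\<forall>p. 0 \<le> u p) \<and> lin_form K u F)"

lemma nonneg_lin_coord:
  assumes "p < K"
  shows "nonneg_lin K (\<lambda>c. real (config_vec K c p))"
  unfolding nonneg_lin_def lin_form_def
proof (intro exI conjI allI)
  let ?u = "\<lambda>q. if q = p then 1 else (0::rat)"
  show "0 \<le> ?u q" for q by simp
  fix c
  have "(\<Sum>q<K. real_of_rat (?u q) * real (config_vec K c q)) = (\<Sum>q<K. if q = p then real (config_vec K c q) else 0)"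
    by (intro sum.cong) auto
  then show "real (config_vec K c p) = (\<Sum>q<K. real_of_rat (?u q) * real (config_vec K c q))"
    using assms by simp
qed

lemma nonneg_lin_add: "nonneg_lin K F \<Longrightarrow> nonneg_lin K G \<Longrightarrow> nonneg_lin K (\<lambda>c. F c + G c)"
  unfolding nonneg_lin_def lin_form_def
proof (elim exE conjE)
  fix u w assume a: "\<forall>p. 0 \<le> u p" "\<forall>c. F c = (\<Sum>p<K. real_of_rat (u p) * real (config_vec K c p))"
    "\<forall>p. 0 \<le> w p" "\<forall>c. G c = (\<Sum>p<K. real_of_rat (w p) * real (config_vec K c p))"
  then show "\<exists>u. (\<forall>p. 0 \<le> u p) \<and> (\<forall>c. F c + G c = (\<Sum>p<K. real_of_rat (u p) * real (config_vec K c p)))"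
    by (intro exI[of _ "\<lambda>p. u p + w p"]) (simp add: of_rat_add distrib_right sum.distrib)
qed

lemma nonneg_lin_zero: "nonneg_lin K (\<lambda>c. 0)"
  unfolding nonneg_lin_def lin_form_def by (intro exI[of _ "\<lambda>_. 0"]) simp

lemma nonneg_lin_one: "0 < K \<Longrightarrow> nonneg_lin K (\<lambda>c. 1)"
  using nonneg_lin_coord[of 0 K] by (simp add: config_vec_def)

lemma nonneg_lin_const: "0 < K \<Longrightarrow> nonneg_lin K (\<lambda>c. real n)"
proof (induction n)
  case 0
  show ?case using nonneg_lin_zero by simp
next
  case (Suc n)
  then show ?case using nonneg_lin_add[OF nonneg_lin_one Suc.IH] by (simp add: add.commute)
qed

lemma nonneg_lin_pc: "1 < K \<Longrightarrow> nonneg_lin K (\<lambda>c. real (fst c))"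
  using nonneg_lin_coord[of 1 K] by (simp add: config_vec_def)

lemma nonneg_lin_reg: "r + 2 < K \<Longrightarrow> nonneg_lin K (\<lambda>c. real (snd c r))"
  using nonneg_lin_coord[of "r + 2" K] by (simp add: config_vec_def)

lemma lin_form_diff:
  assumes "nonneg_lin K F" "nonneg_lin K G"
  obtains u where "lin_form K u (\<lambda>c. F c - G c)"
proof -
  obtain u w where "lin_form K u F" "lin_form K w G" using assms by (auto simp: nonneg_lin_def)
  then have "lin_form K (\<lambda>p. u p - w p) (\<lambda>c. F c - G c)"
    by (simp add: lin_form_def of_rat_diff left_diff_distrib sum_subtractf)
  then show ?thesis by (rule that)
qed

lemma nonneg_lin_edge_nxt:
  assumes "2 \<le> K" "\<forall>r\<in>act_regs a. r + 2 < K"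
  shows "nonneg_lin K (\<lambda>c. real (config_vec K (edge_nxt (i, a, j) c) p))"
proof (cases "p < K")
  case True
  consider "p = 0" | "p = 1" | r where "p = r + 2" by (metis One_nat_def add_2_eq_Suc' not0_implies_Suc)
  then show ?thesis
  proof cases
    case 1
    then show ?thesis using assms(1) nonneg_lin_one[of K] by (simp add: config_vec_def)
  next
    case 2
    then show ?thesis using assms(1) nonneg_lin_const[of K j] by (simp add: config_vec_def edge_nxt_def)
  next
    case (3 r)
    have "nonneg_lin K (\<lambda>c. real (act_upd a (snd c) r))"
    proof (cases a)
      case (Inc q)
      have "nonneg_lin K (\<lambda>c. real (snd c r) + 1)"
        using True 3 by (intro nonneg_lin_add nonneg_lin_reg nonneg_lin_one) auto
      then show ?thesis using Inc 3 True nonneg_lin_reg[of r K] by (cases "r = q") (auto simp: add.commute)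
    next
      case (Cpy r' q)
      then show ?thesis using 3 True assms(2) nonneg_lin_reg[of r K] nonneg_lin_reg[of q K] by (cases "r = r'") auto
    next
      case (Clr q)
      then show ?thesis using 3 True nonneg_lin_reg[of r K] nonneg_lin_zero[of K] by (cases "r = q") auto
    next
      case (Chk r' q)
      then show ?thesis using 3 True nonneg_lin_reg[of r K] by simp
    qed
    then show ?thesis using 3 True by (simp add: config_vec_def edge_nxt_def)
  qed
next
  case False
  then show ?thesis using nonneg_lin_zero[of K] by (simp add: config_vec_def)
qed

lemma quad_form_edge_nxt:
  assumes "2 \<le> K" "\<forall>r\<in>act_regs a. r + 2 < K"
  shows "\<exists>w. (\<forall>i. 0 \<le> w i) \<and> quad_form K w (\<lambda>c. config_tensor K (edge_nxt (i, a, j) c) k)"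
proof -
  obtain u u' where "\<forall>p. 0 \<le> u p" "\<forall>p. 0 \<le> u' p"
    "lin_form K u (\<lambda>c. real (config_vec K (edge_nxt (i, a, j) c) (fst (prod_decode k))))"
    "lin_form K u' (\<lambda>c. real (config_vec K (edge_nxt (i, a, j) c) (snd (prod_decode k))))"
    using nonneg_lin_edge_nxt[OF assms] unfolding nonneg_lin_def by meson
  then show ?thesis
    using lin_form_mult unfolding config_tensor_def
    by (intro exI[of _ "\<lambda>i. u (fst (prod_decode i)) * u' (snd (prod_decode i))"]) auto
qed

lemma quad_form_square_diff:
  assumes "nonneg_lin K F" "nonneg_lin K G"
  shows "\<exists>w. quad_form K w (\<lambda>c. (F c - G c)\<^sup>2)"
proof -
  obtain u where "lin_form K u (\<lambda>c. F c - G c)" using lin_form_diff[OF assms] .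
  from lin_form_mult[OF this this] show ?thesis unfolding power2_eq_square by blast
qed

lemma quad_form_edge_err:
  assumes "2 \<le> K" "\<forall>r\<in>act_regs a. r + 2 < K"
  shows "\<exists>w. quad_form K w (edge_err (i, a, j))"
proof -
  obtain w where w: "quad_form K w (\<lambda>c. (real (fst c) - real i)\<^sup>2)"
    using quad_form_square_diff[OF nonneg_lin_pc nonneg_lin_const, of K i] assms(1) by auto
  have "\<exists>F G. nonneg_lin K F \<and> nonneg_lin K G \<and> (\<lambda>c. act_err a (snd c)) = (\<lambda>c. F c - G c)"
  proof (cases "\<exists>r q. a = Chk r q")
    case True
    then obtain r q where "a = Chk r q" by blast
    then show ?thesis using assms(2) nonneg_lin_reg[of r K] nonneg_lin_reg[of q K]
      by (intro exI[of _ "\<lambda>c. real (snd c r)"] exI[of _ "\<lambda>c. real (snd c q)"]) auto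
  next
    case False
    then have "act_err a s = 0" for s by (cases a) auto
    then show ?thesis using nonneg_lin_zero by (intro exI[of _ "\<lambda>c. 0"]) auto
  qed
  then obtain F G where FG: "nonneg_lin K F" "nonneg_lin K G" "\<And>c. act_err a (snd c) = F c - G c" by metis
  obtain w' where "quad_form K w' (\<lambda>c. (act_err a (snd c))\<^sup>2)"
    unfolding FG(3) using quad_form_square_diff[OF FG(1,2)] by blast
  from quad_form_add[OF w this] show ?thesis by (auto simp: edge_err_def[abs_def])
qed

lemma quad_form_final_err:
  assumes "2 \<le> K"
  shows "\<exists>w. quad_form K w (\<lambda>c. (real (fst c) - real l)\<^sup>2 - 1)"
proof -
  obtain w where w: "quad_form K w (\<lambda>c. (real (fst c) - real l)\<^sup>2)"
    using quad_form_square_diff[OF nonneg_lin_pc nonneg_lin_const, of K l] assms by auto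
  \<comment> \<open>The constant 1 is the square of \<open>1 - 0\<close>, hence again a quadratic
    form.\<close>
  obtain w' where w': "quad_form K w' (\<lambda>c. ((\<lambda>c. 1) c - (\<lambda>c. 0) c)\<^sup>2)"
    using quad_form_square_diff[OF nonneg_lin_one nonneg_lin_zero, of K] assms by auto
  from quad_form_diff[OF w w'] show ?thesis by auto
qed

text \<open>The only nonzero coordinates of the initial vector are 0 and 2 (values 1 and \<open>n\<close>); their pairs are
  encoded by \<open>prod_encode\<close> as 0, 3, 5 and 12.\<close>

definition input_weight :: "nat \<Rightarrow> nat \<Rightarrow> nat" where
  "input_weight n i = (if i = 0 then 1 else if i = 3 \<or> i = 5 then n else if i = 12 then n * n else 0)"

lemma config_tensor_input:
  assumes "3 \<le> K"
  shows "config_tensor K (0, (\<lambda>_. 0)(0 := n)) i = real (input_weight n i)"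
proof -
  obtain p q where pq: "prod_decode i = (p, q)" by force
  then have i: "i = prod_encode (p, q)" by (metis prod_decode_inverse)
  have x: "config_vec K (0, (\<lambda>_. 0)(0 := n)) r = (if r = 0 then 1 else if r = 2 then n else 0)" for r
    using assms by (auto simp: config_vec_def)
  have enc: "prod_encode (0, 0) = 0" "prod_encode (0, 2) = 3" "prod_encode (2, 0) = 5" "prod_encode (2, 2) = 12"
    by (simp_all add: prod_encode_def triangle_def)
  have neq: "i \<noteq> 0" "i \<noteq> 3" "i \<noteq> 5" "i \<noteq> 12" if "\<not> (p \<in> {0, 2} \<and> q \<in> {0, 2})"
    using that enc pq by (metis Pair_inject insertI1 insertI2 prod_encode_inverse)+
  show ?thesis
  proof (cases "p \<in> {0, 2} \<and> q \<in> {0, 2}")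
    case True
    then show ?thesis using enc by (auto simp: config_tensor_def pq x input_weight_def i)
  next
    case False
    then show ?thesis using neq by (auto simp: config_tensor_def pq x input_weight_def)
  qed
qed

section \<open>The initial distribution and the automaton of a list of edges\<close>

definition input_dist :: "nat \<Rightarrow> nat \<Rightarrow> rat" where
  "input_dist n i = of_nat (input_weight n i) / of_nat ((n + 1) * (n + 1))"

lemma sum_input_weight:
  assumes "13 \<le> D"
  shows "(\<Sum>i<D. input_weight n i) = (n + 1) * (n + 1)"
proof -
  have "(\<Sum>i<D. input_weight n i) = (\<Sum>i\<in>{0, 3, 5, 12}. input_weight n i)"
    using assms by (intro sum.mono_neutral_right) (auto simp: input_weight_def)
  also have "\<dots> = (n + 1) * (n + 1)" by (simp add: input_weight_def)
  finally show ?thesis .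
qed

lemma edges_instance:
  fixes es :: "(nat \<times> act \<times> nat) list"
  shows "\<exists>D L P R. 13 \<le> D \<and> (\<forall>n. valid_instance (mdp_inst D L P R (input_dist n)) \<and>
    (gen_dist_min_yes (mdp_inst D L P R (input_dist n)) \<longleftrightarrow>
      (\<exists>t. ((0, (\<lambda>_. 0)(0 := n)), (l, t)) \<in> (edge_step (set es))\<^sup>*)))"
proof -
  \<comment> \<open>Letter \<open>a < M\<close> stands for edge number \<open>a\<close>, and letter
    \<open>M\<close> for the claim that location \<open>l\<close> has been reached.\<close>
  define M where "M = length es"
  have "finite (\<Union>(i, a, j)\<in>set es. act_regs a)"
  proof (intro finite_UN_I)
    fix e assume "e \<in> set es"
    have "finite (act_regs a)" for a by (cases a) auto
    then show "finite (case e of (i, a, j) \<Rightarrow> act_regs a)" by (auto split: prod.splits)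
  qed simp
  then obtain k where k: "\<forall>r\<in>(\<Union>(i, a, j)\<in>set es. act_regs a). r \<le> k"
    using finite_nat_set_iff_bounded_le by blast
  \<comment> \<open>Registers up to \<open>k\<close> occupy the coordinates up to
    \<open>k + 2\<close>; in particular the input register 0 is always included.\<close>
  define K where "K = k + 3"
  have regs: "\<forall>r\<in>act_regs a. r + 2 < K" if "(i, a, j) \<in> set es" for i a j
    using k that unfolding K_def by fastforce
  have K: "3 \<le> K" by (simp add: K_def)
  define D where "D = tensor_dim K"
  have D: "13 \<le> D"
    using triangle_mono[of 6 "2 * K"] K by (simp add: D_def tensor_dim_def triangle_def)
  have "\<exists>w. (\<forall>i. 0 \<le> w i) \<and> quad_form K w (\<lambda>c. config_tensor K (edge_nxt (es ! a) c) j)" if "a < M" for a j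
  proof -
    obtain i b j' where e: "es ! a = (i, b, j')" by (metis surj_pair)
    moreover have "(i, b, j') \<in> set es" using that e unfolding M_def by (metis nth_mem)
    ultimately show ?thesis using quad_form_edge_nxt[of K b i j' j] regs K by simp
  qed
  \<comment> \<open>In \<open>T a j i\<close> the target \<open>j\<close> precedes the source
    \<open>i\<close>, as \<open>T a j\<close> is the form computing the new entry \<open>j\<close>;
    in \<open>P a i j\<close> the order is reversed.\<close>
  then obtain T where T: "\<And>a i j. a < M \<Longrightarrow> 0 \<le> T a j i"
    "\<And>a j. a < M \<Longrightarrow> quad_form K (T a j) (\<lambda>c. config_tensor K (edge_nxt (es ! a) c) j)" by metis
  have "\<exists>w. quad_form K w (edge_err (es ! a))" if "a < M" for a
  proof -
    obtain i b j' where e: "es ! a = (i, b, j')" by (metis surj_pair)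
    moreover have "(i, b, j') \<in> set es" using that e unfolding M_def by (metis nth_mem)
    ultimately show ?thesis using quad_form_edge_err[of K b i j'] regs K by simp
  qed
  then obtain Q0 where Q0: "\<And>a. a < M \<Longrightarrow> quad_form K (Q0 a) (edge_err (es ! a))" by metis
  obtain Q1 where Q1: "quad_form K Q1 (\<lambda>c. (real (fst c) - real l)\<^sup>2 - 1)"
    using quad_form_final_err[of K l] K by auto
  define Q where "Q = (\<lambda>a. if a < M then Q0 a else Q1)"
  define L where "L = Suc M"
  \<comment> \<open>The total of all coefficients bounds every row sum of \<open>T\<close>, and the
    factor 2 brings the rows of \<open>P\<close> below 1/2.\<close>
  define C :: rat where "C = 2 * (1 + (\<Sum>a<M. \<Sum>i<D. \<Sum>j<D. T a j i))"
  \<comment> \<open>The coefficients \<open>Q\<close> have arbitrary sign. As the rows of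
    \<open>P\<close> sum to at most 1/2, the unperturbed rejection probability is at least 1/4, and
    so is the escape probability; a perturbation of at most 1/4 keeps both nonnegative.\<close>
  define \<delta> :: rat where "\<delta> = 1 / (4 * (1 + (\<Sum>a<L. \<Sum>i<D. \<bar>Q a i\<bar>)))"
  define P where "P = (\<lambda>a i j. if a < M then T a j i / C else 0)"
  define R where "R = (\<lambda>a i. 1 / 2 * (1 - (\<Sum>j<D. P a i j)) + \<delta> * Q a i)"
  have T_sum: "(\<Sum>j<D. T a j i) \<le> (\<Sum>a<M. \<Sum>i<D. \<Sum>j<D. T a j i)" if "a < M" "i < D" for a i
  proof -
    have "(\<Sum>j<D. T a j i) \<le> (\<Sum>i<D. \<Sum>j<D. T a j i)"
      using that T(1) by (intro member_le_sum) (auto intro!: sum_nonneg)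
    also have "\<dots> \<le> (\<Sum>a<M. \<Sum>i<D. \<Sum>j<D. T a j i)"
      using that T(1) by (intro member_le_sum[of a "{..<M}" "\<lambda>a. \<Sum>i<D. \<Sum>j<D. T a j i"]) (auto intro!: sum_nonneg)
    finally show ?thesis .
  qed
  have "0 \<le> (\<Sum>a<M. \<Sum>i<D. \<Sum>j<D. T a j i)" using T(1) by (intro sum_nonneg) auto
  then have C: "2 \<le> C" by (simp add: C_def)
  have P_half: "(\<Sum>j<D. P a i j) \<le> 1 / 2" if "i < D" for a i
  proof (cases "a < M")
    case True
    have "(\<Sum>j<D. T a j i) \<le> 1 / 2 * C" using T_sum[OF True that] by (simp add: C_def)
    then show ?thesis using C True by (simp add: P_def sum_divide_distrib[symmetric] field_simps)
  qed (simp add: P_def)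
  have P_nonneg: "0 \<le> P a i j" for a i j using T(1) C by (simp add: P_def)
  have Q_nonneg: "0 \<le> (\<Sum>a<L. \<Sum>i<D. \<bar>Q a i\<bar>)" by (intro sum_nonneg) auto
  have \<delta>: "0 < \<delta>" using Q_nonneg by (simp add: \<delta>_def)
  have \<delta>_Q: "\<bar>\<delta> * Q a i\<bar> \<le> 1 / 4" if "a < L" "i < D" for a i
  proof -
    have "\<bar>Q a i\<bar> \<le> (\<Sum>i<D. \<bar>Q a i\<bar>)" using that by (intro member_le_sum) auto
    also have "\<dots> \<le> (\<Sum>a<L. \<Sum>i<D. \<bar>Q a i\<bar>)"
      using that by (intro member_le_sum[of a "{..<L}" "\<lambda>a. \<Sum>i<D. \<bar>Q a i\<bar>"]) (auto intro!: sum_nonneg)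
    finally have "\<bar>Q a i\<bar> \<le> 1 + (\<Sum>a<L. \<Sum>i<D. \<bar>Q a i\<bar>)" by simp
    then show ?thesis using Q_nonneg \<delta> by (simp add: abs_mult) (simp add: \<delta>_def field_simps)
  qed
  define X where "X = config_tensor K"
  define nxt where "nxt = (\<lambda>a. edge_nxt (es ! a))"
  define err where "err = (\<lambda>a c. if a < M then edge_err (es ! a) c else (real (fst c) - real l)\<^sup>2)"
  have "valid_instance (mdp_inst D L P R (input_dist n)) \<and>
    (gen_dist_min_yes (mdp_inst D L P R (input_dist n)) \<longleftrightarrow>
      (\<exists>t. ((0, (\<lambda>_. 0)(0 := n)), (l, t)) \<in> (edge_step (set es))\<^sup>*))" for n
  proof -
    let ?c0 = "(0, (\<lambda>_. 0)(0 := n))"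
    have X0: "X ?c0 i = real (input_weight n i)" for i unfolding X_def by (rule config_tensor_input[OF K])
    have S0: "(\<Sum>i<D. X ?c0 i) = real ((n + 1) * (n + 1))"
      unfolding X0 sum_input_weight[OF D, symmetric] by simp
    have Rsum: "(\<Sum>i<D. X c i * real_of_rat (R a i)) = 1 / 2 * ((\<Sum>i<D. X c i) -
        (\<Sum>j<D. \<Sum>i<D. X c i * real_of_rat (P a i j))) + real_of_rat \<delta> * (\<Sum>i<D. real_of_rat (Q a i) * X c i)" for a c
    proof -
      have "(\<Sum>j<D. \<Sum>i<D. X c i * real_of_rat (P a i j)) = (\<Sum>i<D. X c i * (\<Sum>j<D. real_of_rat (P a i j)))"
        by (subst sum.swap) (simp add: sum_distrib_left)
      moreover have "X c i * real_of_rat (R a i) = 1 / 2 * X c i - 1 / 2 * (X c i * (\<Sum>j<D. real_of_rat (P a i j)))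
          + real_of_rat \<delta> * (real_of_rat (Q a i) * X c i)" for i
        by (simp add: R_def of_rat_add of_rat_mult of_rat_diff of_rat_divide of_rat_sum algebra_simps)
      ultimately show ?thesis
        by (simp add: sum.distrib sum_subtractf sum_distrib_left[symmetric] sum_divide_distrib[symmetric] right_diff_distrib)
    qed
    have step: "(\<Sum>i<D. X c i * real_of_rat (P a i j)) = X (nxt a c) j / real_of_rat C" if "a < M" for a c j
    proof -
      have "X (nxt a c) j = (\<Sum>i<D. real_of_rat (T a j i) * X c i)"
        using T(2)[OF that, of j] by (simp add: quad_form_def X_def nxt_def D_def)
      then show ?thesis using that by (simp add: P_def of_rat_divide sum_divide_distrib mult.commute)
    qed
    have nz: "(of_nat ((n + 1) * (n + 1)) :: rat) \<noteq> 0" by (simp only: of_nat_eq_0_iff) simp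
    interpret weighted_pfa D L P R "input_dist n" X nxt err M "real_of_rat C" "real_of_rat \<delta>" ?c0
    proof
      show "2 \<le> D" using D by simp
      show "0 < L" "L = Suc M" by (simp_all add: L_def)
      show "0 \<le> P a i j" for a i j by (rule P_nonneg)
      show "0 \<le> R a i" if "a < L" "i < D" for a i
        using P_half[OF that(2), of a] \<delta>_Q[OF that] by (simp add: R_def abs_le_iff field_simps)
      show "R a i + (\<Sum>j<D. P a i j) \<le> 1" if "a < L" "i < D" for a i
        using P_half[OF that(2), of a] \<delta>_Q[OF that] by (simp add: R_def abs_le_iff field_simps)
      show "0 \<le> input_dist n i" for i by (simp add: input_dist_def)
      have "(\<Sum>i<D. input_dist n i) = of_nat (\<Sum>i<D. input_weight n i) / of_nat ((n + 1) * (n + 1))"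
        unfolding input_dist_def by (simp add: sum_divide_distrib)
      then show "(\<Sum>i<D. input_dist n i) = 1" unfolding sum_input_weight[OF D] by (simp only: divide_self[OF nz])
      show "1 \<le> real_of_rat C" using C by (metis (no_types) of_rat_1 of_rat_less_eq one_le_numeral order_trans)
      show "0 < real_of_rat \<delta>" using \<delta> by simp
      show "0 \<le> X c i" for c i by (simp add: X_def config_tensor_def)
      show "(\<Sum>i<D. X c i * real_of_rat (P a i j)) = X (nxt a c) j / real_of_rat C" if "a < M" for a c j
        by (rule step[OF that])
      show "P M i j = 0" for i j by (simp add: P_def)
      show "(\<Sum>j<D. P a i j) \<le> 1 / 2" if "i < D" for a i by (rule P_half[OF that])
      show "(\<Sum>i<D. X c i * real_of_rat (R a i)) =
        1 / 2 * ((\<Sum>i<D. X c i) - (\<Sum>j<D. X (nxt a c) j) / real_of_rat C) + real_of_rat \<delta> * err a c" if "a < M" for a c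
      proof -
        have "err a c = (\<Sum>i<D. real_of_rat (Q a i) * X c i)"
          using Q0[OF that] that by (simp add: quad_form_def err_def Q_def X_def D_def)
        then show ?thesis unfolding Rsum using step[OF that] by (simp add: sum_divide_distrib)
      qed
      show "(\<Sum>i<D. X c i * real_of_rat (R M i)) = 1 / 2 * (\<Sum>i<D. X c i) + real_of_rat \<delta> * (err M c - 1)" for c
      proof -
        have "err M c - 1 = (\<Sum>i<D. real_of_rat (Q M i) * X c i)"
          using Q1 by (simp add: quad_form_def err_def Q_def X_def D_def)
        then show ?thesis unfolding Rsum by (simp add: P_def)
      qed
      show "err a c = 0 \<or> 1 \<le> err a c" for a c
      proof (cases "a < M")
        case True
        then show ?thesis using edge_err_cases by (simp add: err_def)
      next
        case False
        then show ?thesis by (intro Ints_nonneg_cases) (auto simp: err_def)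
      qed
      show "0 < (\<Sum>i<D. X ?c0 i)" unfolding S0 by (simp only: of_nat_0_less_iff) simp
      show "real_of_rat (input_dist n i) * (\<Sum>i<D. X ?c0 i) = X ?c0 i" for i
      proof -
        have "input_dist n i * of_nat ((n + 1) * (n + 1)) = of_nat (input_weight n i)"
          unfolding input_dist_def by (rule nonzero_eq_divide_eq[OF nz, THEN iffD1, OF refl])
        then have "real_of_rat (input_dist n i) * real_of_rat (of_nat ((n + 1) * (n + 1))) = real_of_rat (of_nat (input_weight n i))"
          by (metis of_rat_mult)
        then show ?thesis unfolding S0 unfolding X0 by (simp only: of_rat_of_nat_eq)
      qed
    qed
    have "good c \<longleftrightarrow> (\<exists>t. (c, (l, t)) \<in> (edge_step (set es))\<^sup>*)" for c
    proof
      assume "good c"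
      then show "\<exists>t. (c, (l, t)) \<in> (edge_step (set es))\<^sup>*"
      proof (induction rule: good.induct)
        case (final c)
        then have "fst c = l" by (simp add: err_def)
        then show ?case by (metis prod.collapse rtrancl.rtrancl_refl)
      next
        case (step a c)
        obtain i b j where e: "es ! a = (i, b, j)" by (metis surj_pair)
        have E: "(i, b, j) \<in> set es" using step(1) e unfolding M_def by (metis nth_mem)
        have ok: "fst c = i" "act_ok b (snd c)"
          using step(1,2) e by (simp_all add: err_def edge_err_eq_0)
        have "((i, snd c), (j, act_upd b (snd c))) \<in> edge_step (set es)"
          using E ok(2) by (intro edge_stepI) (auto simp: mem_act_rel)
        moreover have "(i, snd c) = c" "nxt a c = (j, act_upd b (snd c))"
          using ok(1) by (auto simp: nxt_def edge_nxt_def e)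
        ultimately have "(c, nxt a c) \<in> edge_step (set es)" by simp
        then show ?case using step(4) by (meson converse_rtrancl_into_rtrancl)
      qed
    next
      assume "\<exists>t. (c, (l, t)) \<in> (edge_step (set es))\<^sup>*"
      then obtain t where "(c, (l, t)) \<in> (edge_step (set es))\<^sup>*" by blast
      then show "good c"
      proof (induction rule: converse_rtrancl_induct)
        case base
        show ?case by (rule good.final) (simp add: err_def)
      next
        case (step c d)
        from step(1) obtain i s j b where b: "c = (i, s)" "(i, b, j) \<in> set es" "act_ok b s" "d = (j, act_upd b s)"
          by (auto simp: edge_step_def mem_act_rel)
        then obtain a where a: "a < M" "es ! a = (i, b, j)" unfolding M_def by (metis in_set_conv_nth)
        have "d = nxt a c" using b a by (simp add: nxt_def edge_nxt_def)
        moreover have "err a c = 0" using a b by (simp add: err_def edge_err_eq_0)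
        ultimately show ?case using good.step[OF a(1)] step(3) by blast
      qed
    qed
    then show ?thesis using valid_inst yes_iff_good by simp
  qed
  then show ?thesis using D by blast
qed

section \<open>Diagonalisation\<close>

text \<open>The code of a list with a fixed tail is computed from the code of that tail; neither its
  entries nor its length are consulted.\<close>

lemma list_encode_append:
  "list_encode (xs @ ys) = foldr (\<lambda>x t. Suc (prod_encode (x, t))) xs (list_encode ys)"
  by (induction xs) auto

lemma computable1_foldr_encode:
  assumes "\<And>F. F \<in> set Fs \<Longrightarrow> computable1 F" "computable1 G"
  shows "computable1 (\<lambda>n. foldr (\<lambda>x t. Suc (prod_encode (x, t))) (map (\<lambda>F. F n) Fs) (G n))"
  using assms(1)
proof (induction Fs)
  case Nil
  show ?case using assms(2) by simp
next
  case (Cons F Fs)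
  then have "computable1 F" "computable1 (\<lambda>n. foldr (\<lambda>x t. Suc (prod_encode (x, t))) (map (\<lambda>F. F n) Fs) (G n))"
    by auto
  then show ?case
    unfolding list.map foldr.simps comp_def by (intro computable1_Suc computable1_prod_encode)
qed

text \<open>Coprimality makes \<open>quotient_of\<close> return the given pair, so no gcd has to be
  computed; \<open>int_encode\<close> doubles a nonnegative integer.\<close>

lemma rat_code_quotient:
  assumes "coprime a b" "0 < b"
  shows "rat_code (of_nat a / of_nat b) = prod_encode (2 * a, 2 * b)"
proof -
  have "(of_nat a / of_nat b :: rat) = Fract (int a) (int b)" by (simp add: Fract_of_int_quotient)
  then have "quotient_of (of_nat a / of_nat b) = (int a, int b)"
    using assms by (simp add: quotient_of_Fract normalize_stable)
  then show ?thesis by (simp add: rat_code_def int_encode_def sum_encode_def)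
qed

text \<open>The numerators 1, \<open>n\<close> and \<open>n * n\<close> are all coprime to
  \<open>(n + 1) * (n + 1)\<close>, so the fractions are in lowest terms; all other entries are
  constantly 0.\<close>

lemma computable1_input_code: "computable1 (\<lambda>n. rat_code (input_dist n u))"
proof (cases "u \<in> {0, 3, 5, 12}")
  case True
  have "rat_code (input_dist n u) = prod_encode (2 * input_weight n u, 2 * ((n + 1) * (n + 1)))" for n
    unfolding input_dist_def
  proof (rule rat_code_quotient)
    have "coprime n (n + 1)" by simp
    then have "coprime n ((n + 1) * (n + 1))" by (simp only: coprime_mult_right_iff)
    then show "coprime (input_weight n u) ((n + 1) * (n + 1))"
      using True unfolding input_weight_def by (auto simp only: coprime_mult_left_iff coprime_1_left split: if_splits)
  qed simp
  moreover have "computable1 (\<lambda>n. input_weight n u)"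
    unfolding input_weight_def
    by (cases "u = 0"; cases "u = 3 \<or> u = 5"; cases "u = 12")
      (simp_all add: computable1_const computable1_id computable1_mult)
  then have "computable1 (\<lambda>n. prod_encode (2 * input_weight n u, 2 * ((n + 1) * (n + 1))))"
    by (intro computable1_prod_encode computable1_mult computable1_add computable1_const computable1_id)
  ultimately show ?thesis by simp
next
  case False
  then have "input_dist n u = 0" for n by (simp add: input_dist_def input_weight_def)
  then show ?thesis by (simp add: computable1_const)
qed

section \<open>Codes of instances as a function of the input\<close>

definition template_code ::
  "nat \<Rightarrow> nat \<Rightarrow> (nat \<Rightarrow> nat \<Rightarrow> nat \<Rightarrow> rat) \<Rightarrow> (nat \<Rightarrow> nat \<Rightarrow> rat) \<Rightarrow> nat" where
  "template_code D L P R = prod_encode (mdp_size D L, prod_encode (L,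
     prod_encode (list_encode (map (\<lambda>s. s div Suc D) [0..<mdp_size D L]),
     prod_encode (trans_code (mdp_rest D L P R),
     prod_encode (list_encode (replicate (mdp_size D L - 13) (rat_code 0)), Suc D * Suc L)))))"

definition code_at :: "nat \<Rightarrow> nat \<Rightarrow> nat" where
  "code_at k c = fst (prod_decode (((\<lambda>c. snd (prod_decode c)) ^^ k) c))"

lemma code_at_prod_encode:
  fixes a b c d e f :: nat
  defines "x \<equiv> prod_encode (a, prod_encode (b, prod_encode (c, prod_encode (d, prod_encode (e, f)))))"
  shows "code_at 0 x = a" "code_at 1 x = b" "code_at 2 x = c" "code_at 3 x = d" "code_at 4 x = e"
    "((\<lambda>c. snd (prod_decode c)) ^^ 5) x = f"
  by (simp_all add: x_def code_at_def eval_nat_numeral)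

text \<open>The number \<open>c\<close> plays two roles: its components supply the fixed data, and
  \<open>c\<close> itself is the input in \<open>input_dist c\<close>. This is the self-application
  of the diagonal argument.\<close>

definition instantiate :: "nat \<Rightarrow> nat" where
  "instantiate c = list_encode [code_at 0 c, code_at 1 c, code_at 2 c,
     Suc (prod_encode (prod_encode (((\<lambda>c. snd (prod_decode c)) ^^ 5) c, prod_encode (0,
       foldr (\<lambda>x t. Suc (prod_encode (x, t))) (map (\<lambda>u. rat_code (input_dist c u)) [0..<13]) (code_at 4 c))),
       code_at 3 c)),
     ((\<lambda>c. snd (prod_decode c)) ^^ 5) c, Suc (((\<lambda>c. snd (prod_decode c)) ^^ 5) c), rat_code (1 / 2)]"

lemma computable1_instantiate: "computable1 instantiate"
proof -
  have tl: "computable1 (\<lambda>c. ((\<lambda>c. snd (prod_decode c)) ^^ k) c)" for k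
  proof (induction k)
    case 0
    show ?case by (simp add: computable1_id)
  next
    case (Suc k)
    then show ?case unfolding funpow.simps comp_def by (rule computable1_snd_prod_decode)
  qed
  have at: "computable1 (code_at k)" for k
    using computable1_fst_prod_decode[OF tl[of k]] by (simp add: code_at_def[abs_def])
  have row: "computable1 (\<lambda>c. foldr (\<lambda>x t. Suc (prod_encode (x, t))) (map (\<lambda>u. rat_code (input_dist c u)) [0..<13]) (code_at 4 c))"
    using computable1_foldr_encode[of "map (\<lambda>u n. rat_code (input_dist n u)) [0..<13]" "code_at 4"]
      computable1_input_code at by (auto simp: comp_def)
  show ?thesis
    unfolding instantiate_def[abs_def] list_encode.simps
    by (intro computable1_Suc computable1_prod_encode tl row at computable1_const)
qed

text \<open>The row of the first source is the only part depending on the input, and its entries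
  from 13 on are 0. The code of this tail is a single number stored in the template.\<close>

lemma instantiate_template:
  assumes "13 \<le> D"
  shows "instantiate (template_code D L P R) =
    instance_code (mdp_inst D L P R (input_dist (template_code D L P R)))"
proof -
  let ?c = "template_code D L P R"
  have N: "13 \<le> mdp_size D L" using assms by (simp add: mdp_size_def)
  have "mdp_row D L P R v (Suc D * Suc L) 0 = map (\<lambda>u. if u < D then v u else 0) [0..<mdp_size D L]" for v
    by (auto simp: mdp_row_def mdp_prob_def)
  moreover have "[0..<mdp_size D L] = [0..<13] @ [13..<mdp_size D L]"
    using N by (metis le0 le_add_diff_inverse upt_add_eq_append)
  moreover have "map (\<lambda>u. if u < D then input_dist n u else 0) [0..<13] = map (input_dist n) [0..<13]" for n
    using assms by (intro map_cong) auto
  moreover have "map (\<lambda>u. if u < D then input_dist n u else 0) [13..<mdp_size D L] = replicate (mdp_size D L - 13) 0" for n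
    by (auto simp: input_dist_def input_weight_def intro!: nth_equalityI)
  ultimately have row: "mdp_row D L P R (input_dist n) (Suc D * Suc L) 0 =
      map (input_dist n) [0..<13] @ replicate (mdp_size D L - 13) 0" for n
    by simp
  have dec: "code_at 0 ?c = mdp_size D L" "code_at 1 ?c = L"
    "code_at 2 ?c = list_encode (map (\<lambda>s. s div Suc D) [0..<mdp_size D L])"
    "code_at 3 ?c = trans_code (mdp_rest D L P R)"
    "code_at 4 ?c = list_encode (replicate (mdp_size D L - 13) (rat_code 0))"
    "((\<lambda>c. snd (prod_decode c)) ^^ 5) ?c = Suc D * Suc L"
    unfolding template_code_def by (rule code_at_prod_encode)+
  show ?thesis
    unfolding instantiate_def dec instance_code_def mdp_inst_def dm_instance.simps row trans_code_def
      list.map prod.case list_encode.simps map_append map_replicate list_encode_append map_map comp_def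
    by simp
qed

theorem mainTheorem7:
  shows "\<not> gen_dist_min_decidable"
proof
  assume "gen_dist_min_decidable"
  then obtain f where f: "\<And>I. valid_instance I \<Longrightarrow> recf_eval f [instance_code I] (if gen_dist_min_yes I then 1 else 0)"
    unfolding gen_dist_min_decidable_def by blast
  obtain h where h: "\<And>c. recf_eval h [c] (instantiate c)"
    using computable1_instantiate by (auto simp: computable1_def)
  \<comment> \<open>\<open>g\<close> ignores its first argument, so \<open>Mu g\<close> stops at
    once if the decision procedure answers 0, and never if it answers 1.\<close>
  define g where "g = Comp f [Comp h [Proj 1]]"
  obtain l E where E: "finite E"
    "\<And>n. (\<exists>y. recf_eval (Mu g) [n] y) \<longleftrightarrow> (\<exists>t. ((0, (\<lambda>_. 0)(0 := n)), (l, t)) \<in> (edge_step E)\<^sup>*)"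
    by (rule recf_flow_graph[of "Mu g"]) (rule that)
  obtain es where es: "set es = E" using finite_list[OF E(1)] by blast
  from edges_instance[of l es] obtain D L P R where D: "13 \<le> D" and
    inst: "\<forall>n. valid_instance (mdp_inst D L P R (input_dist n)) \<and>
      (gen_dist_min_yes (mdp_inst D L P R (input_dist n)) \<longleftrightarrow>
        (\<exists>t. ((0, (\<lambda>_. 0)(0 := n)), (l, t)) \<in> (edge_step (set es))\<^sup>*))"
    by (elim exE conjE)
  \<comment> \<open>The input is the code of the data compiled from \<open>Mu g\<close> itself, so
    \<open>Mu g\<close> on \<open>c\<close> asks the decision procedure about its own halting and
    does the opposite.\<close>
  define c where "c = template_code D L P R"
  define I where "I = mdp_inst D L P R (input_dist c)"
  have yes: "gen_dist_min_yes I \<longleftrightarrow> (\<exists>y. recf_eval (Mu g) [c] y)"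
    unfolding I_def E(2) using inst es by simp
  have code: "instantiate c = instance_code I"
    unfolding I_def c_def by (rule instantiate_template[OF D])
  have g: "recf_eval g [k, c] (if gen_dist_min_yes I then 1 else 0)" for k
  proof -
    have "recf_eval (Comp h [Proj 1]) [k, c] (instance_code I)"
      using h[of c] unfolding code by (intro recf_eval_comp1) (auto intro: recf_eval_Proj)
    moreover have "recf_eval f [instance_code I] (if gen_dist_min_yes I then 1 else 0)"
      unfolding I_def using inst by (intro f) simp
    ultimately show ?thesis unfolding g_def by (rule recf_eval_comp1)
  qed
  show False
  proof (cases "gen_dist_min_yes I")
    case True
    then obtain y where "recf_eval (Mu g) [c] y" using yes by blast
    then have "recf_eval g [y, c] 0" by (auto elim: recf_Mu)
    from recf_eval_det[OF g[of y] this] show False using True by simp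
  next
    case False
    then have "recf_eval (Mu g) [c] 0" using g[of 0] by (intro recf_eval.mu) auto
    then show False using False yes by blast
  qed
qed

end
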